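(* For every integer $d\ge 2$, \[\mathrm{mult}_{(d-1,1)}(\mathfrak{sl}_2(\mathbb{C}),\rho^{(d)})=d-1,\] where $(d-1,1)$ is regarded as a partition of $d$.
   Context: $\mathfrak{sl}_2(\mathbb{C})$ is the Lie algebra of traceless $2\times 2$ complex matrices, and $\rho^{(d)}:\mathfrak{sl}_2(\mathbb{C})\to\mathfrak{gl}(\mathbb{C}^d)=\mathbb{C}^{d\times d}$ is its $d$-dimensional irreducible representation (unique up to isomorphism). Let $F=\mathbb{C}\langle x_1,x_2,\dots\rangle$ be the free associative $\mathbb{C}$-algebra of countable rank and $F_m=\mathbb{C}\langle x_1,\dots,x_m\rangle\subset F$. Let $I(\mathfrak{sl}_2(\mathbb{C}),\rho^{(d)})$ be the ideal of $F$ consisting of all $f$ such that, if $f\in F_m$, then $f(\rho^{(d)}(A_1),\dots,\rho^{(d)}(A_m))=0$ in $\mathbb{C}^{d\times d}$ for all $A_1,\dots,A_m\in\mathfrak{sl}_2(\mathbb{C})$. Let $P_m=\mathrm{Span}_{\mathbb{C}}\{x_{\pi(1)}\cdots x_{\pi(m)}\mid \pi\in S_m\}\subset F_m$ be the multilinear component. The symmetric group $S_m$ acts on $F_m$ by algebra automorphisms $\pi: x_i\mapsto x_{\pi(i)}$, and $P_m$ and $I(\mathfrak{sl}_2(\mathbb{C}),\rho^{(d)})\cap P_m$ are $S_m$-invariant. For a partition $\lambda\vdash m$, $\chi^\lambda$ denotes the irreducible $S_m$-character associated to $\lambda$ (so $\chi^{(m)}$ is the trivial character), and $\mathrm{mult}_{\lambda}(\mathfrak{sl}_2(\mathbb{C}),\rho^{(d)})$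 is the multiplicity of $\chi^\lambda$ in the character of the $S_m$-module $P_m/(I(\mathfrak{sl}_2(\mathbb{C}),\rho^{(d)})\cap P_m)$. *)

theory Defs
  imports
    "HOL-Library.Poly_Mapping"
    "HOL-Library.Multiset"
    "HOL-Combinatorics.Permutations"
    "HOL-Algebra.Sym_Groups"
    "Jordan_Normal_Form.VS_Connect"
begin

section \<open>Matrix representations\<close>

definition mat_trace :: "'a::comm_monoid_add mat \<Rightarrow> 'a" where
  "mat_trace A = (\<Sum>i<dim_row A. A $$ (i, i))"

definition irreducible_mats :: "nat \<Rightarrow> complex mat set \<Rightarrow> bool" where
  "irreducible_mats n S \<longleftrightarrow> n > 0 \<and>
     (\<forall>W. subspace class_ring W (module_vec TYPE(complex) n) \<longrightarrow>
        (\<forall>M\<in>S. \<forall>w\<in>W. M *\<^sub>v w \<in> W) \<longrightarrow> W = {0\<^sub>v n} \<or> W = carrier_vec n)"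

definition sl2 :: "complex mat set" where
  "sl2 = {A \<in> carrier_mat 2 2. mat_trace A = 0}"

text \<open>Representations \<open>\<rho> : sl2 \<rightarrow> gl(\<complex>\<^sup>d)\<close>; only the values of \<open>\<rho>\<close> on \<^const>\<open>sl2\<close> matter.\<close>

definition sl2_rep :: "nat \<Rightarrow> (complex mat \<Rightarrow> complex mat) \<Rightarrow> bool" where
  "sl2_rep d \<rho> \<longleftrightarrow>
     (\<forall>A\<in>sl2. \<rho> A \<in> carrier_mat d d) \<and>
     (\<forall>A\<in>sl2. \<forall>B\<in>sl2. \<rho> (A + B) = \<rho> A + \<rho> B) \<and>
     (\<forall>c. \<forall>A\<in>sl2. \<rho> (c \<cdot>\<^sub>m A) = c \<cdot>\<^sub>m \<rho> A) \<and>
     (\<forall>A\<in>sl2. \<forall>B\<in>sl2. \<rho> (A * B - B * A) = \<rho> A * \<rho> B - \<rho> B * \<rho> A)"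

definition irreducible_sl2_rep :: "nat \<Rightarrow> (complex mat \<Rightarrow> complex mat) \<Rightarrow> bool" where
  "irreducible_sl2_rep d \<rho> \<longleftrightarrow> sl2_rep d \<rho> \<and> irreducible_mats d (\<rho> ` sl2)"

definition group_rep :: "('g, 'b) monoid_scheme \<Rightarrow> nat \<Rightarrow> ('g \<Rightarrow> complex mat) \<Rightarrow> bool" where
  "group_rep G n R \<longleftrightarrow> R \<in> hom G (ring_mat TYPE(complex) n ()) \<and> R \<one>\<^bsub>G\<^esub> = 1\<^sub>m n"

text \<open>Characters are made equal to \<^const>\<open>undefined\<close> off the carrier, so that two of them are equal
  as functions iff they agree on the group.\<close>

definition irr_chars :: "('g, 'b) monoid_scheme \<Rightarrow> ('g \<Rightarrow> complex) set" where
  "irr_chars G = {\<lambda>g\<in>carrier G. mat_trace (R g) | R n.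
     group_rep G n R \<and> irreducible_mats n (R ` carrier G)}"

text \<open>The multiplicity of \<open>\<psi>\<close> in \<open>\<chi>\<close>: the number of times \<open>\<psi>\<close> occurs when \<open>\<chi>\<close> is
  written as a sum of irreducible characters.\<close>

definition char_mult :: "('g, 'b) monoid_scheme \<Rightarrow> ('g \<Rightarrow> complex) \<Rightarrow> ('g \<Rightarrow> complex) \<Rightarrow> nat" where
  "char_mult G \<psi> \<chi> = (THE k. \<exists>M. set_mset M \<subseteq> irr_chars G \<and>
     (\<forall>g\<in>carrier G. \<chi> g = (\<Sum>\<phi>\<in>#M. \<phi> g)) \<and> count M \<psi> = k)"


section \<open>Formal linear combinations and traces on quotients\<close>

definition pm_scale :: "complex \<Rightarrow> ('a \<Rightarrow>\<^sub>0 complex) \<Rightarrow> ('a \<Rightarrow>\<^sub>0 complex)" where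
  "pm_scale c p = Poly_Mapping.map ((*) c) p"

lemma lookup_pm_scale: "Poly_Mapping.lookup (pm_scale c p) x = c * Poly_Mapping.lookup p x"
  by (cases "Poly_Mapping.lookup p x = 0") (simp_all add: pm_scale_def Poly_Mapping.map.rep_eq)

global_interpretation pm: vector_space "pm_scale :: complex \<Rightarrow> ('a \<Rightarrow>\<^sub>0 complex) \<Rightarrow> _"
  by unfold_locales
    (auto intro!: poly_mapping_eqI simp: lookup_pm_scale Poly_Mapping.lookup_add algebra_simps)

definition pushforward :: "('a \<Rightarrow> 'b) \<Rightarrow> ('a \<Rightarrow>\<^sub>0 complex) \<Rightarrow> ('b \<Rightarrow>\<^sub>0 complex)" where
  "pushforward g p = (\<Sum>x\<in>Poly_Mapping.keys p. Poly_Mapping.single (g x) (Poly_Mapping.lookup p x))"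

text \<open>The residue classes of the list \<open>bs\<close> form a basis of \<open>V/W\<close>.\<close>

definition quotient_basis ::
    "('a \<Rightarrow>\<^sub>0 complex) set \<Rightarrow> ('a \<Rightarrow>\<^sub>0 complex) set \<Rightarrow> ('a \<Rightarrow>\<^sub>0 complex) list \<Rightarrow> bool" where
  "quotient_basis V W bs \<longleftrightarrow> set bs \<subseteq> V \<and>
     (\<forall>c. (\<Sum>i<length bs. pm_scale (c i) (bs ! i)) \<in> W \<longrightarrow> (\<forall>i<length bs. c i = 0)) \<and>
     (\<forall>v\<in>V. \<exists>c. v - (\<Sum>i<length bs. pm_scale (c i) (bs ! i)) \<in> W)"

text \<open>The trace of the endomorphism that \<open>T\<close> induces on the finite-dimensional space \<open>V/W\<close>
  (where \<open>W \<subseteq> V\<close> are subspaces invariant under \<open>T\<close>).\<close>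

definition quotient_trace ::
    "('a \<Rightarrow>\<^sub>0 complex) set \<Rightarrow> ('a \<Rightarrow>\<^sub>0 complex) set \<Rightarrow> (('a \<Rightarrow>\<^sub>0 complex) \<Rightarrow> ('a \<Rightarrow>\<^sub>0 complex)) \<Rightarrow> complex"
  where
  "quotient_trace V W T = (THE t. \<exists>bs M. quotient_basis V W bs \<and>
     M \<in> carrier_mat (length bs) (length bs) \<and>
     (\<forall>j<length bs. T (bs ! j) - (\<Sum>i<length bs. pm_scale (M $$ (i, j)) (bs ! i)) \<in> W) \<and>
     t = mat_trace M)"


section \<open>Specht modules\<close>

text \<open>A partition is the list of its parts in weakly decreasing order. A tableau of shape \<open>\<mu>\<close>
  is a bijective filling of the cells by \<open>1, \<dots>, m\<close>; a tabloid is given by its rows,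
  as a list of sets.\<close>

definition cells :: "nat list \<Rightarrow> (nat \<times> nat) set" where
  "cells \<mu> = {(i, j). i < length \<mu> \<and> j < \<mu> ! i}"

definition tableau :: "nat list \<Rightarrow> (nat \<times> nat \<Rightarrow> nat) \<Rightarrow> bool" where
  "tableau \<mu> t \<longleftrightarrow> bij_betw t (cells \<mu>) {1..sum_list \<mu>}"

definition tabloid :: "nat list \<Rightarrow> (nat \<times> nat \<Rightarrow> nat) \<Rightarrow> nat set list" where
  "tabloid \<mu> t = map (\<lambda>i. t ` {c \<in> cells \<mu>. fst c = i}) [0..<length \<mu>]"

definition column_stabilizer :: "nat list \<Rightarrow> (nat \<times> nat \<Rightarrow> nat) \<Rightarrow> (nat \<Rightarrow> nat) set" where
  "column_stabilizer \<mu> t = {\<sigma>. \<sigma> permutes {1..sum_list \<mu>} \<and>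
     (\<forall>j. \<sigma> ` t ` {c \<in> cells \<mu>. snd c = j} = t ` {c \<in> cells \<mu>. snd c = j})}"

definition polytabloid :: "nat list \<Rightarrow> (nat \<times> nat \<Rightarrow> nat) \<Rightarrow> (nat set list \<Rightarrow>\<^sub>0 complex)" where
  "polytabloid \<mu> t =
     (\<Sum>\<sigma>\<in>column_stabilizer \<mu> t. Poly_Mapping.single (tabloid \<mu> (\<sigma> \<circ> t)) (of_int (sign \<sigma>)))"

definition specht_module :: "nat list \<Rightarrow> (nat set list \<Rightarrow>\<^sub>0 complex) set" where
  "specht_module \<mu> = pm.span {polytabloid \<mu> t | t. tableau \<mu> t}"

definition specht_char :: "nat list \<Rightarrow> (nat \<Rightarrow> nat) \<Rightarrow> complex" where
  "specht_char \<mu> = (\<lambda>\<pi>\<in>carrier (sym_group (sum_list \<mu>)).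
     quotient_trace (specht_module \<mu>) {0} (pushforward (map ((`) \<pi>))))"


section \<open>The free algebra and the identities of a representation\<close>

text \<open>Words under concatenation; this turns \<^typ>\<open>nat list \<Rightarrow>\<^sub>0 complex\<close> into the free associative
  algebra on the letters, with the convolution product of \<^theory>\<open>HOL-Library.Poly_Mapping\<close>.\<close>

instantiation list :: (type) monoid_add
begin

definition "0 = ([] :: 'a list)"
definition "xs + ys = xs @ (ys :: 'a list)"

instance
  by standard (simp_all add: zero_list_def plus_list_def)

end

type_synonym free_algebra = "nat list \<Rightarrow>\<^sub>0 complex"

definition var :: "nat \<Rightarrow> free_algebra" where
  "var i = Poly_Mapping.single [i] 1"

text \<open>The variables are \<open>var i\<close> for \<open>i \<ge> 1\<close>; the letter \<open>0\<close> is not used.\<close>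

definition F_sub :: "nat \<Rightarrow> free_algebra set" where
  "F_sub m = {f. \<forall>w\<in>Poly_Mapping.keys f. set w \<subseteq> {1..m}}"

definition F_alg :: "free_algebra set" where
  "F_alg = (\<Union>m. F_sub m)"

text \<open>Substitution of the \<open>d \<times> d\<close> matrices \<open>X i\<close> for the variables \<open>var i\<close>.\<close>

definition eval_mat :: "nat \<Rightarrow> (nat \<Rightarrow> complex mat) \<Rightarrow> free_algebra \<Rightarrow> complex mat" where
  "eval_mat d X f = mat d d (\<lambda>(i, j).
     \<Sum>w\<in>Poly_Mapping.keys f. Poly_Mapping.lookup f w * foldr (*) (map X w) (1\<^sub>m d) $$ (i, j))"

definition identities :: "nat \<Rightarrow> (complex mat \<Rightarrow> complex mat) \<Rightarrow> free_algebra set" where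
  "identities d \<rho> = {f \<in> F_alg. \<forall>m. f \<in> F_sub m \<longrightarrow>
     (\<forall>A. (\<forall>i\<in>{1..m}. A i \<in> sl2) \<longrightarrow> eval_mat d (\<lambda>i. \<rho> (A i)) f = 0\<^sub>m d d)}"

definition multilinear :: "nat \<Rightarrow> free_algebra set" where
  "multilinear m = pm.span {prod_list (map (\<lambda>i. var (\<pi> i)) [1..<Suc m]) | \<pi>. \<pi> permutes {1..m}}"

text \<open>\<open>pushforward (map \<pi>)\<close> is the algebra endomorphism \<open>var i \<mapsto> var (\<pi> i)\<close>.\<close>

definition multilinear_char ::
    "nat \<Rightarrow> (complex mat \<Rightarrow> complex mat) \<Rightarrow> nat \<Rightarrow> (nat \<Rightarrow> nat) \<Rightarrow> complex" where
  "multilinear_char d \<rho> m = (\<lambda>\<pi>\<in>carrier (sym_group m).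
     quotient_trace (multilinear m) (identities d \<rho> \<inter> multilinear m) (pushforward (map \<pi>)))"

definition mult_sl2 :: "nat list \<Rightarrow> nat \<Rightarrow> (complex mat \<Rightarrow> complex mat) \<Rightarrow> nat" where
  "mult_sl2 \<mu> d \<rho> = char_mult (sym_group (sum_list \<mu>)) (specht_char \<mu>)
     (multilinear_char d \<rho> (sum_list \<mu>))"

end

theory Submission
  imports Defs "Jordan_Normal_Form.Spectral_Radius"
begin

text \<open>
  The character of the hook \<open>(d - 1, 1)\<close> is \<open>\<psi>(g) = |Fix g| - 1\<close>, and the multiplicity is
  \<open>\<langle>\<chi>, \<psi>\<rangle>\<close>, i.e. up to the factor \<open>d!\<close> the trace of \<open>E = \<Sum>\<^sub>g \<psi>(g) g\<close> on
  \<open>P\<^sub>d / (I \<inter> P\<^sub>d)\<close>. On the regular module \<open>P\<^sub>d\<close> that trace is \<open>d! \<psi>(1) = d! (d - 1)\<close>, so it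
  suffices that \<open>E\<close> kills \<open>I \<inter> P\<^sub>d\<close>.

  The coefficients of \<open>E f\<close> are combinations of the sums of those coefficients of \<open>f\<close> whose word
  has a prescribed letter \<open>x\<close> in a prescribed place \<open>k\<close>. Substituting \<open>\<rho>(F)\<close> for \<open>x\<close> and \<open>\<rho>(H)\<close> for all
  other variables in an identity \<open>f\<close>, and applying the result to the weight vectors
  \<open>v\<^sub>0, \<dots>, v\<^bsub>d - 2\<^esub>\<close>, shows that the binary form of degree \<open>d - 1\<close> with these sums as
  coefficients vanishes at \<open>d - 1\<close> points of the projective line; \<open>x \<mapsto> H\<close> gives the point \<open>(1 : 1)\<close>.
  A form of degree \<open>d - 1\<close> with \<open>d\<close> zeros is zero.
\<close>


section \<open>Quotients of spaces of formal linear combinations\<close>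

text \<open>The multiplicity is a definite description over decompositions of a character into
  irreducible ones. So a decomposition must be exhibited; it comes from a composition series,
  because traces add along filtrations, and orthogonality fixes its counts. The same additivity
  moves the trace of \<open>E\<close> from the regular module to the quotient.

  Where the points come from: if \<open>x\<close> stands in place k, counted from 0, the d - 1 - k
  letters to its right act on v_j and the k letters to its left on v_(j+1). The word therefore
  contributes a^k b^(d-1-k), where b is the weight of v_j and a = b - 2. The vector v_(d-1) gives
  nothing, as F kills it, so d - 1 points face d unknown coefficients. Sending \<open>x\<close> to H
  as well supplies the missing point (1 : 1), which is new because a and b differ.

  Why sums over prescribed places suffice: a fixed point i of g says that the words w and g w carry
  the letter i in the same place, and the summand -1 of \<psi> leads to the total coefficient sum,
  which splits by the first letter into sums of that kind.\<close>

abbreviation pm_linear :: "(('a \<Rightarrow>\<^sub>0 complex) \<Rightarrow> ('b \<Rightarrow>\<^sub>0 complex)) \<Rightarrow> bool" where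
  "pm_linear \<equiv> Vector_Spaces.linear pm_scale pm_scale"

lemma linearI_pm:
  fixes T :: "('a \<Rightarrow>\<^sub>0 complex) \<Rightarrow> ('b \<Rightarrow>\<^sub>0 complex)"
  assumes "\<And>p q. T (p + q) = T p + T q" "\<And>a p. T (pm_scale a p) = pm_scale a (T p)"
  shows "pm_linear T"
  by unfold_locales (simp_all add: assms pm.scale_right_distrib pm.scale_left_distrib)

definition lin_comb :: "('a \<Rightarrow>\<^sub>0 complex) list \<Rightarrow> (nat \<Rightarrow> complex) \<Rightarrow> ('a \<Rightarrow>\<^sub>0 complex)" where
  "lin_comb bs c = (\<Sum>i<length bs. pm_scale (c i) (bs ! i))"

lemma lin_comb_add: "lin_comb bs (\<lambda>i. c i + c' i) = lin_comb bs c + lin_comb bs c'"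
  by (simp add: lin_comb_def pm.scale_left_distrib sum.distrib)

lemma lin_comb_scale: "lin_comb bs (\<lambda>i. a * c i) = pm_scale a (lin_comb bs c)"
  by (simp add: lin_comb_def pm.scale_sum_right)

lemma lin_comb_diff: "lin_comb bs (\<lambda>i. c i - c' i) = lin_comb bs c - lin_comb bs c'"
  by (simp add: lin_comb_def pm.scale_left_diff_distrib sum_subtractf)

lemma lin_comb_unit:
  assumes "j < length bs" shows "lin_comb bs (\<lambda>i. if i = j then 1 else 0) = bs ! j"
proof -
  have "lin_comb bs (\<lambda>i. if i = j then 1 else 0) = (\<Sum>i<length bs. if i = j then bs ! i else 0)"
    unfolding lin_comb_def by (rule sum.cong) auto
  then show ?thesis using assms by simp
qed

lemma lin_comb_append:
  "lin_comb (bs @ cs) c = lin_comb bs c + lin_comb cs (\<lambda>i. c (length bs + i))"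
proof -
  have "{..<length bs + length cs} = {..<length bs} \<union> {length bs..<length bs + length cs}" by auto
  moreover have "(\<Sum>i\<in>{length bs..<length bs + length cs}. pm_scale (c i) ((bs @ cs) ! i))
      = (\<Sum>i<length cs. pm_scale (c (length bs + i)) (cs ! i))"
    by (rule sum.reindex_bij_witness[where i = "\<lambda>i. length bs + i" and j = "\<lambda>i. i - length bs"])
      (auto simp: nth_append)
  ultimately show ?thesis
    unfolding lin_comb_def by (simp add: sum.union_disjoint ivl_disj_int nth_append)
qed

lemma lin_comb_cong: "(\<And>i. i < length bs \<Longrightarrow> c i = c' i) \<Longrightarrow> lin_comb bs c = lin_comb bs c'"
  by (simp add: lin_comb_def)

lemma lin_comb_in_subspace:
  "pm.subspace V \<Longrightarrow> set bs \<subseteq> V \<Longrightarrow> lin_comb bs c \<in> V"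
  unfolding lin_comb_def by (intro pm.subspace_sum pm.subspace_scale) auto

locale quotient_space =
  fixes V W :: "('a \<Rightarrow>\<^sub>0 complex) set"
  assumes subspace_V: "pm.subspace V" and subspace_W: "pm.subspace W" and W_le_V: "W \<subseteq> V"

locale based_quotient = quotient_space +
  fixes bs :: "('a \<Rightarrow>\<^sub>0 complex) list"
  assumes basis: "quotient_basis V W bs"
begin

abbreviation "n \<equiv> length bs"

text \<open>Only the values at indices below \<open>n\<close> are determined by \<open>v\<close>;
  the others depend on the choice, hence the side condition \<open>i < n\<close> in the lemmas
  below.\<close>

definition coord :: "('a \<Rightarrow>\<^sub>0 complex) \<Rightarrow> nat \<Rightarrow> complex" where
  "coord v = (SOME c. v - lin_comb bs c \<in> W)"

lemma bs_in_V: "i < n \<Longrightarrow> bs ! i \<in> V"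
  using basis by (auto simp: quotient_basis_def)

lemma lin_comb_in_V: "lin_comb bs c \<in> V"
  using basis by (intro lin_comb_in_subspace subspace_V) (auto simp: quotient_basis_def)

lemma lin_comb_in_W: "lin_comb bs c \<in> W \<Longrightarrow> i < n \<Longrightarrow> c i = 0"
  using basis unfolding quotient_basis_def lin_comb_def by blast

lemma coord: "v \<in> V \<Longrightarrow> v - lin_comb bs (coord v) \<in> W"
proof -
  assume "v \<in> V"
  then have "\<exists>c. v - lin_comb bs c \<in> W"
    using basis unfolding quotient_basis_def lin_comb_def by blast
  then show ?thesis unfolding coord_def by (rule someI_ex)
qed

lemma coord_unique:
  assumes v: "v - lin_comb bs c \<in> W" and i: "i < n"
  shows "coord v i = c i"
proof -
  have "v \<in> V"
    using pm.subspace_add[OF subspace_V _ lin_comb_in_V, of "v - lin_comb bs c" c] v W_le_V by auto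
  from pm.subspace_diff[OF subspace_W v coord[OF this]]
  have "lin_comb bs (\<lambda>i. coord v i - c i) \<in> W" by (simp add: lin_comb_diff)
  from lin_comb_in_W[OF this i] show ?thesis by simp
qed

lemma coord_add:
  assumes "u \<in> V" "v \<in> V" "i < n" shows "coord (u + v) i = coord u i + coord v i"
  using pm.subspace_add[OF subspace_W coord[OF assms(1)] coord[OF assms(2)]]
  by (intro coord_unique[OF _ assms(3)]) (simp add: lin_comb_add algebra_simps)

lemma coord_scale:
  assumes "v \<in> V" "i < n" shows "coord (pm_scale a v) i = a * coord v i"
  using pm.subspace_scale[OF subspace_W coord[OF assms(1)], of a]
  by (intro coord_unique[OF _ assms(2)]) (simp add: lin_comb_scale pm.scale_right_diff_distrib)

lemma coord_in_W:
  assumes "v \<in> W" "i < n" shows "coord v i = 0"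
  by (intro coord_unique[OF _ assms(2)]) (simp add: lin_comb_def assms)

lemma coord_eq_0_imp: 
  assumes "v \<in> V" "\<And>i. i < n \<Longrightarrow> coord v i = 0" shows "v \<in> W"
proof -
  have "lin_comb bs (coord v) = 0" unfolding lin_comb_def using assms(2) by simp
  with coord[OF assms(1)] show ?thesis by simp
qed

lemma coord_lin_comb: "i < n \<Longrightarrow> coord (lin_comb bs c) i = c i"
  by (rule coord_unique) (simp_all add: pm.subspace_0[OF subspace_W])

lemma coord_basis: "i < n \<Longrightarrow> j < n \<Longrightarrow> coord (bs ! j) i = (if i = j then 1 else 0)"
  by (simp add: coord_lin_comb flip: lin_comb_unit)

lemma coord_sum:
  assumes "\<And>x. x \<in> S \<Longrightarrow> f x \<in> V" "i < n"
  shows "coord (\<Sum>x\<in>S. f x) i = (\<Sum>x\<in>S. coord (f x) i)"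
  using assms(1)
proof (induction S rule: infinite_finite_induct)
  case (insert x S)
  then show ?case
    using assms(2) by (simp add: coord_add pm.subspace_sum[OF subspace_V])
qed (simp_all add: coord_in_W pm.subspace_0[OF subspace_W] assms(2))

text \<open>A functional that kills \<open>W\<close> factors through the quotient, so the basis
  determines it. Linearity is asked on \<open>V\<close> alone because the functionals fed in are
  built from \<open>coord\<close>, which is linear there: coordinates in another basis, or
  coordinates after an operator.\<close>

lemma functional_coord:
  assumes "v \<in> V"
    and "\<And>u v. u \<in> V \<Longrightarrow> v \<in> V \<Longrightarrow> \<phi> (u + v) = \<phi> u + \<phi> v"
    and "\<And>a v. v \<in> V \<Longrightarrow> \<phi> (pm_scale a v) = a * \<phi> v"
    and "\<And>w. w \<in> W \<Longrightarrow> \<phi> w = (0::complex)"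
  shows "\<phi> v = (\<Sum>i<n. coord v i * \<phi> (bs ! i))"
proof -
  \<comment> \<open>The induction runs over prefixes of the basis, so every partial sum stays in
    \<open>V\<close>, where \<open>\<phi>\<close> is additive.\<close>
  have sum: "\<phi> (\<Sum>i<k. pm_scale (coord v i) (bs ! i)) = (\<Sum>i<k. coord v i * \<phi> (bs ! i))" if "k \<le> n" for k
    using that
  proof (induction k)
    case 0
    then show ?case using assms(4)[OF pm.subspace_0[OF subspace_W]] by simp
  next
    case (Suc k)
    have "(\<Sum>i<k. pm_scale (coord v i) (bs ! i)) \<in> V"
      using Suc.prems bs_in_V by (intro pm.subspace_sum pm.subspace_scale subspace_V) auto
    with Suc show ?case
      using assms(2,3) by (simp add: bs_in_V pm.subspace_scale[OF subspace_V])
  qed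
  have "\<phi> v = \<phi> ((v - lin_comb bs (coord v)) + lin_comb bs (coord v))" by simp
  also have "\<dots> = \<phi> (v - lin_comb bs (coord v)) + \<phi> (lin_comb bs (coord v))"
    using coord[OF assms(1)] W_le_V by (intro assms(2) lin_comb_in_V) auto
  also have "\<dots> = \<phi> (lin_comb bs (coord v))" using assms(4) coord[OF assms(1)] by simp
  finally show ?thesis using sum[of n] by (simp add: lin_comb_def)
qed

lemma coord_linear:
  assumes T: "pm_linear T" "T ` V \<subseteq> V" "T ` W \<subseteq> W" and v: "v \<in> V" and i: "i < n"
  shows "coord (T v) i = (\<Sum>j<n. coord (T (bs ! j)) i * coord v j)"
proof -
  interpret T: Vector_Spaces.linear pm_scale pm_scale T by (rule T(1))
  have "coord (T v) i = (\<Sum>j<n. coord v j * coord (T (bs ! j)) i)"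
  proof (rule functional_coord[OF v])
    fix u v assume "u \<in> V" "v \<in> V"
    then show "coord (T (u + v)) i = coord (T u) i + coord (T v) i"
      using T(2) i by (simp add: T.add coord_add image_subset_iff)
  next
    fix a v assume "v \<in> V"
    then show "coord (T (pm_scale a v)) i = a * coord (T v) i"
      using T(2) i by (simp add: T.scale coord_scale image_subset_iff)
  qed (use T(3) i in \<open>auto intro: coord_in_W\<close>)
  then show ?thesis by (simp add: mult.commute)
qed

definition trace :: "(('a \<Rightarrow>\<^sub>0 complex) \<Rightarrow> ('a \<Rightarrow>\<^sub>0 complex)) \<Rightarrow> complex" where
  "trace T = (\<Sum>i<n. coord (T (bs ! i)) i)"

end

text \<open>This is tr(PQ) = tr(QP) written in coordinates: expand \<open>T\<close> of a vector of
  \<open>bs'\<close> in \<open>bs\<close>, exchange the sums, and recognise the inner sum as the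
  expansion of a vector of \<open>bs\<close> in \<open>bs'\<close>, pushed through
  \<open>T\<close>.\<close>

lemma based_quotient_trace_unique:
  assumes 1: "based_quotient V W bs" and 2: "based_quotient V W bs'"
    and T: "pm_linear T" "T ` V \<subseteq> V" "T ` W \<subseteq> W"
  shows "based_quotient.trace W bs T = based_quotient.trace W bs' T"
proof -
  interpret A: based_quotient V W bs by (rule 1)
  interpret B: based_quotient V W bs' by (rule 2)
  interpret T: Vector_Spaces.linear pm_scale pm_scale T by (rule T(1))
  have TV: "T v \<in> V" if "v \<in> V" for v using that T(2) by auto
  have AB: "B.coord v k = (\<Sum>i<A.n. A.coord v i * B.coord (bs ! i) k)" if "v \<in> V" "k < B.n" for v k
    by (rule A.functional_coord) (use that in \<open>auto simp: B.coord_add B.coord_scale B.coord_in_W\<close>)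
  have BA: "A.coord v k = (\<Sum>i<B.n. B.coord v i * A.coord (bs' ! i) k)" if "v \<in> V" "k < A.n" for v k
    by (rule B.functional_coord) (use that in \<open>auto simp: A.coord_add A.coord_scale A.coord_in_W\<close>)
  have "B.trace T = (\<Sum>k<B.n. \<Sum>i<A.n. A.coord (T (bs' ! k)) i * B.coord (bs ! i) k)"
    unfolding B.trace_def by (intro sum.cong refl AB TV B.bs_in_V) auto
  also have "\<dots> = (\<Sum>i<A.n. \<Sum>k<B.n. A.coord (T (bs' ! k)) i * B.coord (bs ! i) k)"
    by (rule sum.swap)
  also have "\<dots> = (\<Sum>i<A.n. A.coord (T (bs ! i)) i)"
  proof (rule sum.cong[OF refl])
    fix i assume "i \<in> {..<A.n}"
    then have i: "i < A.n" by simp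
    have "A.coord (T (bs ! i)) i = (\<Sum>k<B.n. B.coord (bs ! i) k * A.coord (T (bs' ! k)) i)"
      by (rule B.functional_coord[where \<phi> = "\<lambda>v. A.coord (T v) i", OF A.bs_in_V[OF i]])
        (use i T(3) TV in \<open>auto simp: A.coord_add A.coord_scale T.add T.scale intro!: A.coord_in_W\<close>)
    then show "(\<Sum>k<B.n. A.coord (T (bs' ! k)) i * B.coord (bs ! i) k) = A.coord (T (bs ! i)) i"
      by (simp add: mult.commute)
  qed
  finally show ?thesis by (simp add: A.trace_def)
qed

text \<open>Makes the definite description computable: the coordinate matrix is a witness, any other
  witness is the coordinate matrix of its own basis, and the two traces agree by independence of the
  basis.\<close>

lemma (in based_quotient) quotient_trace_eq:
  assumes T: "pm_linear T" "T ` V \<subseteq> V" "T ` W \<subseteq> W"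
  shows "quotient_trace V W T = trace T"
  unfolding quotient_trace_def
proof (rule the_equality)
  have "T (bs ! j) - lin_comb bs (coord (T (bs ! j))) \<in> W" if "j < n" for j
    using that T(2) bs_in_V by (intro coord) auto
  moreover have "lin_comb bs (coord (T (bs ! j)))
      = lin_comb bs (\<lambda>i. mat n n (\<lambda>(i, j). coord (T (bs ! j)) i) $$ (i, j))" if "j < n" for j
    using that by (intro lin_comb_cong) simp
  ultimately have "\<forall>j<n. T (bs ! j)
      - (\<Sum>i<n. pm_scale (mat n n (\<lambda>(i, j). coord (T (bs ! j)) i) $$ (i, j)) (bs ! i)) \<in> W"
    by (simp add: lin_comb_def)
  moreover have "trace T = mat_trace (mat n n (\<lambda>(i, j). coord (T (bs ! j)) i))"
    by (simp add: mat_trace_def trace_def)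
  ultimately show "\<exists>bs M. quotient_basis V W bs \<and> M \<in> carrier_mat (length bs) (length bs) \<and>
      (\<forall>j<length bs. T (bs ! j) - (\<Sum>i<length bs. pm_scale (M $$ (i, j)) (bs ! i)) \<in> W) \<and>
      trace T = mat_trace M"
    using basis by (intro exI[of _ bs] exI[of _ "mat n n (\<lambda>(i, j). coord (T (bs ! j)) i)"]) simp
next
  fix t assume "\<exists>bs M. quotient_basis V W bs \<and> M \<in> carrier_mat (length bs) (length bs) \<and>
      (\<forall>j<length bs. T (bs ! j) - (\<Sum>i<length bs. pm_scale (M $$ (i, j)) (bs ! i)) \<in> W) \<and>
      t = mat_trace M"
  then obtain bs' M where b: "quotient_basis V W bs'" and M: "M \<in> carrier_mat (length bs') (length bs')"
    and TM: "\<And>j. j < length bs' \<Longrightarrow> T (bs' ! j) - lin_comb bs' (\<lambda>i. M $$ (i, j)) \<in> W"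
    and t: "t = mat_trace M" by (auto simp: lin_comb_def)
  interpret B: based_quotient V W bs' by unfold_locales fact
  have "t = B.trace T" unfolding t mat_trace_def B.trace_def using M
    by (intro sum.cong) (auto simp: B.coord_unique[OF TM])
  also have "\<dots> = trace T"
    by (rule based_quotient_trace_unique[OF _ _ T]) unfold_locales
  finally show "t = trace T" .
qed

lemma quotient_trace_id:
  assumes "based_quotient V W bs"
  shows "quotient_trace V W id = of_nat (length bs)"
proof -
  interpret based_quotient V W bs by fact
  have "quotient_trace V W id = trace id"
    by (intro quotient_trace_eq) (simp_all add: pm.linear_id[unfolded id_def] id_def)
  then show ?thesis by (simp add: trace_def coord_basis)
qed

text \<open>Along the chain W <= U <= V, expand modulo \<open>U\<close> in \<open>cs\<close> first;
  the remainder lies in \<open>U\<close> and is expanded in \<open>bs\<close>. For independence,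
  reduction modulo \<open>U\<close> kills the \<open>cs\<close> coefficients before those of
  \<open>bs\<close>.\<close>

lemma quotient_basis_append:
  assumes "based_quotient U W bs" "based_quotient V U cs"
  shows "based_quotient V W (bs @ cs)"
proof -
  interpret A: based_quotient U W bs by (rule assms(1))
  interpret B: based_quotient V U cs by (rule assms(2))
  have "\<exists>c. v - lin_comb (bs @ cs) c \<in> W" if "v \<in> V" for v
  proof -
    define u where "u = v - lin_comb cs (B.coord v)"
    define c where "c i = (if i < A.n then A.coord u i else B.coord v (i - A.n))" for i
    have "u \<in> U" unfolding u_def by (rule B.coord[OF that])
    moreover have "lin_comb (bs @ cs) c = lin_comb bs (A.coord u) + lin_comb cs (B.coord v)"
      unfolding lin_comb_append by (intro arg_cong2[of _ _ _ _ "(+)"] lin_comb_cong) (simp_all add: c_def)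
    ultimately show ?thesis using A.coord[of u]
      by (intro exI[of _ c]) (simp add: u_def algebra_simps)
  qed
  moreover have "\<forall>i<length (bs @ cs). c i = 0" if "lin_comb (bs @ cs) c \<in> W" for c
  proof -
    have "lin_comb cs (\<lambda>i. c (A.n + i)) = lin_comb (bs @ cs) c - lin_comb bs c"
      by (simp add: lin_comb_append)
    also have "\<dots> \<in> U" using that A.W_le_V A.lin_comb_in_V A.subspace_V
      by (intro pm.subspace_diff) auto
    finally have *: "c (A.n + i) = 0" if "i < B.n" for i
      by (rule B.lin_comb_in_W[OF _ that])
    then have "lin_comb cs (\<lambda>i. c (A.n + i)) = 0" by (simp add: lin_comb_def)
    with that have "lin_comb bs c \<in> W" by (simp add: lin_comb_append)
    then have **: "c i = 0" if "i < A.n" for i by (rule A.lin_comb_in_W[OF _ that])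
    show ?thesis
    proof (intro allI impI)
      fix i assume "i < length (bs @ cs)"
      then show "c i = 0" using *[of "i - A.n"] **[of i] by (cases "i < A.n") auto
    qed
  qed
  moreover have "set (bs @ cs) \<subseteq> V" 
    using A.basis B.basis B.W_le_V by (auto simp: quotient_basis_def)
  ultimately have "quotient_basis V W (bs @ cs)"
    unfolding quotient_basis_def lin_comb_def by blast
  then show ?thesis using A.W_le_V B.W_le_V A.subspace_W B.subspace_V by unfold_locales auto
qed

text \<open>In the basis \<open>bs @ cs\<close> an operator preserving the filtration is block upper
  triangular, and its diagonal blocks are the induced operators on \<open>U/W\<close> and
  \<open>V/U\<close>.\<close>

lemma quotient_trace_additive:
  assumes "based_quotient U W bs" "based_quotient V U cs"
    and T: "pm_linear T" "T ` V \<subseteq> V" "T ` U \<subseteq> U" "T ` W \<subseteq> W"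
  shows "quotient_trace V W T = quotient_trace U W T + quotient_trace V U T"
proof -
  interpret A: based_quotient U W bs by (rule assms(1))
  interpret B: based_quotient V U cs by (rule assms(2))
  interpret C: based_quotient V W "bs @ cs" by (rule quotient_basis_append[OF assms(1,2)])
  have split: "{..<C.n} = {..<A.n} \<union> {A.n..<C.n}" by auto
  have "C.trace T = (\<Sum>i<A.n. C.coord (T ((bs @ cs) ! i)) i)
      + (\<Sum>i\<in>{A.n..<C.n}. C.coord (T ((bs @ cs) ! i)) i)"
    unfolding C.trace_def split by (rule sum.union_disjoint) auto
  also have "(\<Sum>i\<in>{A.n..<C.n}. C.coord (T ((bs @ cs) ! i)) i)
      = (\<Sum>i<B.n. C.coord (T (cs ! i)) (A.n + i))"
    by (rule sum.reindex_bij_witness[where i = "\<lambda>i. A.n + i" and j = "\<lambda>i. i - A.n"])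
      (auto simp: nth_append)
  also have "\<dots> = B.trace T" unfolding B.trace_def
  proof (intro sum.cong refl)
    fix i assume "i \<in> {..<B.n}"
    then have i: "i < B.n" by simp
    let ?v = "T (cs ! i)"
    have "?v - lin_comb (bs @ cs) (C.coord ?v) \<in> W"
      using T(2) B.bs_in_V[OF i] by (intro C.coord) auto
    \<comment> \<open>Adding back the \<open>bs\<close> part, which lies in \<open>U\<close>, shows
      that the last coordinates of \<open>?v\<close> are its coordinates modulo
      \<open>U\<close>.\<close>
    then have "?v - lin_comb (bs @ cs) (C.coord ?v) + lin_comb bs (C.coord ?v) \<in> U"
      using A.W_le_V by (intro pm.subspace_add[OF A.subspace_V] A.lin_comb_in_V) auto
    then have "?v - lin_comb cs (\<lambda>i. C.coord ?v (A.n + i)) \<in> U"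
      by (simp add: lin_comb_append)
    from B.coord_unique[OF this i] show "C.coord ?v (A.n + i) = B.coord ?v i" by simp
  qed
  also have "(\<Sum>i<A.n. C.coord (T ((bs @ cs) ! i)) i) = A.trace T" unfolding A.trace_def
  proof (intro sum.cong refl)
    fix i assume "i \<in> {..<A.n}"
    then have i: "i < A.n" by simp
    \<comment> \<open>\<open>T\<close> keeps \<open>bs ! i\<close> inside \<open>U\<close>, so the
      coordinates along \<open>cs\<close> are zero.\<close>
    let ?v = "T (bs ! i)" and ?c = "\<lambda>j. if j < A.n then A.coord (T (bs ! i)) j else 0"
    have "lin_comb (bs @ cs) ?c = lin_comb bs (A.coord ?v) + lin_comb cs (\<lambda>i. 0)"
      unfolding lin_comb_append by (intro arg_cong2[of _ _ _ _ "(+)"] lin_comb_cong) simp_all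
    then have "?v - lin_comb (bs @ cs) ?c = ?v - lin_comb bs (A.coord ?v)" by (simp add: lin_comb_def)
    also have "\<dots> \<in> W" using T(3) A.bs_in_V[OF i] by (intro A.coord) auto
    finally have "?v - lin_comb (bs @ cs) ?c \<in> W" .
    from C.coord_unique[OF this, of i] i show "C.coord (T ((bs @ cs) ! i)) i = A.coord ?v i"
      by (simp add: nth_append)
  qed
  finally have "C.trace T = A.trace T + B.trace T" .
  then show ?thesis
    using A.quotient_trace_eq[OF T(1,3,4)] B.quotient_trace_eq[OF T(1,2,3)] C.quotient_trace_eq[OF T(1,2,4)]
    by simp
qed

text \<open>A basis \<open>B\<close> of \<open>W\<close> is extended to a basis \<open>C\<close> of
  \<open>V\<close>; the added vectors represent a basis of the quotient.\<close>

lemma (in quotient_space) obtain_basis: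
  assumes "finite S" "V \<subseteq> pm.span S"
  obtains bs where "based_quotient V W bs"
proof -
  obtain B where B: "B \<subseteq> W" "pm.independent B" "W \<subseteq> pm.span B"
    by (rule pm.maximal_independent_subset)
  from B(1) W_le_V have BV: "B \<subseteq> V" by (rule subset_trans)
  obtain C where C: "B \<subseteq> C" "C \<subseteq> V" "pm.independent C" "V \<subseteq> pm.span C"
    by (rule pm.maximal_independent_subset_extend[OF BV B(2)])
  have fin: "finite C"
    using pm.independent_span_bound[OF assms(1) C(3)] subset_trans[OF C(2) assms(2)] by simp
  then obtain bs where bs: "set bs = C - B" "distinct bs"
    using finite_distinct_list[of "C - B"] by auto
  let ?pos = "the_inv_into {..<length bs} ((!) bs)"
  have bij: "bij_betw ((!) bs) {..<length bs} (C - B)" using bij_betw_nth[OF bs(2) refl bs(1)[symmetric]] .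
  have pos: "?pos (bs ! i) = i" if "i < length bs" for i
    using that bij by (intro the_inv_into_f_f) (auto simp: bij_betw_def)
  have lc: "lin_comb bs c = (\<Sum>x\<in>C - B. pm_scale (c (?pos x)) x)" for c
    unfolding lin_comb_def sum.reindex_bij_betw[OF bij, symmetric] by (intro sum.cong refl) (simp add: pos)
  have finB: "finite B" using fin C(1) finite_subset by blast
  have "\<exists>c. v - lin_comb bs c \<in> W" if v: "v \<in> V" for v
  proof -
    obtain u where u: "v = (\<Sum>x\<in>C. pm_scale (u x) x)"
      using subsetD[OF C(4) v] unfolding pm.span_finite[OF fin] by (rule imageE)
    have eq: "lin_comb bs (\<lambda>i. u (bs ! i)) = (\<Sum>x\<in>C - B. pm_scale (u x) x)"
      unfolding lin_comb_def by (rule sum.reindex_bij_betw[OF bij])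
    have "v - lin_comb bs (\<lambda>i. u (bs ! i)) = (\<Sum>x\<in>B. pm_scale (u x) x)"
      unfolding u eq using C(1) fin by (simp add: sum.subset_diff)
    also have "\<dots> \<in> W" using B(1) subspace_W by (intro pm.subspace_sum pm.subspace_scale) auto
    finally show ?thesis by blast
  qed
  moreover have "\<forall>i<length bs. c i = 0" if c: "lin_comb bs c \<in> W" for c
  proof -
    let ?u = "\<lambda>x. c (?pos x)"
    obtain w where w: "lin_comb bs c = (\<Sum>x\<in>B. pm_scale (w x) x)"
      using subsetD[OF B(3) c] unfolding pm.span_finite[OF finB] by (rule imageE)
    \<comment> \<open>A relation modulo \<open>W\<close> becomes a linear relation on the
      independent set \<open>C\<close>, with the negated \<open>W\<close> part as coefficients on
      \<open>B\<close>.\<close>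
    have "(\<Sum>x\<in>C. pm_scale (if x \<in> B then - w x else ?u x) x)
      = (\<Sum>x\<in>C - B. pm_scale (if x \<in> B then - w x else ?u x) x) + (\<Sum>x\<in>B. pm_scale (if x \<in> B then - w x else ?u x) x)"
      using C(1) fin by (intro sum.subset_diff) auto
    also have "(\<Sum>x\<in>C - B. pm_scale (if x \<in> B then - w x else ?u x) x) = lin_comb bs c"
      unfolding lc by (intro sum.cong) auto
    also have "(\<Sum>x\<in>B. pm_scale (if x \<in> B then - w x else ?u x) x) = - lin_comb bs c"
      unfolding w by (simp add: sum_negf)
    finally have "(\<Sum>x\<in>C. pm_scale (if x \<in> B then - w x else ?u x) x) = 0" by simp
    with C(3) have *: "(if x \<in> B then - w x else ?u x) = 0" if "x \<in> C" for x
      using that fin by (intro pm.independentD[where u = "\<lambda>x. if x \<in> B then - w x else ?u x"]) auto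
    show ?thesis
    proof (intro allI impI)
      fix i assume i: "i < length bs"
      then have "bs ! i \<in> C - B" using bs(1) nth_mem by blast
      with *[of "bs ! i"] pos[OF i] show "c i = 0" by simp
    qed
  qed
  moreover have "set bs \<subseteq> V" using bs(1) C(2) by auto
  ultimately have "quotient_basis V W bs" by (simp add: quotient_basis_def lin_comb_def)
  then have "based_quotient V W bs" by unfold_locales
  then show ?thesis by (rule that)
qed

context based_quotient
begin

text \<open>With a group action for \<open>T\<close> and a character for \<open>c\<close>, an inner
  product of characters becomes the trace of the single operator \<open>E\<close>.\<close>

lemma quotient_trace_sum:
  fixes c :: "'i \<Rightarrow> complex" and T :: "'i \<Rightarrow> ('a \<Rightarrow>\<^sub>0 complex) \<Rightarrow> ('a \<Rightarrow>\<^sub>0 complex)"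
  assumes "\<And>g. g \<in> S \<Longrightarrow> pm_linear (T g)" "\<And>g. g \<in> S \<Longrightarrow> T g ` V \<subseteq> V" "\<And>g. g \<in> S \<Longrightarrow> T g ` W \<subseteq> W"
  defines "E \<equiv> \<lambda>v. \<Sum>g\<in>S. pm_scale (c g) (T g v)"
  shows "quotient_trace V W E = (\<Sum>g\<in>S. c g * quotient_trace V W (T g))"
    and "pm_linear E" "E ` V \<subseteq> V" "E ` W \<subseteq> W"
proof -
  show lin: "pm_linear E"
  proof (rule linearI_pm)
    fix p q
    show "E (p + q) = E p + E q" unfolding E_def sum.distrib[symmetric]
    proof (intro sum.cong refl)
      fix g assume "g \<in> S"
      then interpret L: Vector_Spaces.linear pm_scale pm_scale "T g" by (rule assms(1))
      show "pm_scale (c g) (T g (p + q)) = pm_scale (c g) (T g p) + pm_scale (c g) (T g q)"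
        by (simp add: L.add pm.scale_right_distrib)
    qed
  next
    fix a p
    show "E (pm_scale a p) = pm_scale a (E p)" unfolding E_def pm.scale_sum_right
    proof (intro sum.cong refl)
      fix g assume "g \<in> S"
      then interpret L: Vector_Spaces.linear pm_scale pm_scale "T g" by (rule assms(1))
      show "pm_scale (c g) (T g (pm_scale a p)) = pm_scale a (pm_scale (c g) (T g p))"
        by (simp add: L.scale mult.commute)
    qed
  qed
  show EV: "E ` V \<subseteq> V" unfolding E_def
    using assms(2) by (intro image_subsetI pm.subspace_sum pm.subspace_scale subspace_V) blast
  show EW: "E ` W \<subseteq> W" unfolding E_def
    using assms(3) by (intro image_subsetI pm.subspace_sum pm.subspace_scale subspace_W) blast
  have "trace E = (\<Sum>i<n. \<Sum>g\<in>S. c g * coord (T g (bs ! i)) i)" unfolding trace_def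
  proof (intro sum.cong refl)
    fix i assume "i \<in> {..<n}"
    then have i: "i < n" by simp
    have TV: "T g (bs ! i) \<in> V" if "g \<in> S" for g using assms(2)[OF that] bs_in_V[OF i] by blast
    have "coord (E (bs ! i)) i = (\<Sum>g\<in>S. coord (pm_scale (c g) (T g (bs ! i))) i)"
      unfolding E_def using TV by (intro coord_sum i pm.subspace_scale subspace_V)
    also have "\<dots> = (\<Sum>g\<in>S. c g * coord (T g (bs ! i)) i)"
      using TV i by (intro sum.cong refl coord_scale) auto
    finally show "coord (E (bs ! i)) i = (\<Sum>g\<in>S. c g * coord (T g (bs ! i)) i)" .
  qed
  also have "\<dots> = (\<Sum>g\<in>S. c g * trace (T g))"
    by (subst sum.swap) (simp add: trace_def sum_distrib_left)
  also have "\<dots> = (\<Sum>g\<in>S. c g * quotient_trace V W (T g))"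
    using assms(1-3) by (intro sum.cong refl arg_cong2[of _ _ _ _ "(*)"] quotient_trace_eq[symmetric])
  finally show "quotient_trace V W E = (\<Sum>g\<in>S. c g * quotient_trace V W (T g))"
    using quotient_trace_eq[OF lin EV EW] by simp
qed

end

section \<open>Orthogonality of irreducible characters\<close>

lemma vec_subspace_iff:
  "VectorSpace.subspace class_ring W (module_vec TYPE(complex) n) \<longleftrightarrow> W \<subseteq> carrier_vec n \<and> 0\<^sub>v n \<in> W \<and>
     (\<forall>v\<in>W. \<forall>w\<in>W. v + w \<in> W) \<and> (\<forall>c. \<forall>v\<in>W. c \<cdot>\<^sub>v v \<in> W)"
proof -
  have "vectorspace class_ring (module_vec TYPE(complex) n)" by (rule vec_vs)
  moreover have "Module.module class_ring (module_vec TYPE(complex) n)" by (rule vec_module)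
  ultimately show ?thesis
    unfolding VectorSpace.subspace_def submodule_def by (auto simp: module_vec_simps class_ring_simps)
qed

lemma irreducible_matsD:
  assumes "irreducible_mats n S" "W \<subseteq> carrier_vec n" "0\<^sub>v n \<in> W"
    "\<And>v w. v \<in> W \<Longrightarrow> w \<in> W \<Longrightarrow> v + w \<in> W" "\<And>c v. v \<in> W \<Longrightarrow> c \<cdot>\<^sub>v v \<in> W"
    "\<And>M v. M \<in> S \<Longrightarrow> v \<in> W \<Longrightarrow> M *\<^sub>v v \<in> W"
  shows "W = {0\<^sub>v n} \<or> W = carrier_vec n"
proof -
  have "VectorSpace.subspace class_ring W (module_vec TYPE(complex) n)"
    unfolding vec_subspace_iff using assms(2-5) by auto
  with assms(1,6) show ?thesis unfolding irreducible_mats_def by blast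
qed

text \<open>The columns of \<open>B\<close> are preimages of the unit vectors.\<close>

lemma surjective_mat_right_inverse:
  fixes A :: "'a::semiring_1 mat"
  assumes A: "A \<in> carrier_mat n m"
    and "\<And>v. v \<in> carrier_vec n \<Longrightarrow> \<exists>w\<in>carrier_vec m. A *\<^sub>v w = v"
  obtains B where "B \<in> carrier_mat m n" "A * B = 1\<^sub>m n"
proof -
  have "\<forall>j. \<exists>w. w \<in> carrier_vec m \<and> A *\<^sub>v w = unit_vec n j" using assms(2) by (meson unit_vec_carrier)
  then obtain w where w: "\<And>j. w j \<in> carrier_vec m" "\<And>j. A *\<^sub>v w j = unit_vec n j" by metis
  define B where "B = mat m n (\<lambda>(i, j). w j $ i)"
  have B: "B \<in> carrier_mat m n" by (simp add: B_def)
  have "A * B = 1\<^sub>m n"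
  proof (rule eq_matI)
    fix i j assume "i < dim_row (1\<^sub>m n)" "j < dim_col (1\<^sub>m n)"
    then have ij: "i < n" "j < n" by auto
    have col: "col B j = w j" using w(1)[of j] ij by (intro eq_vecI) (auto simp: B_def)
    have "(A * B) $$ (i, j) = (A *\<^sub>v w j) $ i" using A B ij col by simp
    then show "(A * B) $$ (i, j) = 1\<^sub>m n $$ (i, j)" using ij w(2) by simp
  qed (use A B in auto)
  with B that show ?thesis by blast
qed

lemma mat_trace_mult_comm:
  fixes A :: "'a::comm_semiring_0 mat"
  assumes "A \<in> carrier_mat n m" "B \<in> carrier_mat m n"
  shows "mat_trace (A * B) = mat_trace (B * A)"
proof -
  have "mat_trace (A * B) = (\<Sum>i<n. \<Sum>j<m. A $$ (i, j) * B $$ (j, i))"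
    using assms by (auto simp: mat_trace_def scalar_prod_def atLeast0LessThan intro!: sum.cong)
  also have "\<dots> = (\<Sum>j<m. \<Sum>i<n. B $$ (j, i) * A $$ (i, j))"
    by (subst sum.swap) (simp add: mult.commute)
  also have "\<dots> = mat_trace (B * A)"
    using assms by (auto simp: mat_trace_def scalar_prod_def atLeast0LessThan intro!: sum.cong)
  finally show ?thesis .
qed

text \<open>The kernel of \<open>T\<close> is stable under \<open>S\<close> and its image under
  \<open>R\<close>, so irreducibility leaves a zero kernel and a full image. Both inverse equations
  are derived because \<open>n\<close> and \<open>m\<close> are not known to be equal
  beforehand.\<close>

lemma schur:
  assumes R: "irreducible_mats n (R ` I)" "\<And>g. g \<in> I \<Longrightarrow> R g \<in> carrier_mat n n"
    and S: "irreducible_mats m (S ` I)" "\<And>g. g \<in> I \<Longrightarrow> S g \<in> carrier_mat m m"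
    and T: "T \<in> carrier_mat n m" and comm: "\<And>g. g \<in> I \<Longrightarrow> R g * T = T * S g"
    and "T \<noteq> 0\<^sub>m n m"
  obtains T' where "T' \<in> carrier_mat m n" "T * T' = 1\<^sub>m n" "T' * T = 1\<^sub>m m"
proof -
  let ?K = "{v \<in> carrier_vec m. T *\<^sub>v v = 0\<^sub>v n}" and ?I = "(*\<^sub>v) T ` carrier_vec m"
  have comm': "R g *\<^sub>v (T *\<^sub>v v) = T *\<^sub>v (S g *\<^sub>v v)" if "g \<in> I" "v \<in> carrier_vec m" for g v
    using comm[OF that(1)] R(2)[OF that(1)] S(2)[OF that(1)] T that(2)
    by (metis assoc_mult_mat_vec)
  have "?K = {0\<^sub>v m} \<or> ?K = carrier_vec m"
  proof (rule irreducible_matsD[OF S(1)])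
    fix M v assume "M \<in> S ` I" "v \<in> ?K"
    then obtain g where g: "g \<in> I" "M = S g" and v: "v \<in> carrier_vec m" "T *\<^sub>v v = 0\<^sub>v n" by auto
    have "R g *\<^sub>v 0\<^sub>v n = 0\<^sub>v n" using R(2)[OF g(1)] by (intro eq_vecI) auto
    then have "T *\<^sub>v (S g *\<^sub>v v) = 0\<^sub>v n" using comm'[OF g(1) v(1)] v(2) by simp
    then show "M *\<^sub>v v \<in> ?K" using mult_mat_vec_carrier[OF S(2)[OF g(1)] v(1)] g(2) by simp
  qed (use T in \<open>auto simp: mult_add_distrib_mat_vec mult_mat_vec\<close>)
  moreover have "?K \<noteq> carrier_vec m"
  proof
    assume K: "?K = carrier_vec m"
    have "T = 0\<^sub>m n m"
    proof (rule eq_matI)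
      fix i j assume "i < dim_row (0\<^sub>m n m)" "j < dim_col (0\<^sub>m n m)"
      then have ij: "i < n" "j < m" by auto
      have "unit_vec m j \<in> ?K" unfolding K by simp
      then have "T *\<^sub>v unit_vec m j = 0\<^sub>v n" by simp
      then have "(T *\<^sub>v unit_vec m j) $ i = 0" using ij by simp
      then show "T $$ (i, j) = 0\<^sub>m n m $$ (i, j)" using ij T by simp
    qed (use T in auto)
    with assms(7) show False by simp
  qed
  ultimately have K: "?K = {0\<^sub>v m}" by blast
  have "?I = {0\<^sub>v n} \<or> ?I = carrier_vec n"
  proof (rule irreducible_matsD[OF R(1)])
    show "0\<^sub>v n \<in> ?I" using T by (intro image_eqI[of _ _ "0\<^sub>v m"]) auto
    fix v w assume "v \<in> ?I" "w \<in> ?I"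
    then obtain a b where "a \<in> carrier_vec m" "b \<in> carrier_vec m" "v = T *\<^sub>v a" "w = T *\<^sub>v b" by auto
    then show "v + w \<in> ?I" using T
      by (intro image_eqI[of _ _ "a + b"]) (auto simp: mult_add_distrib_mat_vec)
  next
    fix c v assume "v \<in> ?I"
    then obtain a where "a \<in> carrier_vec m" "v = T *\<^sub>v a" by auto
    then show "c \<cdot>\<^sub>v v \<in> ?I" using T by (intro image_eqI[of _ _ "c \<cdot>\<^sub>v a"]) (auto simp: mult_mat_vec)
  next
    fix M v assume "M \<in> R ` I" "v \<in> ?I"
    then obtain g a where "g \<in> I" "M = R g" "a \<in> carrier_vec m" "v = T *\<^sub>v a" by auto
    then show "M *\<^sub>v v \<in> ?I"
      by (intro image_eqI[of _ _ "S g *\<^sub>v a"]) (simp_all add: comm' mult_mat_vec_carrier[OF S(2)])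
  qed (use T in auto)
  moreover have "?I \<noteq> {0\<^sub>v n}"
  proof
    assume "?I = {0\<^sub>v n}"
    then have "?K = carrier_vec m" by blast
    with \<open>?K \<noteq> carrier_vec m\<close> show False ..
  qed
  ultimately have I: "?I = carrier_vec n" by blast
  have "\<exists>w\<in>carrier_vec m. T *\<^sub>v w = v" if "v \<in> carrier_vec n" for v using that I by (metis imageE)
  from surjective_mat_right_inverse[OF T this]
  obtain T' where T': "T' \<in> carrier_mat m n" "T * T' = 1\<^sub>m n" by metis
  \<comment> \<open>So far \<open>T'\<close> is a right inverse. For every \<open>u\<close>,
    \<open>T\<close> sends T'Tu - u to zero, and the trivial kernel turns this into the left inverse
    equation.\<close>
  have "T' * T = 1\<^sub>m m"
  proof (rule eq_matI)
    fix i j assume "i < dim_row (1\<^sub>m m)" "j < dim_col (1\<^sub>m m)"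
    then have ij: "i < m" "j < m" by auto
    let ?u = "unit_vec m j"
    let ?v = "T' *\<^sub>v (T *\<^sub>v ?u) - ?u"
    have "T *\<^sub>v ?v = T *\<^sub>v (T' *\<^sub>v (T *\<^sub>v ?u)) - T *\<^sub>v ?u"
      using T T' by (intro mult_minus_distrib_mat_vec) auto
    also have "T *\<^sub>v (T' *\<^sub>v (T *\<^sub>v ?u)) = (T * T') *\<^sub>v (T *\<^sub>v ?u)"
      using T T'(1) by (intro assoc_mult_mat_vec[symmetric]) auto
    also have "\<dots> = T *\<^sub>v ?u" unfolding T'(2) using T by (intro one_mult_mat_vec) auto
    finally have "?v \<in> ?K" using T T'(1) by auto
    then have "?v = 0\<^sub>v m" using K by blast
    then have "?v $ i = 0" using ij by simp
    then have "(T' *\<^sub>v (T *\<^sub>v ?u)) $ i = ?u $ i" using ij T' T by simp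
    moreover have "T' *\<^sub>v (T *\<^sub>v ?u) = (T' * T) *\<^sub>v ?u"
      using T T'(1) by (intro assoc_mult_mat_vec[symmetric]) auto
    ultimately have "((T' * T) *\<^sub>v ?u) $ i = ?u $ i" by simp
    then show "(T' * T) $$ (i, j) = 1\<^sub>m m $$ (i, j)"
      using ij T T' by (simp del: assoc_mult_mat_vec)
  qed (use T T' in auto)
  with T' that show ?thesis by blast
qed

text \<open>Over the complex numbers \<open>T\<close> has an eigenvalue \<open>c\<close>. The matrix
  T - c also commutes with the family but has a nonzero kernel, so it is not invertible and must
  vanish.\<close>

lemma schur_scalar:
  assumes R: "irreducible_mats n (R ` I)" "\<And>g. g \<in> I \<Longrightarrow> R g \<in> carrier_mat n n"
    and T: "T \<in> carrier_mat n n" and comm: "\<And>g. g \<in> I \<Longrightarrow> R g * T = T * R g"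
  obtains c where "T = c \<cdot>\<^sub>m 1\<^sub>m n"
proof -
  have n: "n > 0" using R(1) by (simp add: irreducible_mats_def)
  from spectrum_non_empty[OF T n] obtain c where "eigenvalue T c" by (auto simp: spectrum_def)
  then obtain v where v: "v \<in> carrier_vec n" "v \<noteq> 0\<^sub>v n" "T *\<^sub>v v = c \<cdot>\<^sub>v v"
    using T by (auto simp: eigenvalue_def eigenvector_def)
  let ?T = "T - c \<cdot>\<^sub>m 1\<^sub>m n"
  have T': "?T \<in> carrier_mat n n" using T by auto
  have "?T *\<^sub>v v = T *\<^sub>v v - (c \<cdot>\<^sub>m 1\<^sub>m n) *\<^sub>v v"
    using T v by (intro minus_mult_distrib_mat_vec) auto
  also have "(c \<cdot>\<^sub>m 1\<^sub>m n) *\<^sub>v v = c \<cdot>\<^sub>v v" using v by (intro eq_vecI) auto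
  finally have ker: "?T *\<^sub>v v = 0\<^sub>v n" using v by simp
  have "?T = 0\<^sub>m n n"
  proof (rule ccontr)
    assume nz: "?T \<noteq> 0\<^sub>m n n"
    have "R g * ?T = ?T * R g" if g: "g \<in> I" for g
    proof -
      have "R g * (c \<cdot>\<^sub>m 1\<^sub>m n) = (c \<cdot>\<^sub>m 1\<^sub>m n) * R g" using R(2)[OF g] by (intro eq_matI) auto
      then show ?thesis using R(2)[OF g] T comm[OF g]
        by (simp add: mult_minus_distrib_mat minus_mult_distrib_mat)
    qed
    from schur[OF R R T' this nz] obtain S where S: "S \<in> carrier_mat n n" "S * ?T = 1\<^sub>m n" by metis
    have "v = (S * ?T) *\<^sub>v v" using S v by simp
    also have "\<dots> = S *\<^sub>v (?T *\<^sub>v v)" using S(1) T' v by (intro assoc_mult_mat_vec) auto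
    also have "\<dots> = 0\<^sub>v n" unfolding ker using S(1) by (intro eq_vecI) auto
    finally show False using v(2) by simp
  qed
  then have "T = c \<cdot>\<^sub>m 1\<^sub>m n"
    using T by (auto simp: mat_eq_iff)
  then show ?thesis by (rule that)
qed

section \<open>Averaging over a finite group\<close>

lemma group_rep_carrier: "group_rep G n R \<Longrightarrow> g \<in> carrier G \<Longrightarrow> R g \<in> carrier_mat n n"
  by (auto simp: group_rep_def hom_def ring_mat_simps)

lemma group_rep_mult:
  "group_rep G n R \<Longrightarrow> g \<in> carrier G \<Longrightarrow> h \<in> carrier G \<Longrightarrow> R (g \<otimes>\<^bsub>G\<^esub> h) = R g * R h"
  by (auto simp: group_rep_def hom_def ring_mat_simps)

lemma group_rep_one: "group_rep G n R \<Longrightarrow> R \<one>\<^bsub>G\<^esub> = 1\<^sub>m n"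
  by (simp add: group_rep_def)

lemma index_mult_mat_sum:
  "A \<in> carrier_mat n m \<Longrightarrow> B \<in> carrier_mat m k \<Longrightarrow> i < n \<Longrightarrow> j < k \<Longrightarrow>
    (A * B) $$ (i, j) = (\<Sum>l<m. A $$ (i, l) * B $$ (l, j))"
  by (auto simp: scalar_prod_def atLeast0LessThan)

context group
begin

lemma sum_left_translate:
  fixes f :: "'a \<Rightarrow> 'c::comm_monoid_add"
  assumes "h \<in> carrier G" shows "(\<Sum>g\<in>carrier G. f (h \<otimes> g)) = (\<Sum>g\<in>carrier G. f g)"
  by (rule sum.reindex_bij_witness[of _ "\<lambda>g. inv h \<otimes> g" "\<lambda>g. h \<otimes> g"])
    (use assms in \<open>auto simp: m_assoc[symmetric]\<close>)

text \<open>The average over \<open>g\<close> of \<open>R(g) E\<^sub>j\<^sub>k S(g)\<inverse>\<close>, with \<open>E\<^sub>j\<^sub>k\<close> a matrix unit.\<close>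

definition intertwiner ::
    "nat \<Rightarrow> ('a \<Rightarrow> complex mat) \<Rightarrow> nat \<Rightarrow> ('a \<Rightarrow> complex mat) \<Rightarrow> nat \<Rightarrow> nat \<Rightarrow> complex mat" where
  "intertwiner n R m S j k =
     mat n m (\<lambda>(i, l). \<Sum>g\<in>carrier G. R g $$ (i, j) * S (inv g) $$ (k, l))"

lemma intertwiner_commutes:
  assumes R: "group_rep G n R" and S: "group_rep G m S"
    and h: "h \<in> carrier G" and jk: "j < n" "k < m"
  shows "R h * intertwiner n R m S j k = intertwiner n R m S j k * S h" (is "_ * ?T = _")
proof (rule eq_matI)
  have T: "?T \<in> carrier_mat n m" by (simp add: intertwiner_def)
  note [simp] = group_rep_carrier[OF R] group_rep_carrier[OF S]
  show "dim_row (R h * ?T) = dim_row (?T * S h)" "dim_col (R h * ?T) = dim_col (?T * S h)"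
    using T group_rep_carrier[OF R h] group_rep_carrier[OF S h] by auto
  fix i l assume "i < dim_row (?T * S h)" "l < dim_col (?T * S h)"
  then have il: "i < n" "l < m" using T group_rep_carrier[OF S h] by auto
  have "(R h * ?T) $$ (i, l) = (\<Sum>a<n. R h $$ (i, a) * (\<Sum>g\<in>carrier G. R g $$ (a, j) * S (inv g) $$ (k, l)))"
    using h il by (subst index_mult_mat_sum[OF _ T]) (auto simp: intertwiner_def)
  also have "\<dots> = (\<Sum>g\<in>carrier G. (\<Sum>a<n. R h $$ (i, a) * R g $$ (a, j)) * S (inv g) $$ (k, l))"
    by (simp add: sum_distrib_left sum_distrib_right mult.assoc) (rule sum.swap)
  also have "\<dots> = (\<Sum>g\<in>carrier G. R (h \<otimes> g) $$ (i, j) * S (inv g) $$ (k, l))"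
    using h il jk by (intro sum.cong refl)
      (simp add: group_rep_mult[OF R] index_mult_mat_sum[where n = n and m = n and k = n] del: index_mult_mat)
  \<comment> \<open>Writing \<open>inv g\<close> as \<open>inv (h \<otimes> g) \<otimes> h\<close>
    makes the summand a function of \<open>h \<otimes> g\<close>, ready for translation.\<close>
  also have "\<dots> = (\<Sum>g\<in>carrier G. R (h \<otimes> g) $$ (i, j) * S (inv (h \<otimes> g) \<otimes> h) $$ (k, l))"
    using h by (intro sum.cong refl) (simp add: inv_mult_group m_assoc)
  also have "\<dots> = (\<Sum>g\<in>carrier G. R g $$ (i, j) * S (inv g \<otimes> h) $$ (k, l))"
    by (rule sum_left_translate[OF h])
  also have "\<dots> = (\<Sum>g\<in>carrier G. R g $$ (i, j) * (\<Sum>b<m. S (inv g) $$ (k, b) * S h $$ (b, l)))"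
    using h il jk by (intro sum.cong refl)
      (simp add: group_rep_mult[OF S] index_mult_mat_sum[where n = m and m = m and k = m] del: index_mult_mat)
  also have "\<dots> = (\<Sum>b<m. (\<Sum>g\<in>carrier G. R g $$ (i, j) * S (inv g) $$ (k, b)) * S h $$ (b, l))"
    by (simp add: sum_distrib_left sum_distrib_right mult.assoc) (rule sum.swap)
  also have "\<dots> = (?T * S h) $$ (i, l)"
    using h il by (subst index_mult_mat_sum[OF T]) (auto simp: intertwiner_def)
  finally show "(R h * ?T) $$ (i, l) = (?T * S h) $$ (i, l)" .
qed

text \<open>Reduces inner products of characters to Schur's lemma: each product of two diagonal
  entries, summed over the group, is one entry of an averaged matrix unit.\<close>

lemma sum_traces_intertwiner:
  assumes R: "group_rep G n R" and S: "group_rep G m S"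
  shows "(\<Sum>g\<in>carrier G. mat_trace (R g) * mat_trace (S (inv g)))
    = (\<Sum>i<n. \<Sum>k<m. intertwiner n R m S i k $$ (i, k))"
proof -
  have "(\<Sum>g\<in>carrier G. mat_trace (R g) * mat_trace (S (inv g)))
      = (\<Sum>g\<in>carrier G. \<Sum>i<n. \<Sum>k<m. R g $$ (i, i) * S (inv g) $$ (k, k))"
    by (intro sum.cong refl) (use carrier_matD(1)[OF group_rep_carrier[OF R]]
        carrier_matD(1)[OF group_rep_carrier[OF S]] in \<open>simp add: mat_trace_def sum_product\<close>)
  also have "\<dots> = (\<Sum>i<n. \<Sum>g\<in>carrier G. \<Sum>k<m. R g $$ (i, i) * S (inv g) $$ (k, k))"
    by (rule sum.swap)
  also have "\<dots> = (\<Sum>i<n. \<Sum>k<m. \<Sum>g\<in>carrier G. R g $$ (i, i) * S (inv g) $$ (k, k))"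
    by (intro sum.cong refl) (rule sum.swap)
  finally show ?thesis by (simp add: intertwiner_def)
qed

text \<open>A nonzero intertwiner would be invertible and conjugate one representation into the
  other, making the characters equal. Hence all intertwiners vanish. Evaluation at
  \<open>inv g\<close> takes the place of complex conjugation.\<close>

lemma irr_chars_orthogonal:
  assumes "\<phi> \<in> irr_chars G" "\<psi> \<in> irr_chars G" "\<phi> \<noteq> \<psi>"
  shows "(\<Sum>g\<in>carrier G. \<phi> g * \<psi> (inv g)) = 0"
proof -
  from assms(1) obtain R n where R: "\<phi> = (\<lambda>g\<in>carrier G. mat_trace (R g))" "group_rep G n R"
    "irreducible_mats n (R ` carrier G)" by (auto simp: irr_chars_def)
  from assms(2) obtain S m where S: "\<psi> = (\<lambda>g\<in>carrier G. mat_trace (S g))" "group_rep G m S"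
    "irreducible_mats m (S ` carrier G)" by (auto simp: irr_chars_def)
  note R' = group_rep_carrier[OF R(2)] and S' = group_rep_carrier[OF S(2)]
  have "intertwiner n R m S i k = 0\<^sub>m n m" if ik: "i < n" "k < m" for i k
  proof (rule ccontr)
    let ?T = "intertwiner n R m S i k"
    assume nz: "?T \<noteq> 0\<^sub>m n m"
    have T: "?T \<in> carrier_mat n m" by (simp add: intertwiner_def)
    note comm = intertwiner_commutes[OF R(2) S(2) _ ik]
    obtain T' where T': "T' \<in> carrier_mat m n" "?T * T' = 1\<^sub>m n" "T' * ?T = 1\<^sub>m m"
      using schur[OF R(3) R' S(3) S' T comm nz] by metis
    have "mat_trace (R g) = mat_trace (S g)" if g: "g \<in> carrier G" for g
    proof -
      have "R g = R g * (?T * T')" using R'[OF g] T' by simp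
      also have "\<dots> = (R g * ?T) * T'" by (rule assoc_mult_mat[OF R'[OF g] T T'(1), symmetric])
      also have "\<dots> = (?T * S g) * T'" by (simp add: comm[OF g])
      finally have "mat_trace (R g) = mat_trace (T' * (?T * S g))"
        using mat_trace_mult_comm[of "?T * S g" n m T'] T T'(1) S'[OF g] by simp
      also have "T' * (?T * S g) = (T' * ?T) * S g" by (rule assoc_mult_mat[OF T'(1) T S'[OF g], symmetric])
      finally show ?thesis using T'(3) S'[OF g] by simp
    qed
    then have "\<phi> = \<psi>" unfolding R S by (auto simp: restrict_def)
    with assms(3) show False ..
  qed
  with sum_traces_intertwiner[OF R(2) S(2)] show ?thesis by (simp add: R(1) S(1))
qed

lemma irr_chars_norm:
  assumes "\<psi> \<in> irr_chars G" "finite (carrier G)"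
  shows "(\<Sum>g\<in>carrier G. \<psi> g * \<psi> (inv g)) = of_nat (card (carrier G))"
proof -
  from assms(1) obtain R n where R: "\<psi> = (\<lambda>g\<in>carrier G. mat_trace (R g))" "group_rep G n R"
    "irreducible_mats n (R ` carrier G)" by (auto simp: irr_chars_def)
  note R' = group_rep_carrier[OF R(2)]
  have n: "n > 0" using R(3) by (simp add: irreducible_mats_def)
  have T: "intertwiner n R n R j k = ((if j = k then of_nat (card (carrier G)) / of_nat n else 0) \<cdot>\<^sub>m 1\<^sub>m n)"
    if jk: "j < n" "k < n" for j k
  proof -
    let ?T = "intertwiner n R n R j k"
    have T: "?T \<in> carrier_mat n n" by (simp add: intertwiner_def)
    obtain c where c: "?T = c \<cdot>\<^sub>m 1\<^sub>m n"
      using schur_scalar[OF R(3) R' T intertwiner_commutes[OF R(2) R(2) _ jk]] by metis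
    \<comment> \<open>The scalar is read off from the trace: conjugation preserves the trace of a
      matrix unit, which is 1 if \<open>j = k\<close> and 0 otherwise.\<close>
    have "of_nat n * c = (\<Sum>i<n. ?T $$ (i, i))" unfolding c by simp
    also have "\<dots> = (\<Sum>g\<in>carrier G. \<Sum>i<n. R (inv g) $$ (k, i) * R g $$ (i, j))"
      by (subst sum.swap) (simp add: intertwiner_def mult.commute)
    also have "\<dots> = (\<Sum>g\<in>carrier G. R (inv g \<otimes> g) $$ (k, j))"
      by (intro sum.cong refl, subst group_rep_mult[OF R(2)])
        (use jk R' in \<open>auto simp del: index_mult_mat l_inv intro!: index_mult_mat_sum[symmetric]\<close>)
    also have "\<dots> = (\<Sum>g\<in>carrier G. if j = k then 1 else 0)"
      using jk by (intro sum.cong refl) (simp add: group_rep_one[OF R(2)] l_inv)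
    finally have "of_nat n * c = (if j = k then of_nat (card (carrier G)) else 0)" by simp
    then have "c = (if j = k then of_nat (card (carrier G)) / of_nat n else 0)"
      using n by (auto simp: field_simps)
    with c show ?thesis by simp
  qed
  have "(\<Sum>g\<in>carrier G. \<psi> g * \<psi> (inv g)) = (\<Sum>i<n. \<Sum>k<n. intertwiner n R n R i k $$ (i, k))"
    using sum_traces_intertwiner[OF R(2) R(2)] by (simp add: R(1))
  also have "\<dots> = (\<Sum>i<n. \<Sum>k<n. if i = k then of_nat (card (carrier G)) / of_nat n else 0)"
    by (intro sum.cong refl) (simp add: T)
  also have "\<dots> = of_nat (card (carrier G))" using n by simp
  finally show ?thesis .
qed

lemma inner_product_count:
  assumes M: "set_mset M \<subseteq> irr_chars G" and \<psi>: "\<psi> \<in> irr_chars G" and fin: "finite (carrier G)"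
    and \<chi>: "\<And>g. g \<in> carrier G \<Longrightarrow> \<chi> g = (\<Sum>\<phi>\<in>#M. \<phi> g)"
  shows "(\<Sum>g\<in>carrier G. \<chi> g * \<psi> (inv g)) = of_nat (count M \<psi> * card (carrier G))"
proof -
  have "(\<Sum>g\<in>carrier G. (\<Sum>\<phi>\<in>#M. \<phi> g) * \<psi> (inv g)) = of_nat (count M \<psi> * card (carrier G))"
    using M
  proof (induction M)
    case (add \<phi> M)
    then show ?case using irr_chars_orthogonal[of \<phi> \<psi>] irr_chars_norm[OF \<psi> fin] \<psi>
      by (cases "\<phi> = \<psi>") (simp_all add: distrib_right sum.distrib)
  qed simp
  then show ?thesis using \<chi> by simp
qed

text \<open>The inner product with \<open>\<psi>\<close> determines \<open>count M \<psi>\<close>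
  for every admissible multiset, so the description in \<open>char_mult\<close> has at most one
  solution; the given \<open>M\<close> supplies existence.\<close>

lemma char_mult_eq:
  assumes "set_mset M \<subseteq> irr_chars G" and \<psi>: "\<psi> \<in> irr_chars G" and fin: "finite (carrier G)"
    and "\<And>g. g \<in> carrier G \<Longrightarrow> \<chi> g = (\<Sum>\<phi>\<in>#M. \<phi> g)"
    and k: "(\<Sum>g\<in>carrier G. \<chi> g * \<psi> (inv g)) = of_nat (k * card (carrier G))"
  shows "char_mult G \<psi> \<chi> = k"
proof -
  have "card (carrier G) > 0" using fin by (auto simp: card_gt_0_iff)
  then have *: "count M' \<psi> = k"
    if "set_mset M' \<subseteq> irr_chars G" "\<And>g. g \<in> carrier G \<Longrightarrow> \<chi> g = (\<Sum>\<phi>\<in>#M'. \<phi> g)" for M'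
    using inner_product_count[OF that(1) \<psi> fin that(2)] k by (simp flip: of_nat_mult)
  show ?thesis unfolding char_mult_def
  proof (rule the_equality)
    show "\<exists>M. set_mset M \<subseteq> irr_chars G \<and> (\<forall>g\<in>carrier G. \<chi> g = (\<Sum>\<phi>\<in>#M. \<phi> g)) \<and> count M \<psi> = k"
      using assms(1,4) *[OF assms(1,4)] by blast
  qed (use * in blast)
qed

end

section \<open>Characters of invariant quotients\<close>

locale pm_rep = group G for G :: "('g, 'b) monoid_scheme" (structure) +
  fixes T :: "'g \<Rightarrow> ('a \<Rightarrow>\<^sub>0 complex) \<Rightarrow> ('a \<Rightarrow>\<^sub>0 complex)"
  assumes linear_T: "g \<in> carrier G \<Longrightarrow> pm_linear (T g)"
    and T_mult: "g \<in> carrier G \<Longrightarrow> h \<in> carrier G \<Longrightarrow> T (g \<otimes> h) v = T g (T h v)"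
    and T_one: "T \<one> v = v"
begin

definition invariant :: "('a \<Rightarrow>\<^sub>0 complex) set \<Rightarrow> bool" where
  "invariant U \<longleftrightarrow> pm.subspace U \<and> (\<forall>g\<in>carrier G. T g ` U \<subseteq> U)"

lemma invariantD: "invariant U \<Longrightarrow> g \<in> carrier G \<Longrightarrow> T g ` U \<subseteq> U"
  by (simp add: invariant_def)

definition rep_matrix :: "('a \<Rightarrow>\<^sub>0 complex) set \<Rightarrow> ('a \<Rightarrow>\<^sub>0 complex) list \<Rightarrow> 'g \<Rightarrow> complex mat" where
  "rep_matrix W bs g = mat (length bs) (length bs) (\<lambda>(i, j). based_quotient.coord W bs (T g (bs ! j)) i)"

context
  fixes V W :: "('a \<Rightarrow>\<^sub>0 complex) set" and bs
  assumes bq: "based_quotient V W bs" and inv: "invariant V" "invariant W"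
begin

interpretation based_quotient V W bs by (rule bq)

lemma rep_matrix_coord:
  assumes "g \<in> carrier G" "v \<in> V"
  shows "rep_matrix W bs g *\<^sub>v vec n (coord v) = vec n (coord (T g v))"
proof (rule eq_vecI)
  fix i assume "i < dim_vec (vec n (coord (T g v)))"
  then have i: "i < n" by simp
  have "coord (T g v) i = (\<Sum>j<n. coord (T g (bs ! j)) i * coord v j)"
    using inv assms i by (intro coord_linear linear_T invariantD)
  with i show "(rep_matrix W bs g *\<^sub>v vec n (coord v)) $ i = vec n (coord (T g v)) $ i"
    by (simp add: rep_matrix_def scalar_prod_def atLeast0LessThan)
qed (simp add: rep_matrix_def)

lemma group_rep_rep_matrix: "group_rep G n (rep_matrix W bs)"
proof -
  have "rep_matrix W bs (g \<otimes> h) = rep_matrix W bs g * rep_matrix W bs h"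
    if gh: "g \<in> carrier G" "h \<in> carrier G" for g h
  proof (rule eq_matI)
    fix i j assume "i < dim_row (rep_matrix W bs g * rep_matrix W bs h)"
      "j < dim_col (rep_matrix W bs g * rep_matrix W bs h)"
    then have ij: "i < n" "j < n" by (simp_all add: rep_matrix_def)
    have "coord (T g (T h (bs ! j))) i = (\<Sum>l<n. coord (T g (bs ! l)) i * coord (T h (bs ! j)) l)"
      using inv gh ij bs_in_V invariantD[OF inv(1) gh(2)] by (intro coord_linear linear_T invariantD) auto
    with ij gh show "rep_matrix W bs (g \<otimes> h) $$ (i, j) = (rep_matrix W bs g * rep_matrix W bs h) $$ (i, j)"
      by (simp add: rep_matrix_def T_mult scalar_prod_def atLeast0LessThan)
  qed (simp_all add: rep_matrix_def)
  moreover have "rep_matrix W bs \<one> = 1\<^sub>m n"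
    by (rule eq_matI) (simp_all add: rep_matrix_def T_one coord_basis)
  ultimately show ?thesis
    by (auto simp: group_rep_def hom_def ring_mat_simps) (simp_all add: rep_matrix_def)
qed

lemma trace_rep_matrix:
  "g \<in> carrier G \<Longrightarrow> mat_trace (rep_matrix W bs g) = quotient_trace V W (T g)"
  using quotient_trace_eq[OF linear_T invariantD[OF inv(1)] invariantD[OF inv(2)], of g]
  by (simp add: trace_def mat_trace_def rep_matrix_def)

text \<open>A stable subspace of coordinate vectors pulls back along the coordinate map to an
  invariant subspace between \<open>W\<close> and \<open>V\<close>, so simplicity of the quotient
  becomes \<open>irreducible_mats\<close>.\<close>

lemma simple_quotient_char:
  assumes "V \<noteq> W"
    and simple: "\<And>U. invariant U \<Longrightarrow> W \<subseteq> U \<Longrightarrow> U \<subseteq> V \<Longrightarrow> U = W \<or> U = V"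
  shows "(\<lambda>g\<in>carrier G. quotient_trace V W (T g)) \<in> irr_chars G"
proof -
  have n: "n > 0"
  proof (rule ccontr)
    assume "\<not> n > 0"
    then have "V \<subseteq> W" using coord_eq_0_imp by auto
    with W_le_V assms(1) show False by blast
  qed
  have "S = {0\<^sub>v n} \<or> S = carrier_vec n"
    if S: "VectorSpace.subspace class_ring S (module_vec TYPE(complex) n)"
      and RS: "\<forall>M\<in>rep_matrix W bs ` carrier G. \<forall>w\<in>S. M *\<^sub>v w \<in> S" for S
  proof -
    from S have S: "S \<subseteq> carrier_vec n" "0\<^sub>v n \<in> S" "\<And>v w. v \<in> S \<Longrightarrow> w \<in> S \<Longrightarrow> v + w \<in> S"
      "\<And>c v. v \<in> S \<Longrightarrow> c \<cdot>\<^sub>v v \<in> S" by (auto simp: vec_subspace_iff)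
    define U where "U = {v \<in> V. vec n (coord v) \<in> S}"
    have vec0: "vec n (coord v) = 0\<^sub>v n" if "v \<in> W" for v
      using that by (intro eq_vecI) (simp_all add: coord_in_W)
    have "pm.subspace U" unfolding U_def
    proof (rule pm.subspaceI)
      show "0 \<in> {v \<in> V. vec n (coord v) \<in> S}"
        using vec0[OF pm.subspace_0[OF subspace_W]] S(2) pm.subspace_0[OF subspace_V] by simp
    next
      fix u v assume uv: "u \<in> {v \<in> V. vec n (coord v) \<in> S}" "v \<in> {v \<in> V. vec n (coord v) \<in> S}"
      then have "vec n (coord (u + v)) = vec n (coord u) + vec n (coord v)"
        by (intro eq_vecI) (simp_all add: coord_add)
      with uv S(3) show "u + v \<in> {v \<in> V. vec n (coord v) \<in> S}"
        using pm.subspace_add[OF subspace_V] by simp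
    next
      fix c v assume v: "v \<in> {v \<in> V. vec n (coord v) \<in> S}"
      then have "vec n (coord (pm_scale c v)) = c \<cdot>\<^sub>v vec n (coord v)"
        by (intro eq_vecI) (simp_all add: coord_scale)
      with v S(4) show "pm_scale c v \<in> {v \<in> V. vec n (coord v) \<in> S}"
        using pm.subspace_scale[OF subspace_V] by simp
    qed
    moreover have "T g ` U \<subseteq> U" if g: "g \<in> carrier G" for g
    proof (intro image_subsetI)
      fix v assume v: "v \<in> U"
      then have "rep_matrix W bs g *\<^sub>v vec n (coord v) \<in> S" using RS g by (auto simp: U_def)
      then have "vec n (coord (T g v)) \<in> S" using rep_matrix_coord[OF g, of v] v by (simp add: U_def)
      with v show "T g v \<in> U" using invariantD[OF inv(1) g] by (auto simp: U_def)
    qed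
    ultimately have "invariant U" by (simp add: invariant_def)
    moreover have "W \<subseteq> U" using vec0 S(2) W_le_V by (auto simp: U_def)
    moreover have "U \<subseteq> V" by (auto simp: U_def)
    ultimately have "U = W \<or> U = V" by (rule simple)
    then show ?thesis
    proof
      assume U: "U = W"
      have "s = 0\<^sub>v n" if s: "s \<in> S" for s
      proof -
        have sv: "vec n (coord (lin_comb bs (($) s))) = s"
          using s S(1) by (intro eq_vecI) (auto simp: coord_lin_comb)
        with s have "lin_comb bs (($) s) \<in> U" by (simp add: U_def lin_comb_in_V)
        with sv vec0 show ?thesis by (simp add: U)
      qed
      with S(2) show ?thesis by blast
    next
      assume U: "U = V"
      have "s \<in> S" if s: "s \<in> carrier_vec n" for s
      proof -
        have "vec n (coord (lin_comb bs (($) s))) = s"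
          using s by (intro eq_vecI) (auto simp: coord_lin_comb)
        moreover have "lin_comb bs (($) s) \<in> U" unfolding U by (rule lin_comb_in_V)
        ultimately show ?thesis by (simp add: U_def)
      qed
      with S(1) show ?thesis by blast
    qed
  qed
  with n have "irreducible_mats n (rep_matrix W bs ` carrier G)" by (auto simp: irreducible_mats_def)
  moreover have "(\<lambda>g\<in>carrier G. quotient_trace V W (T g)) = (\<lambda>g\<in>carrier G. mat_trace (rep_matrix W bs g))"
    by (auto simp: trace_rep_matrix)
  ultimately show ?thesis unfolding irr_chars_def using group_rep_rep_matrix by blast
qed

end

text \<open>Induction on the dimension: a quotient that is neither zero nor simple is cut at an
  invariant \<open>U\<close>, and the multisets of the two layers are added. The finite spanning set
  is carried along to obtain bases of the layers.\<close>

lemma quotient_char_sum_irr_chars: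
  assumes "finite S" "V \<subseteq> pm.span S" "based_quotient V W bs" "invariant V" "invariant W"
  shows "\<exists>M. set_mset M \<subseteq> irr_chars G \<and> (\<forall>g\<in>carrier G. quotient_trace V W (T g) = (\<Sum>\<phi>\<in>#M. \<phi> g))"
  using assms(2-)
proof (induction "length bs" arbitrary: V W bs rule: less_induct)
  case less
  interpret based_quotient V W bs by (rule less.prems(2))
  consider "V = W" | "V \<noteq> W" "\<And>U. invariant U \<Longrightarrow> W \<subseteq> U \<Longrightarrow> U \<subseteq> V \<Longrightarrow> U = W \<or> U = V"
    | U where "invariant U" "W \<subseteq> U" "U \<subseteq> V" "U \<noteq> W" "U \<noteq> V" by blast
  then show ?case
  proof cases
    case 1
    have "quotient_trace V W (T g) = 0" if "g \<in> carrier G" for g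
      using quotient_trace_eq[OF linear_T invariantD invariantD] that less.prems invariantD[OF less.prems(3) that] bs_in_V
      by (simp add: trace_def) (use 1 in \<open>auto intro!: sum.neutral coord_in_W\<close>)
    then show ?thesis by (intro exI[of _ "{#}"]) simp
  next
    case 2
    with simple_quotient_char[OF less.prems(2-)] show ?thesis
      by (intro exI[of _ "{#\<lambda>g\<in>carrier G. quotient_trace V W (T g)#}"]) simp
  next
    case 3
    have "pm.subspace U" using 3 by (simp add: invariant_def)
    then interpret A: quotient_space U W + B: quotient_space V U
      using 3 subspace_V subspace_W by unfold_locales auto
    obtain cs where cs: "based_quotient U W cs"
      using A.obtain_basis[OF assms(1) subset_trans[OF 3(3) less.prems(1)]] .
    obtain ds where ds: "based_quotient V U ds"
      using B.obtain_basis[OF assms(1) less.prems(1)] .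
    interpret A: based_quotient U W cs by (rule cs)
    interpret B: based_quotient V U ds by (rule ds)
    \<comment> \<open>the trace of the identity shows that all bases of a quotient have the same length\<close>
    have "of_nat n = quotient_trace V W id" by (rule quotient_trace_id[OF less.prems(2), symmetric])
    also have "\<dots> = of_nat (length (cs @ ds))"
      by (rule quotient_trace_id[OF quotient_basis_append[OF cs ds]])
    finally have len: "n = A.n + B.n" by (simp flip: of_nat_add)
    have "A.n \<noteq> 0" using A.coord_eq_0_imp 3 by auto
    moreover have "B.n \<noteq> 0" using B.coord_eq_0_imp 3 by auto
    ultimately have lt: "A.n < n" "B.n < n" using len by auto
    obtain M where M: "set_mset M \<subseteq> irr_chars G" "\<forall>g\<in>carrier G. quotient_trace U W (T g) = (\<Sum>\<phi>\<in>#M. \<phi> g)"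
      using less.hyps[OF lt(1) subset_trans[OF 3(3) less.prems(1)] cs 3(1) less.prems(4)] by blast
    obtain N where N: "set_mset N \<subseteq> irr_chars G" "\<forall>g\<in>carrier G. quotient_trace V U (T g) = (\<Sum>\<phi>\<in>#N. \<phi> g)"
      using less.hyps[OF lt(2) less.prems(1) ds less.prems(3) 3(1)] by blast
    have "quotient_trace V W (T g) = (\<Sum>\<phi>\<in>#M + N. \<phi> g)" if g: "g \<in> carrier G" for g
      using quotient_trace_additive[OF cs ds linear_T[OF g] invariantD[OF less.prems(3) g]
          invariantD[OF 3(1) g] invariantD[OF less.prems(4) g]] M(2) N(2) g by simp
    with M(1) N(1) show ?thesis by (intro exI[of _ "M + N"]) simp
  qed
qed

end

section \<open>Permutation modules and the Specht module of a hook\<close>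

abbreviation lookup where "lookup \<equiv> Poly_Mapping.lookup"
abbreviation keys where "keys \<equiv> Poly_Mapping.keys"
abbreviation pm_unit :: "'a \<Rightarrow> 'a \<Rightarrow>\<^sub>0 complex" where "pm_unit x \<equiv> Poly_Mapping.single x 1"

lemma keys_pm_scale: "keys (pm_scale a p) \<subseteq> keys p"
  by (auto simp: in_keys_iff lookup_pm_scale)

text \<open>\<open>S\<close> may be larger than the support of \<open>p\<close>, so that several
  elements can be compared over one index set.\<close>

lemma lookup_pushforward:
  assumes "finite S" "keys p \<subseteq> S"
  shows "lookup (pushforward g p) y = (\<Sum>x\<in>S. if g x = y then lookup p x else 0)"
proof -
  have "lookup (pushforward g p) y = (\<Sum>x\<in>keys p. if g x = y then lookup p x else 0)"
    unfolding pushforward_def lookup_sum by (simp add: lookup_single when_def)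
  also have "\<dots> = (\<Sum>x\<in>S. if g x = y then lookup p x else 0)"
    using assms by (intro sum.mono_neutral_left) (auto simp: in_keys_iff)
  finally show ?thesis .
qed

lemma linear_pushforward: "pm_linear (pushforward g)"
proof (rule linearI_pm)
  fix p q :: "'a \<Rightarrow>\<^sub>0 complex"
  have "lookup (pushforward g (p + q)) y = lookup (pushforward g p + pushforward g q) y" for y
  proof -
    let ?S = "keys p \<union> keys q"
    have "lookup (pushforward g (p + q)) y = (\<Sum>x\<in>?S. if g x = y then lookup (p + q) x else 0)"
      by (intro lookup_pushforward keys_add) simp
    also have "\<dots> = (\<Sum>x\<in>?S. (if g x = y then lookup p x else 0) + (if g x = y then lookup q x else 0))"
      by (intro sum.cong refl) (simp add: lookup_add)
    also have "\<dots> = lookup (pushforward g p) y + lookup (pushforward g q) y"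
      unfolding sum.distrib by (intro arg_cong2[of _ _ _ _ "(+)"] lookup_pushforward[symmetric]) auto
    finally show ?thesis by (simp add: lookup_add)
  qed
  then show "pushforward g (p + q) = pushforward g p + pushforward g q" by (rule poly_mapping_eqI)
next
  fix a and p :: "'a \<Rightarrow>\<^sub>0 complex"
  have "lookup (pushforward g (pm_scale a p)) y = lookup (pm_scale a (pushforward g p)) y" for y
  proof -
    have "lookup (pushforward g (pm_scale a p)) y = (\<Sum>x\<in>keys p. if g x = y then lookup (pm_scale a p) x else 0)"
      by (intro lookup_pushforward keys_pm_scale) simp
    also have "\<dots> = (\<Sum>x\<in>keys p. a * (if g x = y then lookup p x else 0))"
      by (intro sum.cong refl) (simp add: lookup_pm_scale)
    also have "\<dots> = a * lookup (pushforward g p) y"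
      unfolding sum_distrib_left[symmetric] by (intro arg_cong[of _ _ "(*) a"] lookup_pushforward[symmetric]) auto
    finally show ?thesis by (simp add: lookup_pm_scale)
  qed
  then show "pushforward g (pm_scale a p) = pm_scale a (pushforward g p)" by (rule poly_mapping_eqI)
qed

lemma pushforward_single: "pushforward g (Poly_Mapping.single x a) = Poly_Mapping.single (g x) a"
  by (rule poly_mapping_eqI, subst lookup_pushforward[of "{x}"]) (simp_all add: lookup_single when_def)

lemma pushforward_sum: "pushforward g (\<Sum>x\<in>S. f x) = (\<Sum>x\<in>S. pushforward g (f x))"
proof -
  interpret Vector_Spaces.linear pm_scale pm_scale "pushforward g" by (rule linear_pushforward)
  show ?thesis by (rule sum)
qed

lemma pushforward_comp: "pushforward (f \<circ> g) p = pushforward f (pushforward g p)"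
proof -
  have "pushforward f (pushforward g p)
      = pushforward f (\<Sum>x\<in>keys p. Poly_Mapping.single (g x) (lookup p x))" by (simp add: pushforward_def)
  also have "\<dots> = pushforward (f \<circ> g) p"
    by (simp add: pushforward_sum pushforward_single) (simp add: pushforward_def)
  finally show ?thesis by simp
qed

lemma pushforward_id: "pushforward id p = p"
  by (rule poly_mapping_eqI) (simp add: lookup_pushforward[of "keys p"] in_keys_iff)

lemma lookup_pushforward_inj: "inj g \<Longrightarrow> lookup (pushforward g p) (g x) = lookup p x"
  by (simp add: lookup_pushforward[of "keys p"] inj_eq in_keys_iff)

lemma keys_pushforward: "keys (pushforward g p) \<subseteq> g ` keys p"
proof
  fix y assume "y \<in> keys (pushforward g p)"
  then have "(\<Sum>x\<in>keys p. if g x = y then lookup p x else 0) \<noteq> 0"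
    by (simp add: in_keys_iff lookup_pushforward[of "keys p"])
  then obtain x where "x \<in> keys p" "(if g x = y then lookup p x else 0) \<noteq> 0"
    by (rule sum.not_neutral_contains_not_neutral)
  then show "y \<in> g ` keys p" by (auto split: if_splits)
qed

section \<open>Free spaces on a set and traces of permutations\<close>

definition pm_on :: "'a set \<Rightarrow> ('a \<Rightarrow>\<^sub>0 complex) set" where
  "pm_on X = {p. keys p \<subseteq> X}"

lemma lookup_outside: "p \<in> pm_on X \<Longrightarrow> x \<notin> X \<Longrightarrow> lookup p x = 0"
  by (auto simp: pm_on_def in_keys_iff)

lemma pm_onI: "(\<And>x. x \<notin> X \<Longrightarrow> lookup p x = 0) \<Longrightarrow> p \<in> pm_on X"
  by (auto simp: pm_on_def in_keys_iff)

lemma subspace_pm_on: "pm.subspace (pm_on X)"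
  by (rule pm.subspaceI) (auto intro!: pm_onI simp: lookup_outside lookup_add lookup_pm_scale)

lemma subspace_zero: "pm.subspace {0}"
  by (rule pm.subspaceI) auto

lemma unit_in_pm_on: "x \<in> X \<Longrightarrow> pm_unit x \<in> pm_on X"
  by (simp add: pm_on_def)

lemma pm_on_expand:
  assumes "finite X" "p \<in> pm_on X"
  shows "p = (\<Sum>x\<in>X. pm_scale (lookup p x) (pm_unit x))"
proof (rule poly_mapping_eqI)
  fix y
  show "lookup p y = lookup (\<Sum>x\<in>X. pm_scale (lookup p x) (pm_unit x)) y"
    using assms lookup_outside[OF assms(2), of y]
    by (cases "y \<in> X") (simp_all add: lookup_sum lookup_pm_scale lookup_single when_def if_distrib cong: if_cong)
qed

lemma pm_on_span: "finite X \<Longrightarrow> pm_on X = pm.span (pm_unit ` X)"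
proof
  assume "finite X"
  show "pm_on X \<subseteq> pm.span (pm_unit ` X)"
  proof
    fix p assume "p \<in> pm_on X"
    from pm_on_expand[OF \<open>finite X\<close> this] show "p \<in> pm.span (pm_unit ` X)"
      by (metis (no_types, lifting) imageI pm.span_base pm.span_scale pm.span_sum)
  qed
  show "pm.span (pm_unit ` X) \<subseteq> pm_on X"
    by (intro pm.span_minimal subspace_pm_on) (auto intro: unit_in_pm_on)
qed

lemma based_quotient_pm_on:
  assumes "distinct xs" shows "based_quotient (pm_on (set xs)) {0} (map pm_unit xs)"
proof -
  have lookup_lc: "lookup (lin_comb (map pm_unit xs) c) (xs ! i) = c i" if "i < length xs" for c i
  proof -
    have "lookup (lin_comb (map pm_unit xs) c) (xs ! i) = (\<Sum>j<length xs. if j = i then c j else 0)"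
      unfolding lin_comb_def lookup_sum length_map
      using assms that by (intro sum.cong refl) (simp add: lookup_pm_scale lookup_single when_def nth_eq_iff_index_eq)
    with that show ?thesis by simp
  qed
  have lc_in: "lin_comb (map pm_unit xs) c \<in> pm_on (set xs)" for c
    by (intro lin_comb_in_subspace subspace_pm_on) (auto simp: unit_in_pm_on)
  have "p = lin_comb (map pm_unit xs) (\<lambda>i. lookup p (xs ! i))" if "p \<in> pm_on (set xs)" for p
  proof (rule poly_mapping_eqI)
    fix y
    show "lookup p y = lookup (lin_comb (map pm_unit xs) (\<lambda>i. lookup p (xs ! i))) y"
    proof (cases "y \<in> set xs")
      case True
      then obtain i where "i < length xs" "y = xs ! i" by (metis in_set_conv_nth)
      then show ?thesis by (simp add: lookup_lc)
    next
      case False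
      then show ?thesis by (simp add: lookup_outside[OF that] lookup_outside[OF lc_in])
    qed
  qed
  then have "\<exists>c. p - lin_comb (map pm_unit xs) c \<in> {0}" if "p \<in> pm_on (set xs)" for p
    using that by (metis diff_self singletonI)
  moreover have "\<forall>i<length (map pm_unit xs). c i = 0" if "lin_comb (map pm_unit xs) c \<in> {0}" for c
    using lookup_lc[of _ c] that by simp
  ultimately have "quotient_basis (pm_on (set xs)) {0} (map pm_unit xs)"
    by (auto simp: quotient_basis_def lin_comb_def unit_in_pm_on)
  then show ?thesis using subspace_pm_on subspace_zero pm.subspace_0[OF subspace_pm_on]
    by unfold_locales auto
qed

lemma quotient_trace_pm_on:
  assumes "finite X" "pm_linear T" "T ` pm_on X \<subseteq> pm_on X"
  shows "quotient_trace (pm_on X) {0} T = (\<Sum>x\<in>X. lookup (T (pm_unit x)) x)"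
proof -
  obtain xs where xs: "set xs = X" "distinct xs" using finite_distinct_list[OF assms(1)] by blast
  interpret based_quotient "pm_on X" "{0}" "map pm_unit xs"
    using based_quotient_pm_on[OF xs(2)] by (simp add: xs)
  interpret T: Vector_Spaces.linear pm_scale pm_scale T by (rule assms(2))
  have lookup_coord: "coord p i = lookup p (xs ! i)" if "p \<in> pm_on X" "i < length xs" for p i
  proof -
    have "lookup p (xs ! i) = lookup (lin_comb (map pm_unit xs) (coord p)) (xs ! i)"
      using coord[OF that(1)] by simp
    also have "\<dots> = (\<Sum>j<length xs. if j = i then coord p j else 0)"
      unfolding lin_comb_def lookup_sum length_map
      using xs(2) that(2) by (intro sum.cong refl) (simp add: lookup_pm_scale lookup_single when_def nth_eq_iff_index_eq)
    finally show ?thesis using that(2) by simp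
  qed
  have "quotient_trace (pm_on X) {0} T = trace T"
    by (rule quotient_trace_eq[OF assms(2,3)]) simp
  also have "\<dots> = (\<Sum>i<length xs. lookup (T (pm_unit (xs ! i))) (xs ! i))"
    unfolding trace_def length_map
  proof (intro sum.cong refl)
    fix i assume "i \<in> {..<length xs}"
    then have "i < length xs" "pm_unit (xs ! i) \<in> pm_on X" using xs(1) by (auto intro: unit_in_pm_on)
    then show "coord (T (map pm_unit xs ! i)) i = lookup (T (pm_unit (xs ! i))) (xs ! i)"
      using assms(3) by (simp add: lookup_coord image_subset_iff)
  qed
  also have "\<dots> = (\<Sum>x\<in>X. lookup (T (pm_unit x)) x)"
    using sum.reindex_bij_betw[OF bij_betw_nth[OF xs(2) refl xs(1)[symmetric]],
        of "\<lambda>x. lookup (T (pm_unit x)) x"] .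
  finally show ?thesis .
qed

lemma pushforward_pm_on: "g ` X \<subseteq> Y \<Longrightarrow> pushforward g ` pm_on X \<subseteq> pm_on Y"
  using keys_pushforward by (fastforce simp: pm_on_def)

text \<open>The kernel of the augmentation map on the free space over \<open>X\<close>.\<close>

definition pm_sum_zero :: "'a set \<Rightarrow> ('a \<Rightarrow>\<^sub>0 complex) set" where
  "pm_sum_zero X = {p \<in> pm_on X. (\<Sum>x\<in>X. lookup p x) = 0}"

lemma subspace_pm_sum_zero: "pm.subspace (pm_sum_zero X)"
  unfolding pm_sum_zero_def
  by (rule pm.subspaceI) (auto simp: pm.subspace_0[OF subspace_pm_on] pm.subspace_add[OF subspace_pm_on]
      pm.subspace_scale[OF subspace_pm_on] lookup_add lookup_pm_scale sum.distrib simp flip: sum_distrib_left)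

lemma sum_lookup_pushforward:
  assumes "finite X" "g ` X \<subseteq> X" "p \<in> pm_on X"
  shows "(\<Sum>x\<in>X. lookup (pushforward g p) x) = (\<Sum>x\<in>X. lookup p x)"
proof -
  have "(\<Sum>y\<in>X. lookup (pushforward g p) y) = (\<Sum>y\<in>X. \<Sum>x\<in>X. if g x = y then lookup p x else 0)"
    using assms by (intro sum.cong refl lookup_pushforward) (auto simp: pm_on_def)
  also have "\<dots> = (\<Sum>x\<in>X. \<Sum>y\<in>X. if g x = y then lookup p x else 0)" by (rule sum.swap)
  also have "\<dots> = (\<Sum>x\<in>X. lookup p x)" using assms(1,2) by (intro sum.cong refl) auto
  finally show ?thesis .
qed

text \<open>The coefficient sum identifies the quotient with the ground field.\<close>

lemma based_quotient_pm_sum_zero: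
  assumes X: "finite X" "x0 \<in> X"
  shows "based_quotient (pm_on X) (pm_sum_zero X) [pm_unit x0]"
proof -
  have *: "p - pm_scale c (pm_unit x0) \<in> pm_sum_zero X \<longleftrightarrow> (\<Sum>x\<in>X. lookup p x) = c"
    if "p \<in> pm_on X" for p c
  proof -
    have "(\<Sum>x\<in>X. lookup (pm_scale c (pm_unit x0)) x) = (\<Sum>x\<in>X. if x0 = x then c else 0)"
      by (intro sum.cong refl) (simp add: lookup_pm_scale lookup_single when_def)
    then have "(\<Sum>x\<in>X. lookup (p - pm_scale c (pm_unit x0)) x) = (\<Sum>x\<in>X. lookup p x) - c"
      using X by (simp add: lookup_minus sum_subtractf)
    moreover have "p - pm_scale c (pm_unit x0) \<in> pm_on X"
      using that X by (intro pm.subspace_diff pm.subspace_scale subspace_pm_on unit_in_pm_on)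
    ultimately show ?thesis by (simp add: pm_sum_zero_def)
  qed
  have "c = 0" if "pm_scale c (pm_unit x0) \<in> pm_sum_zero X" for c
    using *[OF pm.subspace_0[OF subspace_pm_on], of "- c"] that by simp
  then have "quotient_basis (pm_on X) (pm_sum_zero X) [pm_unit x0]"
    using X * by (auto simp: quotient_basis_def unit_in_pm_on lessThan_Suc)
  then show ?thesis using subspace_pm_on subspace_pm_sum_zero
    by unfold_locales (auto simp: pm_sum_zero_def)
qed

text \<open>On the whole free space the trace counts fixed points. The one-dimensional quotient by
  the sum-zero part is acted on trivially, and by additivity it takes 1 away.\<close>

lemma quotient_trace_pm_sum_zero:
  assumes X: "finite X" "x0 \<in> X" and g: "g ` X \<subseteq> X"
  shows "quotient_trace (pm_sum_zero X) {0} (pushforward g) = of_nat (card {x \<in> X. g x = x}) - 1"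
proof -
  let ?T = "pushforward g"
  have pres: "?T ` pm_on X \<subseteq> pm_on X" by (rule pushforward_pm_on[OF g])
  have pres0: "?T ` pm_sum_zero X \<subseteq> pm_sum_zero X"
    using pres sum_lookup_pushforward[OF X(1) g] by (auto simp: pm_sum_zero_def)
  have zero: "?T ` {0} \<subseteq> {0}" by (simp add: pushforward_def)
  interpret A: based_quotient "pm_on X" "pm_sum_zero X" "[pm_unit x0]"
    by (rule based_quotient_pm_sum_zero[OF X])
  interpret B: quotient_space "pm_sum_zero X" "{0}"
    using subspace_pm_sum_zero subspace_zero pm.subspace_0[OF subspace_pm_sum_zero] by unfold_locales auto
  obtain bs where bs: "based_quotient (pm_sum_zero X) {0} bs"
    using B.obtain_basis[of "pm_unit ` X"] X(1) pm_on_span[OF X(1)] by (auto simp: pm_sum_zero_def)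
  have "A.trace ?T = 1"
  proof -
    have "?T (pm_unit x0) - lin_comb [pm_unit x0] (\<lambda>_. 1) \<in> pm_sum_zero X"
    proof -
      have "lookup (pm_unit (g x0)) = (\<lambda>y. if g x0 = y then 1 else 0)" "lookup (pm_unit x0) = (\<lambda>y. if x0 = y then 1 else 0)"
        by (auto simp: lookup_single when_def)
      then show ?thesis using X g
        by (auto simp: pm_sum_zero_def lin_comb_def lessThan_Suc pushforward_single lookup_minus sum_subtractf
          intro!: pm.subspace_diff subspace_pm_on unit_in_pm_on)
    qed
    from A.coord_unique[OF this, of 0] show ?thesis by (simp add: A.trace_def lessThan_Suc)
  qed
  then have "quotient_trace (pm_on X) (pm_sum_zero X) ?T = 1"
    using A.quotient_trace_eq[OF linear_pushforward pres pres0] by simp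
  moreover have "quotient_trace (pm_on X) {0} ?T = of_nat (card {x \<in> X. g x = x})"
    using quotient_trace_pm_on[OF X(1) linear_pushforward pres] X(1)
    by (simp add: pushforward_single lookup_single when_def sum.If_cases Int_def)
  ultimately show ?thesis
    using quotient_trace_additive[OF bs A.based_quotient_axioms linear_pushforward pres pres0 zero]
    by (simp add: algebra_simps)
qed

text \<open>\<open>\<iota>\<close> turns a permutation of numbers into one of basis elements; it
  serves both for tabloids and for words.\<close>

lemma pm_rep_pushforward:
  assumes "\<And>\<pi> \<sigma>. \<iota> (\<pi> \<circ> \<sigma>) = \<iota> \<pi> \<circ> \<iota> \<sigma>" "\<iota> id = id"
  shows "pm_rep (sym_group n) (\<lambda>\<pi>. pushforward (\<iota> \<pi>))"
  by (intro pm_rep.intro pm_rep_axioms.intro sym_group_is_group linear_pushforward)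
    (simp_all add: sym_group_mult sym_group_one assms pushforward_comp pushforward_id)

section \<open>The Specht module of shape (d - 1, 1)\<close>

context
  fixes d :: nat
  assumes d: "d \<ge> 2"
  notes One_nat_def [simp del]
begin

text \<open>A tabloid of shape \<open>(d - 1, 1)\<close> is determined by the entry of its second row.\<close>

definition hook_tabloid :: "nat \<Rightarrow> nat set list" where
  "hook_tabloid i = [{1..d} - {i}, {i}]"

lemma inj_hook_tabloid: "inj hook_tabloid"
  by (auto simp: inj_def hook_tabloid_def)

lemma image_hook_tabloid:
  "\<pi> permutes {1..d} \<Longrightarrow> map ((`) \<pi>) (hook_tabloid i) = hook_tabloid (\<pi> i)"
  by (simp add: hook_tabloid_def image_set_diff permutes_inj permutes_image)

lemma cells_hook: "cells [d - 1, 1] = insert (1, 0) ((\<lambda>j. (0, j)) ` {..<d - 1})"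
  by (auto simp: cells_def less_Suc_eq nth_Cons' split: if_splits)

lemma tabloid_hook:
  assumes t: "tableau [d - 1, 1] t"
  shows "tabloid [d - 1, 1] t = hook_tabloid (t (1, 0))"
proof -
  have bij: "bij_betw t (cells [d - 1, 1]) {1..d}" using t d by (simp add: tableau_def)
  have rows: "{c \<in> cells [d - 1, 1]. fst c = 0} = cells [d - 1, 1] - {(1, 0)}"
    "{c \<in> cells [d - 1, 1]. fst c = 1} = {(1, 0)}" by (auto simp: cells_hook)
  have "t ` (cells [d - 1, 1] - {(1, 0)}) = t ` cells [d - 1, 1] - t ` {(1, 0)}"
    using bij by (intro inj_on_image_set_diff[of t "cells [d - 1, 1]"]) (auto simp: bij_betw_def cells_hook)
  then have "t ` (cells [d - 1, 1] - {(1, 0)}) = {1..d} - {t (1, 0)}"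
    using bij by (simp add: bij_betw_def)
  moreover have "[0..<length [d - 1, 1]] = [0, 1]" by (simp add: upt_rec One_nat_def)
  ultimately show ?thesis using rows by (simp only: tabloid_def hook_tabloid_def list.map image_insert image_empty)
qed

text \<open>Only the first column has two cells, so the column stabilizer consists of the identity
  and the swap of the two entries there, with signs 1 and -1.\<close>

lemma polytabloid_hook:
  assumes t: "tableau [d - 1, 1] t"
  shows "polytabloid [d - 1, 1] t = pm_unit (hook_tabloid (t (1, 0))) - pm_unit (hook_tabloid (t (0, 0)))"
proof -
  define a b where "a = t (0, 0)" and "b = t (1, 0)"
  have bij: "bij_betw t (cells [d - 1, 1]) {1..d}" and sum: "sum_list [d - 1, 1] = d"
    using t d by (simp_all add: tableau_def)
  have in_cells: "(0, 0) \<in> cells [d - 1, 1]" "(1, 0) \<in> cells [d - 1, 1]" using d by (auto simp: cells_hook)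
  have ab: "a \<in> {1..d}" "b \<in> {1..d}" using in_cells bij by (auto simp: a_def b_def bij_betw_def)
  have "a \<noteq> b" using inj_onD[OF bij_betw_imp_inj_on[OF bij] _ in_cells] by (auto simp: a_def b_def)
  have col0: "{c \<in> cells [d - 1, 1]. snd c = 0} = {(0, 0), (1, 0)}" using d by (auto simp: cells_hook)
  have colj: "{c \<in> cells [d - 1, 1]. snd c = j} = (if j < d - 1 then {(0, j)} else {})" if "j > 0" for j
    using that by (auto simp: cells_hook)
  have "column_stabilizer [d - 1, 1] t = {id, transpose a b}"
  proof (intro subset_antisym subsetI)
    fix \<sigma> assume "\<sigma> \<in> column_stabilizer [d - 1, 1] t"
    then have \<sigma>: "\<sigma> permutes {1..d}"
      "\<And>j. \<sigma> ` t ` {c \<in> cells [d - 1, 1]. snd c = j} = t ` {c \<in> cells [d - 1, 1]. snd c = j}"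
      unfolding column_stabilizer_def sum by auto
    have 0: "{\<sigma> a, \<sigma> b} = {a, b}" using \<sigma>(2)[of 0] unfolding col0 by (simp add: a_def b_def)
    \<comment> \<open>An entry outside the first column is alone in its column and hence
      fixed.\<close>
    have fix1: "\<sigma> x = x" if x: "x \<in> {1..d}" "x \<noteq> a" "x \<noteq> b" for x
    proof -
      have "x \<in> t ` cells [d - 1, 1]" using bij_betw_imp_surj_on[OF bij] x(1) by simp
      then obtain c where c: "c \<in> cells [d - 1, 1]" "x = t c" by blast
      then have "c \<noteq> (0, 0)" "c \<noteq> (1, 0)" using x by (auto simp: a_def b_def)
      with c(1) obtain j where j: "c = (0, j)" "0 < j" "j < d - 1" by (auto simp: cells_hook)
      with \<sigma>(2)[of j] show ?thesis unfolding c(2) colj[OF j(2)] by simp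
    qed
    have fix2: "\<sigma> x = x" if "x \<notin> {1..d}" for x using \<sigma>(1) that by (rule permutes_not_in)
    show "\<sigma> \<in> {id, transpose a b}"
    proof (cases "\<sigma> a = a")
      case True
      then have "\<sigma> b = b" using 0 by (auto simp: doubleton_eq_iff)
      with True fix1 fix2 have "\<sigma> x = id x" for x by (cases "x = a"; cases "x = b"; cases "x \<in> {1..d}") auto
      then show ?thesis by auto
    next
      case False
      then have s: "\<sigma> a = b" "\<sigma> b = a" using 0 by (auto simp: doubleton_eq_iff)
      with fix1 fix2 have "\<sigma> x = transpose a b x" for x
        by (cases "x = a"; cases "x = b"; cases "x \<in> {1..d}") auto
      then show ?thesis by auto
    qed
  next
    fix \<sigma> assume \<sigma>: "\<sigma> \<in> {id, transpose a b}"
    have "\<sigma> ` t ` {c \<in> cells [d - 1, 1]. snd c = j} = t ` {c \<in> cells [d - 1, 1]. snd c = j}" for j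
    proof (cases "j = 0")
      case True
      with \<sigma> show ?thesis unfolding True col0 by (auto simp: a_def b_def)
    next
      case False
      have "t (0, j) \<noteq> a" "t (0, j) \<noteq> b" if "j < d - 1"
        using False that inj_onD[OF bij_betw_imp_inj_on[OF bij], of "(0, j)"] in_cells
        by (auto simp: a_def b_def cells_hook)
      with \<sigma> False show ?thesis by (auto simp: colj)
    qed
    moreover have "\<sigma> permutes {1..d}" using \<sigma> ab by (auto simp: permutes_id permutes_swap_id)
    ultimately show "\<sigma> \<in> column_stabilizer [d - 1, 1] t" unfolding column_stabilizer_def sum by auto
  qed
  moreover have "id \<noteq> transpose a b" using \<open>a \<noteq> b\<close> by (metis id_apply transpose_apply_first)
  moreover have "tableau [d - 1, 1] (transpose a b \<circ> t)"
    unfolding tableau_def sum using bij ab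
    by (intro bij_betw_trans[OF bij] permutes_imp_bij permutes_swap_id)
  from tabloid_hook[OF this] have "tabloid [d - 1, 1] (transpose a b \<circ> t) = hook_tabloid a"
    by (simp add: b_def)
  moreover have "tabloid [d - 1, 1] t = hook_tabloid b" using tabloid_hook[OF t] by (simp add: b_def)
  ultimately show ?thesis
    unfolding polytabloid_def using \<open>a \<noteq> b\<close> by (simp add: sign_swap_id single_uminus a_def b_def)
qed

lemma ex_hook_tableau:
  assumes "a \<in> {1..d}" "b \<in> {1..d}" "a \<noteq> b"
  obtains t where "tableau [d - 1, 1] t" "t (0, 0) = a" "t (1, 0) = b"
proof -
  let ?C = "cells [d - 1, 1] - {(0, 0), (1, 0)}"
  have "finite (cells [d - 1, 1])" by (simp add: cells_hook)
  moreover have "card (cells [d - 1, 1]) = d"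
    using d unfolding cells_hook by (subst card_insert_disjoint) (auto simp: card_image inj_on_def)
  moreover have sub: "{(0, 0), (1, 0)} \<subseteq> cells [d - 1, 1]" using d by (auto simp: cells_hook)
  ultimately have "card ?C = d - 2" by (subst card_Diff_subset) auto
  moreover have "card ({1..d} - {a, b}) = d - 2" using assms by (subst card_Diff_subset) auto
  \<comment> \<open>The remaining cells and numbers are equally many, so any bijection between them
    completes the filling.\<close>
  ultimately obtain t where t: "bij_betw t ?C ({1..d} - {a, b})"
    using finite_same_card_bij[of ?C "{1..d} - {a, b}"] \<open>finite (cells [d - 1, 1])\<close> by auto
  let ?t = "t((0, 0) := a, (1, 0) := b)"
  have "bij_betw ?t ?C ({1..d} - {a, b})"
    using t by (rule bij_betw_cong[THEN iffD1, rotated]) auto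
  moreover have "bij_betw ?t {(0, 0), (1, 0)} {a, b}" using assms(3) by (auto simp: bij_betw_def)
  ultimately have "bij_betw ?t (?C \<union> {(0, 0), (1, 0)}) (({1..d} - {a, b}) \<union> {a, b})"
    by (rule bij_betw_combine) auto
  moreover have "?C \<union> {(0, 0), (1, 0)} = cells [d - 1, 1]" "({1..d} - {a, b}) \<union> {a, b} = {1..d}"
    using sub assms by auto
  ultimately have "tableau [d - 1, 1] ?t" using d by (simp add: tableau_def)
  then show ?thesis by (rule that) simp_all
qed

text \<open>Polytabloids are differences of two basis tabloids, every such difference occurs, and
  these differences span the vectors with coefficient sum zero.\<close>

lemma specht_module_hook:
  "specht_module [d - 1, 1] = pm_sum_zero (hook_tabloid ` {1..d})" (is "?S = pm_sum_zero ?X")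
proof
  have "pm_unit (hook_tabloid b) - pm_unit (hook_tabloid a) \<in> pm_sum_zero ?X" if "a \<in> {1..d}" "b \<in> {1..d}" for a b
  proof -
    have "(\<Sum>x\<in>?X. lookup (pm_unit (hook_tabloid i)) x) = 1" if "i \<in> {1..d}" for i
      using that by (simp add: lookup_single when_def)
    then show ?thesis using that
      by (auto simp: pm_sum_zero_def lookup_minus sum_subtractf intro!: pm.subspace_diff subspace_pm_on unit_in_pm_on)
  qed
  moreover have "t (0, 0) \<in> {1..d}" "t (1, 0) \<in> {1..d}" if "tableau [d - 1, 1] t" for t
  proof -
    have "(0, 0) \<in> cells [d - 1, 1]" "(1, 0) \<in> cells [d - 1, 1]" using d by (auto simp: cells_hook)
    moreover have "bij_betw t (cells [d - 1, 1]) {1..d}" using that d by (simp add: tableau_def)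
    ultimately show "t (0, 0) \<in> {1..d}" "t (1, 0) \<in> {1..d}" by (auto simp: bij_betw_def)
  qed
  ultimately show "?S \<subseteq> pm_sum_zero ?X" unfolding specht_module_def
    by (intro pm.span_minimal subspace_pm_sum_zero) (auto simp: polytabloid_hook)
next
  have diff: "pm_unit (hook_tabloid b) - pm_unit (hook_tabloid 1) \<in> ?S" if "b \<in> {1..d}" for b
  proof (cases "b = 1")
    case True
    then show ?thesis by (simp add: specht_module_def pm.span_zero)
  next
    case False
    have "1 \<in> {1..d}" using d by simp
    from ex_hook_tableau[OF this that] False
    obtain t where "tableau [d - 1, 1] t" "t (0, 0) = 1" "t (1, 0) = b" by metis
    then show ?thesis unfolding specht_module_def
      by (intro pm.span_base) (metis (mono_tags, lifting) mem_Collect_eq polytabloid_hook)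
  qed
  show "pm_sum_zero ?X \<subseteq> ?S"
  proof
    fix p assume "p \<in> pm_sum_zero ?X"
    then have p: "p \<in> pm_on ?X" "(\<Sum>x\<in>?X. lookup p x) = 0" by (auto simp: pm_sum_zero_def)
    have inj: "inj_on hook_tabloid {1..d}" using inj_hook_tabloid by (rule inj_on_subset) simp
    have "p = (\<Sum>x\<in>?X. pm_scale (lookup p x) (pm_unit x))" by (rule pm_on_expand[OF _ p(1)]) simp
    \<comment> \<open>Comparing every basis vector with that of \<open>hook_tabloid 1\<close> leaves
      a correction proportional to the coefficient sum, which is zero.\<close>
    also have "\<dots> = (\<Sum>x\<in>?X. pm_scale (lookup p x) (pm_unit x - pm_unit (hook_tabloid 1)))
        + (\<Sum>x\<in>?X. pm_scale (lookup p x) (pm_unit (hook_tabloid 1)))"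
      by (simp add: pm.scale_right_diff_distrib flip: sum.distrib)
    also have "(\<Sum>x\<in>?X. pm_scale (lookup p x) (pm_unit (hook_tabloid 1))) = 0"
      by (simp add: p(2) flip: pm.scale_sum_left)
    finally have "p = (\<Sum>x\<in>?X. pm_scale (lookup p x) (pm_unit x - pm_unit (hook_tabloid 1)))" by simp
    also have "\<dots> \<in> ?S" unfolding specht_module_def
      by (intro pm.span_sum pm.span_scale) (use diff in \<open>auto simp: specht_module_def\<close>)
    finally show "p \<in> ?S" .
  qed
qed

interpretation rep: pm_rep "sym_group d" "\<lambda>\<pi>. pushforward (map ((`) \<pi>))"
  by (rule pm_rep_pushforward) (auto simp: image_comp fun_eq_iff)

lemma hook_stable: "\<pi> permutes {1..d} \<Longrightarrow> map ((`) \<pi>) ` hook_tabloid ` {1..d} \<subseteq> hook_tabloid ` {1..d}"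
  using permutes_image[of \<pi> "{1..d}"] by (fastforce simp: image_hook_tabloid)

lemma invariant_hook: "rep.invariant (pm_sum_zero (hook_tabloid ` {1..d}))"
  unfolding rep.invariant_def sym_group_carrier
proof (intro conjI ballI subspace_pm_sum_zero)
  fix \<pi> assume "\<pi> \<in> carrier (sym_group d)"
  then have \<pi>: "\<pi> permutes {1..d}" by (simp add: sym_group_carrier)
  show "pushforward (map ((`) \<pi>)) ` pm_sum_zero (hook_tabloid ` {1..d}) \<subseteq> pm_sum_zero (hook_tabloid ` {1..d})"
    using pushforward_pm_on[OF hook_stable[OF \<pi>]] sum_lookup_pushforward[OF _ hook_stable[OF \<pi>]]
    by (auto simp: pm_sum_zero_def)
qed

text \<open>A nonzero \<open>p\<close> in \<open>U\<close> has two different coefficients.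
  Subtracting from \<open>p\<close> its image under the corresponding transposition leaves a nonzero
  multiple of a difference of two basis vectors, and further transpositions carry this difference to
  a spanning set.\<close>

lemma specht_hook_simple:
  assumes U: "rep.invariant U" "U \<subseteq> pm_sum_zero (hook_tabloid ` {1..d})" "U \<noteq> {0}"
  shows "U = pm_sum_zero (hook_tabloid ` {1..d})"
proof -
  let ?X = "hook_tabloid ` {1..d}" and ?v = "\<lambda>i. pm_unit (hook_tabloid i)"
  have sub: "pm.subspace U" using U(1) by (simp add: rep.invariant_def)
  have act: "pushforward (map ((`) \<pi>)) p \<in> U" if "\<pi> permutes {1..d}" "p \<in> U" for \<pi> p
    using rep.invariantD[OF U(1), of \<pi>] that by (auto simp: sym_group_carrier)
  have inj: "inj_on hook_tabloid {1..d}" using inj_hook_tabloid by (rule inj_on_subset) simp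
  have expand: "p = (\<Sum>i\<in>{1..d}. pm_scale (lookup p (hook_tabloid i)) (?v i))" if "p \<in> pm_on ?X" for p
    by (rule trans[OF pm_on_expand[OF _ that]]) (simp_all add: sum.reindex[OF inj])
  obtain p where p: "p \<in> U" "p \<noteq> 0" using U(3) pm.subspace_0[OF sub] by blast
  from p(1) U(2) have "p \<in> pm_sum_zero ?X" by blast
  then have p': "p \<in> pm_on ?X" "(\<Sum>i\<in>{1..d}. lookup p (hook_tabloid i)) = 0"
    by (simp_all add: pm_sum_zero_def sum.reindex[OF inj])
  \<comment> \<open>A vector with constant coefficients has \<open>d\<close> times that constant as
    its coefficient sum, so a sum of zero would force \<open>p = 0\<close>.\<close>
  have "\<exists>i\<in>{1..d}. \<exists>j\<in>{1..d}. lookup p (hook_tabloid i) \<noteq> lookup p (hook_tabloid j)"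
  proof (rule ccontr)
    have one: "1 \<in> {1..d}" using d by simp
    assume "\<not> ?thesis"
    then have const: "lookup p (hook_tabloid i) = lookup p (hook_tabloid 1)" if "i \<in> {1..d}" for i
      using that one by blast
    then have "(\<Sum>i\<in>{1..d}. lookup p (hook_tabloid i)) = (\<Sum>i\<in>{1..d}. lookup p (hook_tabloid 1))"
      by (rule sum.cong[OF refl])
    with p'(2) d have "lookup p (hook_tabloid 1) = 0" by simp
    with const have "(\<Sum>i\<in>{1..d}. pm_scale (lookup p (hook_tabloid i)) (?v i)) = 0" by simp
    with expand[OF p'(1)] have "p = 0" by (rule trans)
    with p(2) show False ..
  qed
  then obtain i j where ij: "i \<in> {1..d}" "j \<in> {1..d}" "lookup p (hook_tabloid i) \<noteq> lookup p (hook_tabloid j)"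
    by blast
  then have "i \<noteq> j" by auto
  define c where "c = lookup p (hook_tabloid i) - lookup p (hook_tabloid j)"
  have swap: "transpose a b permutes {1..d}" if "a \<in> {1..d}" "b \<in> {1..d}" for a b
    using that by (rule permutes_swap_id)
  let ?g = "map ((`) (transpose i j))"
  have "p - pushforward ?g p = pm_scale c (?v i - ?v j)"
  proof (rule poly_mapping_eqI)
    fix y
    have inj_g: "inj ?g" by (intro inj_mapI injI) (simp add: inj_image_eq_iff)
    have lg: "lookup (pushforward ?g p) (hook_tabloid (transpose i j k)) = lookup p (hook_tabloid k)" for k
      using lookup_pushforward_inj[OF inj_g, of p "hook_tabloid k"]
      by (simp add: image_hook_tabloid[OF swap[OF ij(1,2)]])
    show "lookup (p - pushforward ?g p) y = lookup (pm_scale c (?v i - ?v j)) y"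
    proof (cases "y \<in> ?X")
      case True
      then obtain k where k: "k \<in> {1..d}" "y = hook_tabloid k" by auto
      have "lookup (pushforward ?g p) y = lookup p (hook_tabloid (transpose i j k))"
        using lg[of "transpose i j k"] k by simp
      then show ?thesis using k \<open>i \<noteq> j\<close>
        by (auto simp: lookup_minus lookup_pm_scale lookup_single when_def c_def transpose_def inj_eq[OF inj_hook_tabloid])
    next
      case False
      have "pushforward ?g p \<in> pm_on ?X"
        using pushforward_pm_on[OF hook_stable[OF swap[OF ij(1,2)]]] p'(1) by blast
      then show ?thesis using False p'(1) ij
        by (auto simp: lookup_minus lookup_pm_scale lookup_single when_def lookup_outside)
    qed
  qed
  moreover have "p - pushforward ?g p \<in> U"
    using p(1) by (intro pm.subspace_diff[OF sub] act swap ij)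
  ultimately have "pm_scale c (?v i - ?v j) \<in> U" by simp
  moreover have "c \<noteq> 0" using ij(3) by (simp add: c_def)
  ultimately have vij: "?v i - ?v j \<in> U" using pm.subspace_scale[OF sub, of _ "1 / c"] by fastforce
  have vik: "?v k - ?v i \<in> U" if k: "k \<in> {1..d}" for k
  proof (cases "k = i")
    case True
    then show ?thesis using pm.subspace_0[OF sub] by simp
  next
    case False
    \<comment> \<open>This transposition fixes \<open>i\<close> and moves \<open>j\<close> to
      \<open>k\<close>, so it carries the known difference to the wanted one up to sign.\<close>
    have perm: "transpose j k permutes {1..d}" by (rule swap[OF ij(2) k])
    interpret L: Vector_Spaces.linear pm_scale pm_scale "pushforward (map ((`) (transpose j k)))"
      by (rule linear_pushforward)
    have "pushforward (map ((`) (transpose j k))) (?v i - ?v j) = ?v i - ?v k"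
      using False \<open>i \<noteq> j\<close> by (simp add: L.diff pushforward_single image_hook_tabloid[OF perm] transpose_def)
    with act[OF perm vij] have "?v i - ?v k \<in> U" by simp
    from pm.subspace_neg[OF sub this] show ?thesis by simp
  qed
  show ?thesis
  proof (intro subset_antisym U(2) subsetI)
    fix q assume "q \<in> pm_sum_zero ?X"
    then have q: "q \<in> pm_on ?X" "(\<Sum>k\<in>{1..d}. lookup q (hook_tabloid k)) = 0"
      by (auto simp: pm_sum_zero_def sum.reindex[OF inj])
    have "q = (\<Sum>k\<in>{1..d}. pm_scale (lookup q (hook_tabloid k)) (?v k))" by (rule expand[OF q(1)])
    also have "\<dots> = (\<Sum>k\<in>{1..d}. pm_scale (lookup q (hook_tabloid k)) (?v k - ?v i))
        + (\<Sum>k\<in>{1..d}. pm_scale (lookup q (hook_tabloid k)) (?v i))"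
      by (simp add: pm.scale_right_diff_distrib flip: sum.distrib)
    also have "(\<Sum>k\<in>{1..d}. pm_scale (lookup q (hook_tabloid k)) (?v i)) = 0"
      by (simp only: pm.scale_sum_left[symmetric] q(2) pm.scale_zero_left)
    finally have "q = (\<Sum>k\<in>{1..d}. pm_scale (lookup q (hook_tabloid k)) (?v k - ?v i))" by simp
    also have "\<dots> \<in> U" by (intro pm.subspace_sum pm.subspace_scale sub vik)
    finally show "q \<in> U" .
  qed
qed

text \<open>A tabloid is fixed exactly when the entry of its second row is, so fixed tabloids are
  counted by fixed points.\<close>

lemma specht_char_hook:
  assumes "\<pi> permutes {1..d}"
  shows "specht_char [d - 1, 1] \<pi> = of_nat (card {i \<in> {1..d}. \<pi> i = i}) - 1"
proof -
  let ?X = "hook_tabloid ` {1..d}"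
  have "specht_char [d - 1, 1] \<pi> = quotient_trace (pm_sum_zero ?X) {0} (pushforward (map ((`) \<pi>)))"
    using assms d by (simp add: specht_char_def specht_module_hook sym_group_carrier)
  also have "\<dots> = of_nat (card {x \<in> ?X. map ((`) \<pi>) x = x}) - 1"
    by (rule quotient_trace_pm_sum_zero[of _ "hook_tabloid 1"]) (use d hook_stable[OF assms] in auto)
  also have "{x \<in> ?X. map ((`) \<pi>) x = x} = hook_tabloid ` {i \<in> {1..d}. \<pi> i = i}"
    using inj_hook_tabloid by (auto simp: image_hook_tabloid[OF assms] inj_eq)
  also have "card \<dots> = card {i \<in> {1..d}. \<pi> i = i}"
    by (intro card_image inj_on_subset[OF inj_hook_tabloid]) simp
  finally show ?thesis .
qed

text \<open>Simplicity of the Specht module, phrased for characters because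
  \<open>char_mult_eq\<close> counts an irreducible character. The module is nonzero because
  \<open>d \<ge> 2\<close> provides two distinct tabloids.\<close>

lemma specht_char_hook_irr: "specht_char [d - 1, 1] \<in> irr_chars (sym_group d)"
proof -
  let ?X = "hook_tabloid ` {1..d}"
  interpret B: quotient_space "pm_sum_zero ?X" "{0}"
    using subspace_pm_sum_zero subspace_zero pm.subspace_0[OF subspace_pm_sum_zero] by unfold_locales auto
  have "pm_sum_zero ?X \<subseteq> pm.span (pm_unit ` ?X)" by (auto simp: pm_sum_zero_def simp flip: pm_on_span)
  then obtain bs where bs: "based_quotient (pm_sum_zero ?X) {0} bs"
    using B.obtain_basis[of "pm_unit ` ?X"] by auto
  have zero: "rep.invariant {0}" by (simp add: rep.invariant_def subspace_zero pushforward_def)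
  have "pm_unit (hook_tabloid 1) - pm_unit (hook_tabloid 2) \<in> pm_sum_zero ?X"
    using d by (auto simp: pm_sum_zero_def lookup_minus sum_subtractf lookup_single when_def
        intro!: pm.subspace_diff subspace_pm_on unit_in_pm_on)
  moreover have "lookup (pm_unit (hook_tabloid 1) - pm_unit (hook_tabloid 2)) (hook_tabloid 1) \<noteq> 0"
    by (simp add: lookup_minus lookup_single when_def inj_eq[OF inj_hook_tabloid])
  ultimately have "pm_sum_zero ?X \<noteq> {0}" by (metis lookup_zero singletonD)
  from rep.simple_quotient_char[OF bs invariant_hook zero this] specht_hook_simple
  have "(\<lambda>\<pi>\<in>carrier (sym_group d). quotient_trace (pm_sum_zero ?X) {0} (pushforward (map ((`) \<pi>))))
      \<in> irr_chars (sym_group d)" by blast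
  then show ?thesis using d by (simp add: specht_char_def specht_module_hook)
qed

end

section \<open>Identities of irreducible representations of \<open>sl2\<close>\<close>

text \<open>The rows are (a, b) and (c, -a), so the unit arguments give the standard basis H, E, F
  in this order.\<close>

definition sl2_mat :: "complex \<Rightarrow> complex \<Rightarrow> complex \<Rightarrow> complex mat" where
  "sl2_mat a b c = mat 2 2 (\<lambda>(i, j). if i = j then (if i = 0 then a else - a) else if i = 0 then b else c)"

lemma sl2_mat_in_sl2: "sl2_mat a b c \<in> sl2"
  by (simp add: sl2_def sl2_mat_def mat_trace_def numeral_2_eq_2)

lemma sl2_add: "A \<in> sl2 \<Longrightarrow> B \<in> sl2 \<Longrightarrow> A + B \<in> sl2"
proof -
  assume "A \<in> sl2" "B \<in> sl2"
  then have A: "A \<in> carrier_mat 2 2" "mat_trace A = 0" "B \<in> carrier_mat 2 2" "mat_trace B = 0"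
    by (auto simp: sl2_def)
  from A(1,3) have "mat_trace (A + B) = mat_trace A + mat_trace B"
    by (auto simp: mat_trace_def numeral_2_eq_2)
  with A show ?thesis by (simp add: sl2_def)
qed

lemma sl2_smult: "A \<in> sl2 \<Longrightarrow> a \<cdot>\<^sub>m A \<in> sl2"
  by (auto simp: sl2_def mat_trace_def simp flip: sum_distrib_left)

lemma sl2_mat_cases:
  assumes "A \<in> sl2"
  obtains a b c where "A = a \<cdot>\<^sub>m sl2_mat 1 0 0 + b \<cdot>\<^sub>m sl2_mat 0 1 0 + c \<cdot>\<^sub>m sl2_mat 0 0 1"
proof -
  have A: "A \<in> carrier_mat 2 2" "A $$ (0, 0) + A $$ (1, 1) = 0"
    using assms by (auto simp: sl2_def mat_trace_def numeral_2_eq_2)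
  from A(2) have 1: "A $$ (1, 1) = - A $$ (0, 0)" by (metis add_eq_0_iff)
  have "A = A $$ (0, 0) \<cdot>\<^sub>m sl2_mat 1 0 0 + A $$ (0, 1) \<cdot>\<^sub>m sl2_mat 0 1 0 + A $$ (1, 0) \<cdot>\<^sub>m sl2_mat 0 0 1"
    by (rule eq_matI) (use A(1) 1 in \<open>auto simp: sl2_mat_def less_2_cases_iff\<close>)
  then show ?thesis by (rule that)
qed

text \<open>The factor \<open>1\<close> in the last bracket gives all three the shape that
  \<open>commutator_mult_vec\<close> expects.\<close>

lemma sl2_mat_brackets:
  "sl2_mat 1 0 0 * sl2_mat 0 1 0 - sl2_mat 0 1 0 * sl2_mat 1 0 0 = 2 \<cdot>\<^sub>m sl2_mat 0 1 0"
  "sl2_mat 1 0 0 * sl2_mat 0 0 1 - sl2_mat 0 0 1 * sl2_mat 1 0 0 = (-2) \<cdot>\<^sub>m sl2_mat 0 0 1"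
  "sl2_mat 0 1 0 * sl2_mat 0 0 1 - sl2_mat 0 0 1 * sl2_mat 0 1 0 = 1 \<cdot>\<^sub>m sl2_mat 1 0 0"
  by (auto simp: mat_eq_iff sl2_mat_def scalar_prod_def less_2_cases_iff numeral_2_eq_2)

lemma commutator_mult_vec:
  fixes X :: "complex mat"
  assumes "X * Y - Y * X = c \<cdot>\<^sub>m Z" "X \<in> carrier_mat d d" "Y \<in> carrier_mat d d" "Z \<in> carrier_mat d d"
    "v \<in> carrier_vec d"
  shows "X *\<^sub>v (Y *\<^sub>v v) = Y *\<^sub>v (X *\<^sub>v v) + c \<cdot>\<^sub>v (Z *\<^sub>v v)"
proof -
  have "(c \<cdot>\<^sub>m Z) *\<^sub>v v = (X * Y) *\<^sub>v v - (Y * X) *\<^sub>v v"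
    unfolding assms(1)[symmetric] using assms(2-) by (intro minus_mult_distrib_mat_vec) auto
  also have "(X * Y) *\<^sub>v v = X *\<^sub>v (Y *\<^sub>v v)" using assms by simp
  also have "(Y * X) *\<^sub>v v = Y *\<^sub>v (X *\<^sub>v v)" using assms by simp
  also have "(c \<cdot>\<^sub>m Z) *\<^sub>v v = c \<cdot>\<^sub>v (Z *\<^sub>v v)" using assms by (intro eq_vecI) auto
  finally have eq: "c \<cdot>\<^sub>v (Z *\<^sub>v v) = X *\<^sub>v (Y *\<^sub>v v) - Y *\<^sub>v (X *\<^sub>v v)" .
  show ?thesis unfolding eq using assms(2-) by (intro eq_vecI) auto
qed

text \<open>\<open>v 0\<close> is a highest weight vector and the \<open>v j\<close> are its
  successive images under F. A zero among the first \<open>d\<close> of them would make their span a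
  proper nonzero invariant subspace. The weight \<open>\<kappa>\<close> is left open; what matters
  later is that successive weights differ by 2.\<close>

lemma irreducible_sl2_rep_chain:
  assumes "irreducible_sl2_rep d \<rho>"
  obtains v \<kappa> where "\<And>j. v j \<in> carrier_vec d" "\<And>j. j < d \<Longrightarrow> v j \<noteq> 0\<^sub>v d"
    "\<And>j. \<rho> (sl2_mat 1 0 0) *\<^sub>v v j = (\<kappa> - 2 * of_nat j) \<cdot>\<^sub>v v j"
    "\<And>j. \<rho> (sl2_mat 0 0 1) *\<^sub>v v j = v (Suc j)"
proof -
  define h e f where "h = \<rho> (sl2_mat 1 0 0)" and "e = \<rho> (sl2_mat 0 1 0)" and "f = \<rho> (sl2_mat 0 0 1)"
  have rep: "sl2_rep d \<rho>" and irr: "irreducible_mats d (\<rho> ` sl2)"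
    using assms by (auto simp: irreducible_sl2_rep_def)
  have d: "d > 0" using irr by (simp add: irreducible_mats_def)
  have car: "\<rho> A \<in> carrier_mat d d" if "A \<in> sl2" for A using rep that by (simp add: sl2_rep_def)
  have add: "\<rho> (A + B) = \<rho> A + \<rho> B" if "A \<in> sl2" "B \<in> sl2" for A B using rep that by (simp add: sl2_rep_def)
  have scale: "\<rho> (c \<cdot>\<^sub>m A) = c \<cdot>\<^sub>m \<rho> A" if "A \<in> sl2" for c A using rep that by (simp add: sl2_rep_def)
  have bracket: "\<rho> A * \<rho> B - \<rho> B * \<rho> A = \<rho> (A * B - B * A)" if "A \<in> sl2" "B \<in> sl2" for A B
    using rep that by (simp add: sl2_rep_def)
  have hef: "h \<in> carrier_mat d d" "e \<in> carrier_mat d d" "f \<in> carrier_mat d d"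
    by (simp_all add: h_def e_def f_def car sl2_mat_in_sl2)
  have brackets: "h * e - e * h = 2 \<cdot>\<^sub>m e" "h * f - f * h = (-2) \<cdot>\<^sub>m f" "e * f - f * e = 1 \<cdot>\<^sub>m h"
    unfolding h_def e_def f_def by (simp_all only: bracket sl2_mat_in_sl2 sl2_mat_brackets scale)
  note he = commutator_mult_vec[OF brackets(1) hef(1,2,2)]
    and hf = commutator_mult_vec[OF brackets(2) hef(1,3,3)]
    and ef = commutator_mult_vec[OF brackets(3) hef(2,3,1)]
  obtain \<mu> u where u: "u \<in> carrier_vec d" "u \<noteq> 0\<^sub>v d" "h *\<^sub>v u = \<mu> \<cdot>\<^sub>v u"
    using spectrum_non_empty[OF hef(1) d] hef(1)
    by (auto simp: spectrum_def eigenvalue_def eigenvector_def)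
  define w where "w k = ((*\<^sub>v) e ^^ k) u" for k
  have w: "w k \<in> carrier_vec d" for k
    by (induction k) (use u hef in \<open>auto simp: w_def\<close>)
  have hw: "h *\<^sub>v w k = (\<mu> + 2 * of_nat k) \<cdot>\<^sub>v w k" for k
  proof (induction k)
    case (Suc k)
    have "h *\<^sub>v w (Suc k) = h *\<^sub>v (e *\<^sub>v w k)" by (simp add: w_def)
    also have "\<dots> = (\<mu> + 2 * of_nat (Suc k)) \<cdot>\<^sub>v (e *\<^sub>v w k)"
      using w[of k] hef mult_mat_vec[OF hef(2) w[of k]] he[OF w[of k]]
      by (intro eq_vecI) (auto simp: Suc algebra_simps)
    finally show ?case by (simp add: w_def)
  qed (simp add: w_def u)
  \<comment> \<open>E raises eigenvalues of H by 2, so a chain without zeros would give infinitely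
    many eigenvalues.\<close>
  obtain K where K: "w K = 0\<^sub>v d"
  proof (rule ccontr)
    assume "\<not> thesis"
    with that have "w k \<noteq> 0\<^sub>v d" for k by blast
    then have "eigenvalue h (\<mu> + 2 * of_nat k)" for k
      using w hw hef by (auto simp: eigenvalue_def eigenvector_def)
    then have "range (\<lambda>k. \<mu> + 2 * of_nat k) \<subseteq> spectrum h" by (auto simp: spectrum_def)
    then have "finite (range (\<lambda>k::nat. \<mu> + 2 * of_nat k))"
      using card_finite_spectrum(1)[OF hef(1)] finite_subset by blast
    moreover have "inj (\<lambda>k::nat. \<mu> + 2 * of_nat k)" by (auto simp: inj_on_def)
    ultimately show False using finite_imageD infinite_UNIV_nat by blast
  qed
  moreover from K have "w K = 0\<^sub>v d" .
  moreover have "w 0 \<noteq> 0\<^sub>v d" using u by (simp add: w_def)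
  ultimately obtain N where N: "w N \<noteq> 0\<^sub>v d" "w (Suc N) = 0\<^sub>v d"
    using ex_least_nat_less[of "\<lambda>k. w k = 0\<^sub>v d" K] by blast
  define \<kappa> where "\<kappa> = \<mu> + 2 * of_nat N"
  define v where "v j = ((*\<^sub>v) f ^^ j) (w N)" for j
  have v_Suc: "f *\<^sub>v v j = v (Suc j)" for j by (simp add: v_def)
  have v: "v j \<in> carrier_vec d" for j
    by (induction j) (use w hef in \<open>auto simp: v_def\<close>)
  have hv: "h *\<^sub>v v j = (\<kappa> - 2 * of_nat j) \<cdot>\<^sub>v v j" for j
  proof (induction j)
    case 0
    then show ?case by (simp add: v_def hw \<kappa>_def)
  next
    case (Suc j)
    have "h *\<^sub>v (f *\<^sub>v v j) = (\<kappa> - 2 * of_nat (Suc j)) \<cdot>\<^sub>v (f *\<^sub>v v j)"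
      using v[of j] hef mult_mat_vec[OF hef(3) v[of j]] hf[OF v[of j]]
      by (intro eq_vecI) (auto simp: Suc algebra_simps)
    then show ?case by (simp add: v_Suc)
  qed
  have ev0: "e *\<^sub>v v 0 = 0\<^sub>v d" using N(2) by (simp add: v_def w_def)
  \<comment> \<open>The factor is the sum of the weights of \<open>v 0\<close> up to
    \<open>v j\<close>, one weight being picked up each time E is commuted past an F.\<close>
  have ev: "e *\<^sub>v v (Suc j) = (of_nat (Suc j) * (\<kappa> - of_nat j)) \<cdot>\<^sub>v v j" for j
  proof (induction j)
    case 0
    have "f *\<^sub>v 0\<^sub>v d = 0\<^sub>v d" using hef by (intro eq_vecI) auto
    then show ?case using ef[OF v[of 0]] v[of 0] by (simp add: v_Suc ev0 hv)
  next
    case (Suc j)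
    have "e *\<^sub>v (f *\<^sub>v v (Suc j)) = f *\<^sub>v (e *\<^sub>v v (Suc j)) + 1 \<cdot>\<^sub>v (h *\<^sub>v v (Suc j))"
      by (rule ef[OF v])
    also have "f *\<^sub>v (e *\<^sub>v v (Suc j)) = (of_nat (Suc j) * (\<kappa> - of_nat j)) \<cdot>\<^sub>v v (Suc j)"
      unfolding Suc mult_mat_vec[OF hef(3) v[of j]] v_Suc ..
    finally show ?case unfolding hv v_Suc using v[of "Suc j"]
      by (intro eq_vecI) (auto simp: algebra_simps)
  qed
  have "v j \<noteq> 0\<^sub>v d" if "j < d" for j
  proof
    assume j: "v j = 0\<^sub>v d"
    have "v (j + k) = 0\<^sub>v d" for k
    proof (induction k)
      case (Suc k)
      have "f *\<^sub>v 0\<^sub>v d = 0\<^sub>v d" using hef by (intro eq_vecI) auto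
      with Suc show ?case by (simp flip: v_Suc)
    qed (simp add: j)
    \<comment> \<open>\<open>v (d - 1) = 0\<close> makes the matrix of the first \<open>d\<close>
      vectors singular, and \<open>v d = 0\<close> keeps their span stable under F.\<close>
    from this[of "d - 1 - j"] this[of "d - j"] that have vd: "v (d - 1) = 0\<^sub>v d" "v d = 0\<^sub>v d" by auto
    define A where "A = mat d d (\<lambda>(i, j). v j $ i)"
    have A: "A \<in> carrier_mat d d" by (simp add: A_def)
    have col: "col A j = v j" if "j < d" for j
      using that v[of j] by (intro eq_vecI) (auto simp: A_def)
    let ?I = "(*\<^sub>v) A ` carrier_vec d"
    \<comment> \<open>The range of \<open>A\<close> stands for the span. An operator sending each
      column of \<open>A\<close> to a multiple of some column satisfies
      \<open>M * A = A * M'\<close>, hence preserves that range.\<close>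
    have stable: "M *\<^sub>v x \<in> ?I"
      if M: "M \<in> carrier_mat d d" and cols: "\<And>j. j < d \<Longrightarrow> \<exists>l<d. \<exists>c. M *\<^sub>v v j = c \<cdot>\<^sub>v v l" and x: "x \<in> ?I"
      for M x
    proof -
      from cols obtain l c where lc: "\<And>j. j < d \<Longrightarrow> l j < d" "\<And>j. j < d \<Longrightarrow> M *\<^sub>v v j = c j \<cdot>\<^sub>v v (l j)"
        by metis
      define M' where "M' = mat d d (\<lambda>(i, j). if i = l j then c j else 0)"
      have M': "M' \<in> carrier_mat d d" by (simp add: M'_def)
      have "M * A = A * M'"
      proof (rule eq_matI)
        fix i j assume "i < dim_row (A * M')" "j < dim_col (A * M')"
        then have ij: "i < d" "j < d" using A M' by auto
        have "(A * M') $$ (i, j) = (\<Sum>k<d. A $$ (i, k) * M' $$ (k, j))"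
          by (rule index_mult_mat_sum[OF A M' ij])
        also have "\<dots> = (\<Sum>k<d. if k = l j then v (l j) $ i * c j else 0)"
          using ij by (intro sum.cong) (auto simp: A_def M'_def)
        also have "\<dots> = (M *\<^sub>v v j) $ i" using lc[OF ij(2)] v[of "l j"] ij by simp
        finally show "(M * A) $$ (i, j) = (A * M') $$ (i, j)" using ij M A col by simp
      qed (use M A M' in auto)
      from x obtain y where y: "y \<in> carrier_vec d" "x = A *\<^sub>v y" by auto
      have "M *\<^sub>v x = (M * A) *\<^sub>v y" using y M A by simp
      also have "\<dots> = A *\<^sub>v (M' *\<^sub>v y)" unfolding \<open>M * A = A * M'\<close> using y A M' by simp
      finally show ?thesis using y M' by auto
    qed
    have I_add: "x + y \<in> ?I" if "x \<in> ?I" "y \<in> ?I" for x y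
    proof -
      from that obtain a b where "a \<in> carrier_vec d" "b \<in> carrier_vec d" "x = A *\<^sub>v a" "y = A *\<^sub>v b" by auto
      then show ?thesis using A by (intro image_eqI[of _ _ "a + b"]) (auto simp: mult_add_distrib_mat_vec)
    qed
    have I_scale: "c \<cdot>\<^sub>v x \<in> ?I" if "x \<in> ?I" for c x
    proof -
      from that obtain a where "a \<in> carrier_vec d" "x = A *\<^sub>v a" by auto
      then show ?thesis using A by (intro image_eqI[of _ _ "c \<cdot>\<^sub>v a"]) (auto simp: mult_mat_vec)
    qed
    \<comment> \<open>Vanishing images must also appear as multiples of a column to fit
      \<open>stable\<close>.\<close>
    have zero: "0\<^sub>v d = 0 \<cdot>\<^sub>v v 0" using v[of 0] by auto
    have "?I = {0\<^sub>v d} \<or> ?I = carrier_vec d"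
    proof (rule irreducible_matsD[OF irr])
      show "?I \<subseteq> carrier_vec d" using A by auto
      show "0\<^sub>v d \<in> ?I" using A by (intro image_eqI[of _ _ "0\<^sub>v d"]) auto
      fix M x assume "M \<in> \<rho> ` sl2" and x: "x \<in> ?I"
      then obtain X where X: "X \<in> sl2" "M = \<rho> X" by auto
      obtain a b c where X_eq: "X = a \<cdot>\<^sub>m sl2_mat 1 0 0 + b \<cdot>\<^sub>m sl2_mat 0 1 0 + c \<cdot>\<^sub>m sl2_mat 0 0 1"
        using sl2_mat_cases[OF X(1)] .
      have M: "M = a \<cdot>\<^sub>m h + b \<cdot>\<^sub>m e + c \<cdot>\<^sub>m f"
        unfolding X(2) X_eq h_def e_def f_def
        by (simp add: add scale sl2_add sl2_smult sl2_mat_in_sl2)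
      have x': "x \<in> carrier_vec d" using x A by auto
      have "M *\<^sub>v x = a \<cdot>\<^sub>v (h *\<^sub>v x) + b \<cdot>\<^sub>v (e *\<^sub>v x) + c \<cdot>\<^sub>v (f *\<^sub>v x)"
        unfolding M using hef x' by (intro eq_vecI) (auto simp: add_scalar_prod_distrib[of _ d])
      moreover have "h *\<^sub>v x \<in> ?I"
        by (rule stable[OF hef(1) _ x]) (use hv in blast)
      moreover have "e *\<^sub>v x \<in> ?I"
      proof (rule stable[OF hef(2) _ x])
        fix j assume "j < d"
        then show "\<exists>l<d. \<exists>c. e *\<^sub>v v j = c \<cdot>\<^sub>v v l"
          using ev ev0 zero d by (cases j) (auto intro: Suc_lessD)
      qed
      moreover have "f *\<^sub>v x \<in> ?I"
      proof (rule stable[OF hef(3) _ x])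
        fix j assume j: "j < d"
        show "\<exists>l<d. \<exists>c. f *\<^sub>v v j = c \<cdot>\<^sub>v v l"
        proof (cases "Suc j < d")
          case True
          have "v (Suc j) = 1 \<cdot>\<^sub>v v (Suc j)" by simp
          with True show ?thesis unfolding v_Suc by blast
        next
          case False
          with j have "Suc j = d" by simp
          then have "f *\<^sub>v v j = 0 \<cdot>\<^sub>v v 0" unfolding v_Suc using vd(2) zero by simp
          with d show ?thesis by blast
        qed
      qed
      ultimately show "M *\<^sub>v x \<in> ?I" by (simp add: I_add I_scale)
    qed (use I_add I_scale in auto)
    moreover have "A *\<^sub>v unit_vec d 0 = v 0"
      using A col[OF d] d by (intro eq_vecI) (auto simp flip: col[OF d])
    then have "v 0 \<in> ?I" by (metis imageI unit_vec_carrier)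
    moreover have "v 0 \<noteq> 0\<^sub>v d" using N(1) by (simp add: v_def)
    ultimately have "?I = carrier_vec d" by blast
    then have "\<exists>y\<in>carrier_vec d. A *\<^sub>v y = x" if "x \<in> carrier_vec d" for x using that by (metis imageE)
    from surjective_mat_right_inverse[OF A this] obtain B where B: "B \<in> carrier_mat d d" "A * B = 1\<^sub>m d"
      by metis
    have "B * A = 1\<^sub>m d" by (rule mat_mult_left_right_inverse[OF A B])
    \<comment> \<open>The last column of \<open>A\<close> is zero, hence so is the last column of
      \<open>B * A\<close>.\<close>
    moreover have "(B * A) $$ (d - 1, d - 1) = 0"
      using d A B col[of "d - 1"] vd(1) by (auto simp: row_carrier)
    ultimately show False using d by simp
  qed
  then show ?thesis using that[of v \<kappa>] v hv v_Suc by (simp add: h_def f_def)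
qed

text \<open>The form is the sum of the \<alpha>_k S^k T^(n-k). In the chart t -> (t : t + 2) it
  becomes the polynomial \<open>q\<close>, the \<open>n\<close> zeros become distinct roots of
  \<open>q\<close>, and (1 : 1) is the point at infinity: the coefficient of t^n is the sum of the
  \<alpha>_k. So \<open>q\<close> has degree below \<open>n\<close>, or is zero, and it has
  \<open>n\<close> roots.\<close>

lemma binary_form_zero:
  fixes \<alpha> :: "nat \<Rightarrow> complex"
  assumes roots: "\<And>j. j < n \<Longrightarrow> (\<Sum>k\<le>n. \<alpha> k * ((\<kappa> - 2 * of_nat j - 2) ^ k * (\<kappa> - 2 * of_nat j) ^ (n - k))) = 0"
    and sum: "(\<Sum>k\<le>n. \<alpha> k) = 0" and "k \<le> n"
  shows "\<alpha> k = 0"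
proof -
  define q where "q = (\<Sum>k\<le>n. smult (\<alpha> k) ([:0, 1:] ^ k * [:2, 1:] ^ (n - k)))"
  have poly_q: "poly q t = (\<Sum>k\<le>n. \<alpha> k * (t ^ k * (t + 2) ^ (n - k)))" for t
    by (simp add: q_def poly_sum add.commute)
  have monic: "degree ([:0, 1:] ^ k * [:2, 1:] ^ (n - k) :: complex poly) = n"
    "coeff ([:0, 1:] ^ k * [:2, 1:] ^ (n - k) :: complex poly) n = 1" if "k \<le> n" for k
  proof -
    have "lead_coeff ([:0, 1:] ^ k * [:2, 1:] ^ (n - k) :: complex poly) = 1"
      by (simp add: lead_coeff_mult lead_coeff_power)
    moreover show "degree ([:0, 1:] ^ k * [:2, 1:] ^ (n - k) :: complex poly) = n"
      using that by (simp add: degree_mult_eq degree_power_eq)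
    ultimately show "coeff ([:0, 1:] ^ k * [:2, 1:] ^ (n - k) :: complex poly) n = 1" by simp
  qed
  have deg: "degree q \<le> n" unfolding q_def
    by (intro degree_sum_le order_trans[OF degree_smult_le]) (auto simp: monic)
  have "coeff q n = 0" using sum by (simp add: q_def coeff_sum monic)
  have "q = 0"
  proof (rule ccontr)
    assume q: "q \<noteq> 0"
    with \<open>coeff q n = 0\<close> have "degree q \<noteq> n" by (metis leading_coeff_0_iff)
    with deg have "degree q < n" by simp
    have "(\<lambda>j. \<kappa> - 2 * of_nat j - 2) ` {..<n} \<subseteq> {t. poly q t = 0}"
      using roots by (auto simp: poly_q)
    then have "card ((\<lambda>j. \<kappa> - 2 * of_nat j - 2) ` {..<n}) \<le> degree q"
      using card_mono[OF poly_roots_finite[OF q]] poly_roots_degree[OF q] by (meson order_trans)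
    moreover have "inj_on (\<lambda>j. \<kappa> - 2 * of_nat j - 2) {..<n}" by (auto simp: inj_on_def)
    ultimately show False using \<open>degree q < n\<close> by (simp add: card_image)
  qed
  \<comment> \<open>The coefficients are recovered in the other chart, s = S/T, where they are those
    of the polynomial \<open>r\<close>.\<close>
  define r where "r = (\<Sum>k\<le>n. monom (\<alpha> k) k)"
  have "poly r s = 0" if s: "s \<noteq> 1" for s
  proof -
    \<comment> \<open>dehomogenise: \<open>t = 2 s / (1 - s)\<close> satisfies \<open>t = s (t + 2)\<close>\<close>
    define t where "t = 2 * s / (1 - s)"
    have t: "t + 2 \<noteq> 0" "t = s * (t + 2)" using s by (auto simp: t_def field_simps)
    have "0 = (\<Sum>k\<le>n. \<alpha> k * (t ^ k * (t + 2) ^ (n - k)))" using poly_q[of t] \<open>q = 0\<close> by simp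
    also have "\<dots> = (\<Sum>k\<le>n. (t + 2) ^ n * (\<alpha> k * s ^ k))"
    proof (intro sum.cong refl)
      fix k assume "k \<in> {..n}"
      then have "(t + 2) ^ n = (t + 2) ^ k * (t + 2) ^ (n - k)" by (simp flip: power_add)
      moreover have "t ^ k = s ^ k * (t + 2) ^ k" by (subst t(2)) (simp add: power_mult_distrib)
      ultimately show "\<alpha> k * (t ^ k * (t + 2) ^ (n - k)) = (t + 2) ^ n * (\<alpha> k * s ^ k)" by simp
    qed
    finally show ?thesis using t(1) by (simp add: r_def poly_sum poly_monom flip: sum_distrib_left)
  qed
  then have "- {1} \<subseteq> {s. poly r s = 0}" by auto
  moreover have "infinite (- {1 :: complex})" by (simp add: infinite_UNIV_char_0)
  ultimately have "r = 0" using poly_roots_finite finite_subset by blast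
  then have "coeff r k = 0" by simp
  then show ?thesis using assms(3) by (simp add: r_def coeff_sum)
qed

section \<open>From an identity to sums of its coefficients\<close>

lemma eval_mat_zero_mult_vec:
  assumes "eval_mat d X f = 0\<^sub>m d d"
    and car: "\<And>w i. w \<in> Poly_Mapping.keys f \<Longrightarrow> i \<in> set w \<Longrightarrow> X i \<in> carrier_mat d d"
    and v: "v \<in> carrier_vec d" and i: "i < d"
  shows "(\<Sum>w\<in>Poly_Mapping.keys f. Poly_Mapping.lookup f w * (foldr (*) (map X w) (1\<^sub>m d) *\<^sub>v v) $ i) = 0"
proof -
  let ?M = "\<lambda>w. foldr (*) (map X w) (1\<^sub>m d)"
  have M: "?M w \<in> carrier_mat d d" if "\<And>i. i \<in> set w \<Longrightarrow> X i \<in> carrier_mat d d" for w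
    using that by (induction w) (auto intro!: mult_carrier_mat[of _ d d])
  have "(\<Sum>w\<in>Poly_Mapping.keys f. Poly_Mapping.lookup f w * (?M w *\<^sub>v v) $ i)
      = (\<Sum>w\<in>Poly_Mapping.keys f. \<Sum>j<d. Poly_Mapping.lookup f w * ?M w $$ (i, j) * v $ j)"
  proof (intro sum.cong refl)
    fix w assume "w \<in> Poly_Mapping.keys f"
    with M car have "?M w \<in> carrier_mat d d" by blast
    then show "Poly_Mapping.lookup f w * (?M w *\<^sub>v v) $ i = (\<Sum>j<d. Poly_Mapping.lookup f w * ?M w $$ (i, j) * v $ j)"
      using v i by (auto simp: scalar_prod_def atLeast0LessThan sum_distrib_left mult.assoc)
  qed
  also have "\<dots> = (\<Sum>j<d. eval_mat d X f $$ (i, j) * v $ j)"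
    using i by (subst sum.swap) (simp add: eval_mat_def sum_distrib_right)
  also have "\<dots> = 0" using i by (simp add: assms(1))
  finally show ?thesis .
qed

text \<open>Shaped for two uses on one word: with empty tail for the block right of
  \<open>x\<close>, then with tail \<open>x # vs\<close> for the block left of it, where the start
  \<open>u\<close> and the eigenvector \<open>v\<close> differ. The carrier fact is part of the
  conclusion so that the first use feeds the second.\<close>

lemma foldr_mult_eigenvector:
  fixes v :: "complex vec"
  assumes "\<And>i. i \<in> set w \<Longrightarrow> X i \<in> carrier_mat d d" "v \<in> carrier_vec d" "u \<in> carrier_vec d"
    and "foldr (*) (map X ws) (1\<^sub>m d) *\<^sub>v u = c \<cdot>\<^sub>v v" "foldr (*) (map X ws) (1\<^sub>m d) \<in> carrier_mat d d"
    and "\<And>i. i \<in> set w \<Longrightarrow> X i *\<^sub>v v = a \<cdot>\<^sub>v v"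
  shows "foldr (*) (map X (w @ ws)) (1\<^sub>m d) *\<^sub>v u = (a ^ length w * c) \<cdot>\<^sub>v v
    \<and> foldr (*) (map X (w @ ws)) (1\<^sub>m d) \<in> carrier_mat d d"
  using assms(1,6)
proof (induction w)
  case Nil
  then show ?case using assms by simp
next
  case (Cons i w)
  let ?M = "foldr (*) (map X (w @ ws)) (1\<^sub>m d)"
  have IH: "?M *\<^sub>v u = (a ^ length w * c) \<cdot>\<^sub>v v" "?M \<in> carrier_mat d d" using Cons by auto
  have Xi: "X i \<in> carrier_mat d d" "X i *\<^sub>v v = a \<cdot>\<^sub>v v" using Cons by auto
  have "(X i * ?M) *\<^sub>v u = X i *\<^sub>v (?M *\<^sub>v u)" by (rule assoc_mult_mat_vec[OF Xi(1) IH(2) assms(3)])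
  also have "\<dots> = (a ^ length w * c) \<cdot>\<^sub>v (X i *\<^sub>v v)"
    unfolding IH(1) by (rule mult_mat_vec[OF Xi(1) assms(2)])
  also have "\<dots> = (a ^ length (i # w) * c) \<cdot>\<^sub>v v"
    unfolding Xi(2) by (simp add: smult_smult_assoc ac_simps)
  finally show ?case using Xi(1) IH(2) by simp
qed

text \<open>Places are counted from 0, so the \<open>d\<close> sums for a fixed letter are the
  coefficients of a form of degree \<open>d - 1\<close>.\<close>

lemma identity_position_sums_zero:
  assumes rep: "irreducible_sl2_rep d \<rho>" and d: "d \<ge> 2" and f: "f \<in> identities d \<rho>"
    and words: "\<And>w. w \<in> Poly_Mapping.keys f \<Longrightarrow> length w = d \<and> distinct w \<and> set w = {1..d}"
    and x: "x \<in> {1..d}" and k: "k < d"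
  shows "(\<Sum>w\<in>Poly_Mapping.keys f. if w ! k = x then Poly_Mapping.lookup f w else 0) = 0"
proof -
  let ?H = "sl2_mat 1 0 0" and ?F = "sl2_mat 0 0 1"
  obtain v \<kappa> where v: "\<And>j. v j \<in> carrier_vec d" "\<And>j. j < d \<Longrightarrow> v j \<noteq> 0\<^sub>v d"
    "\<And>j. \<rho> ?H *\<^sub>v v j = (\<kappa> - 2 * of_nat j) \<cdot>\<^sub>v v j" "\<And>j. \<rho> ?F *\<^sub>v v j = v (Suc j)"
    using irreducible_sl2_rep_chain[OF rep] by metis
  have car: "\<rho> (sl2_mat a b c) \<in> carrier_mat d d" for a b c
    using rep by (simp add: irreducible_sl2_rep_def sl2_rep_def sl2_mat_in_sl2)
  have eval: "(\<Sum>w\<in>Poly_Mapping.keys f. Poly_Mapping.lookup f w * (foldr (*) (map (\<lambda>i. \<rho> (A i)) w) (1\<^sub>m d) *\<^sub>v u) $ i) = 0"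
    if A: "\<And>i. A i \<in> sl2" and u: "u \<in> carrier_vec d" and i: "i < d" for A u i
  proof (rule eval_mat_zero_mult_vec[OF _ _ u i])
    have "f \<in> F_sub d" using words by (auto simp: F_sub_def)
    with f A show "eval_mat d (\<lambda>i. \<rho> (A i)) f = 0\<^sub>m d d" by (auto simp: identities_def)
    show "\<rho> (A i) \<in> carrier_mat d d" for i
      using rep A by (simp add: irreducible_sl2_rep_def sl2_rep_def)
  qed
  have nonzero: "\<exists>i<d. v j $ i \<noteq> 0" if "j < d" for j
    using v(1,2) that by (metis eq_vecI carrier_vecD index_zero_vec)
  define \<alpha> where "\<alpha> k = (\<Sum>w\<in>Poly_Mapping.keys f. if w ! k = x then Poly_Mapping.lookup f w else 0)" for k
  have split: "\<exists>us vs. w = us @ [x] @ vs \<and> (\<forall>k<d. w ! k = x \<longleftrightarrow> k = length us) \<and> length us + length vs + 1 = d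
      \<and> x \<notin> set us \<union> set vs" if "w \<in> Poly_Mapping.keys f" for w
  proof -
    from words[OF that] x have w: "x \<in> set w" "distinct w" "length w = d" by auto
    then obtain us vs where us: "w = us @ x # vs" by (metis split_list)
    moreover have "w ! k = x \<longleftrightarrow> k = length us" if "k < d" for k
      using nth_eq_iff_index_eq[OF w(2), of k "length us"] that w(3) us by simp
    ultimately show ?thesis using w by (intro exI[of _ us] exI[of _ vs]) auto
  qed
  \<comment> \<open>Words are grouped by the place of \<open>x\<close>, which is the length of the
    prefix before it.\<close>
  have \<alpha>_sum: "(\<Sum>w\<in>Poly_Mapping.keys f. Poly_Mapping.lookup f w * g (length (takeWhile (\<lambda>y. y \<noteq> x) w)))
      = (\<Sum>k\<le>d - 1. \<alpha> k * g k)" for g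
  proof -
    have "(\<Sum>k\<le>d - 1. \<alpha> k * g k)
        = (\<Sum>w\<in>Poly_Mapping.keys f. \<Sum>k\<le>d - 1. (if w ! k = x then Poly_Mapping.lookup f w else 0) * g k)"
      unfolding \<alpha>_def by (subst sum.swap) (simp add: sum_distrib_right)
    also have "\<dots> = (\<Sum>w\<in>Poly_Mapping.keys f. Poly_Mapping.lookup f w * g (length (takeWhile (\<lambda>y. y \<noteq> x) w)))"
    proof (intro sum.cong refl)
      fix w assume "w \<in> Poly_Mapping.keys f"
      from split[OF this] obtain us vs where us: "w = us @ [x] @ vs" "\<And>k. k < d \<Longrightarrow> w ! k = x \<longleftrightarrow> k = length us"
        "length us + length vs + 1 = d" "x \<notin> set us \<union> set vs" by blast
      have "(\<Sum>k\<le>d - 1. (if w ! k = x then Poly_Mapping.lookup f w else 0) * g k)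
          = (\<Sum>k\<le>d - 1. if k = length us then Poly_Mapping.lookup f w * g k else 0)"
        using us(2) d by (intro sum.cong) auto
      also have "\<dots> = Poly_Mapping.lookup f w * g (length us)" using us(3) by simp
      also have "takeWhile (\<lambda>y. y \<noteq> x) w = us" using us(1,4) by (auto simp: takeWhile_eq_all_conv takeWhile_append)
      then have "length us = length (takeWhile (\<lambda>y. y \<noteq> x) w)" by simp
      finally show "(\<Sum>k\<le>d - 1. (if w ! k = x then Poly_Mapping.lookup f w else 0) * g k)
        = Poly_Mapping.lookup f w * g (length (takeWhile (\<lambda>y. y \<noteq> x) w))" .
    qed
    finally show ?thesis by simp
  qed
  have "\<alpha> k = 0"
  proof (rule binary_form_zero[where n = "d - 1"])
    fix j assume j: "j < d - 1"
    let ?X = "\<lambda>i. \<rho> (if i = x then ?F else ?H)"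
    \<comment> \<open>The first factor comes from the letters left of \<open>x\<close>, acting on
      \<open>v (Suc j)\<close>, the second from those right of it, acting on
      \<open>v j\<close>.\<close>
    let ?a = "\<lambda>k. (\<kappa> - 2 * of_nat j - 2) ^ k * (\<kappa> - 2 * of_nat j) ^ (d - 1 - k)"
    have word: "foldr (*) (map ?X w) (1\<^sub>m d) *\<^sub>v v j = ?a (length (takeWhile (\<lambda>y. y \<noteq> x) w)) \<cdot>\<^sub>v v (Suc j)"
      if w: "w \<in> Poly_Mapping.keys f" for w
    proof -
      from split[OF w] obtain us vs where us: "w = us @ [x] @ vs"
        "length us + length vs + 1 = d" "x \<notin> set us \<union> set vs" by blast
      have tw: "takeWhile (\<lambda>y. y \<noteq> x) w = us" using us(1,3) by (auto simp: takeWhile_eq_all_conv takeWhile_append)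
      have "foldr (*) (map ?X (vs @ [])) (1\<^sub>m d) *\<^sub>v v j = ((\<kappa> - 2 * of_nat j) ^ length vs * 1) \<cdot>\<^sub>v v j
          \<and> foldr (*) (map ?X (vs @ [])) (1\<^sub>m d) \<in> carrier_mat d d"
        by (rule foldr_mult_eigenvector) (use v us(3) car in auto)
      then have 1: "foldr (*) (map ?X vs) (1\<^sub>m d) *\<^sub>v v j = ((\<kappa> - 2 * of_nat j) ^ length vs) \<cdot>\<^sub>v v j"
        "foldr (*) (map ?X vs) (1\<^sub>m d) \<in> carrier_mat d d" by auto
      have "foldr (*) (map ?X (x # vs)) (1\<^sub>m d) *\<^sub>v v j = \<rho> ?F *\<^sub>v (foldr (*) (map ?X vs) (1\<^sub>m d) *\<^sub>v v j)"
        using assoc_mult_mat_vec[OF car 1(2) v(1)] by simp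
      also have "\<dots> = ((\<kappa> - 2 * of_nat j) ^ length vs) \<cdot>\<^sub>v v (Suc j)"
        unfolding 1(1) mult_mat_vec[OF car v(1)] v(4) ..
      finally have 2: "foldr (*) (map ?X (x # vs)) (1\<^sub>m d) *\<^sub>v v j = ((\<kappa> - 2 * of_nat j) ^ length vs) \<cdot>\<^sub>v v (Suc j)" .
      have "foldr (*) (map ?X (us @ x # vs)) (1\<^sub>m d) *\<^sub>v v j
          = ((\<kappa> - 2 * of_nat (Suc j)) ^ length us * (\<kappa> - 2 * of_nat j) ^ length vs) \<cdot>\<^sub>v v (Suc j)
          \<and> foldr (*) (map ?X (us @ x # vs)) (1\<^sub>m d) \<in> carrier_mat d d"
        by (rule foldr_mult_eigenvector[OF _ _ _ 2]) (use v us(3) car 1(2) in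
            \<open>auto simp del: of_nat_Suc intro!: mult_carrier_mat[of _ d d]\<close>)
      moreover have "length vs = d - 1 - length us" using us(2) by simp
      moreover have "\<kappa> - 2 * of_nat (Suc j) = \<kappa> - 2 * of_nat j - 2" by simp
      ultimately show ?thesis unfolding tw using us(1) by (simp add: diff_diff_eq add.commute)
    qed
    \<comment> \<open>The bound \<open>j < d - 1\<close> makes \<open>v (Suc j)\<close> nonzero, and
      a nonzero entry of it can be cancelled.\<close>
    from j have "Suc j < d" by simp
    from nonzero[OF this] obtain i where i: "i < d" "v (Suc j) $ i \<noteq> 0" by auto
    have "0 = (\<Sum>w\<in>Poly_Mapping.keys f. Poly_Mapping.lookup f w * (foldr (*) (map ?X w) (1\<^sub>m d) *\<^sub>v v j) $ i)"
      using eval[of "\<lambda>i. if i = x then ?F else ?H" "v j" i] i v(1) by (simp add: sl2_mat_in_sl2)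
    also have "\<dots> = (\<Sum>w\<in>Poly_Mapping.keys f. (Poly_Mapping.lookup f w * ?a (length (takeWhile (\<lambda>y. y \<noteq> x) w))) * v (Suc j) $ i)"
      using i v(1)[of "Suc j"] by (intro sum.cong refl) (simp add: word)
    also have "\<dots> = (\<Sum>k\<le>d - 1. \<alpha> k * ?a k) * v (Suc j) $ i"
      unfolding \<alpha>_sum[symmetric, of ?a] by (simp add: sum_distrib_right)
    finally show "(\<Sum>k\<le>d - 1. \<alpha> k * ?a k) = 0" using i by simp
  next
    \<comment> \<open>With H for all variables every word acts on \<open>v j\<close> by the same
      power of its weight, which must be nonzero to be cancelled. The weights of \<open>v 0\<close>
      and \<open>v 1\<close> differ by 2, so one of them qualifies.\<close>
    have "\<exists>j<d. \<kappa> - 2 * of_nat j \<noteq> 0"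
    proof (cases "\<kappa> = 0")
      case True
      with d show ?thesis by (intro exI[of _ 1]) auto
    next
      case False
      with d show ?thesis by (intro exI[of _ 0]) auto
    qed
    then obtain j where j: "j < d" "\<kappa> - 2 * of_nat j \<noteq> 0" by blast
    from nonzero[OF j(1)] obtain i where i: "i < d" "v j $ i \<noteq> 0" by auto
    have word: "foldr (*) (map (\<lambda>i. \<rho> ?H) w) (1\<^sub>m d) *\<^sub>v v j = ((\<kappa> - 2 * of_nat j) ^ d) \<cdot>\<^sub>v v j"
      if w: "w \<in> Poly_Mapping.keys f" for w
    proof -
      have "foldr (*) (map (\<lambda>i. \<rho> ?H) (w @ [])) (1\<^sub>m d) *\<^sub>v v j = ((\<kappa> - 2 * of_nat j) ^ length w * 1) \<cdot>\<^sub>v v j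
          \<and> foldr (*) (map (\<lambda>i. \<rho> ?H) (w @ [])) (1\<^sub>m d) \<in> carrier_mat d d"
        by (rule foldr_mult_eigenvector) (use v car in auto)
      then show ?thesis using words[OF w] by simp
    qed
    have "0 = (\<Sum>w\<in>Poly_Mapping.keys f. Poly_Mapping.lookup f w * (foldr (*) (map (\<lambda>i. \<rho> ?H) w) (1\<^sub>m d) *\<^sub>v v j) $ i)"
      using eval[of "\<lambda>i. ?H" "v j" i] i v(1) by (simp add: sl2_mat_in_sl2)
    also have "\<dots> = (\<Sum>w\<in>Poly_Mapping.keys f. Poly_Mapping.lookup f w * 1 * ((\<kappa> - 2 * of_nat j) ^ d * v j $ i))"
      using i v(1)[of j] by (intro sum.cong refl) (simp add: word)
    also have "\<dots> = (\<Sum>k\<le>d - 1. \<alpha> k * 1) * ((\<kappa> - 2 * of_nat j) ^ d * v j $ i)"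
      unfolding \<alpha>_sum[symmetric, of "\<lambda>_. 1"] by (simp add: sum_distrib_right)
    finally show "(\<Sum>k\<le>d - 1. \<alpha> k) = 0" using i j by simp
  qed (use k in auto)
  then show ?thesis by (simp add: \<alpha>_def)
qed

section \<open>The multilinear component\<close>

declare sym_group_inv_equality [simp del]

definition perm_words :: "nat \<Rightarrow> nat list set" where
  "perm_words d = (\<lambda>\<pi>. map \<pi> [1..<Suc d]) ` {\<pi>. \<pi> permutes {1..d}}"

lemma perm_wordsD:
  assumes "w \<in> perm_words d" shows "length w = d" "distinct w" "set w = {1..d}"
proof -
  obtain \<pi> where \<pi>: "\<pi> permutes {1..d}" "w = map \<pi> [1..<Suc d]" using assms by (auto simp: perm_words_def)
  have "set [1..<Suc d] = {1..d}" by auto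
  then show "length w = d" "distinct w" "set w = {1..d}"
    using \<pi> permutes_image[OF \<pi>(1)] permutes_inj_on[OF \<pi>(1)]
    by (simp_all only: distinct_map length_map set_map length_upt distinct_upt simp_thms diff_Suc_1)
qed

lemma finite_perm_words: "finite (perm_words d)"
  by (simp add: perm_words_def finite_permutations)

text \<open>The symmetric group acts simply transitively on the words. Thus the multilinear
  component is the regular module, and sums over the group turn into sums over words.\<close>

lemma bij_betw_map_perm_words:
  assumes "w \<in> perm_words d"
  shows "bij_betw (\<lambda>g. map g w) (carrier (sym_group d)) (perm_words d)"
proof -
  obtain \<pi> where \<pi>: "\<pi> permutes {1..d}" "w = map \<pi> [1..<Suc d]" using assms by (auto simp: perm_words_def)
  show ?thesis unfolding bij_betw_def
  proof (intro conjI subset_antisym subsetI inj_onI)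
    fix g h assume gh: "g \<in> carrier (sym_group d)" "h \<in> carrier (sym_group d)" "map g w = map h w"
    show "g = h"
    proof
      fix x
      show "g x = h x"
        using gh perm_wordsD(3)[OF assms] permutes_not_in[of g "{1..d}" x] permutes_not_in[of h "{1..d}" x]
        by (cases "x \<in> {1..d}") (auto simp: sym_group_carrier)
    qed
  next
    fix u assume "u \<in> (\<lambda>g. map g w) ` carrier (sym_group d)"
    then obtain g where "g permutes {1..d}" "u = map g w" by (auto simp: sym_group_carrier)
    then show "u \<in> perm_words d" using \<pi> permutes_compose[OF \<pi>(1), of g]
      by (auto simp: perm_words_def)
  next
    fix u assume "u \<in> perm_words d"
    then obtain \<sigma> where \<sigma>: "\<sigma> permutes {1..d}" "u = map \<sigma> [1..<Suc d]" by (auto simp: perm_words_def)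
    have "u = map (\<sigma> \<circ> inv' \<pi>) w" unfolding \<sigma>(2) \<pi>(2) by (simp add: permutes_inverses[OF \<pi>(1)])
    moreover have "\<sigma> \<circ> inv' \<pi> permutes {1..d}" by (intro permutes_compose permutes_inv \<pi>(1) \<sigma>(1))
    ultimately show "u \<in> (\<lambda>g. map g w) ` carrier (sym_group d)" by (auto simp: sym_group_carrier)
  qed
qed

lemma map_perm_words: "g permutes {1..d} \<Longrightarrow> map g ` perm_words d \<subseteq> perm_words d"
  using bij_betw_map_perm_words by (fastforce simp: bij_betw_def sym_group_carrier)

lemma multilinear_eq: "multilinear d = pm_on (perm_words d)"
proof -
  have prods: "prod_list (map (\<lambda>i. var (\<pi> i)) xs) = pm_unit (map \<pi> xs)" for \<pi> xs
  proof (induction xs)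
    case Nil
    then show ?case by (simp add: single_one[symmetric] zero_list_def del: single_one)
  qed (simp add: var_def mult_single plus_list_def)
  have "{prod_list (map (\<lambda>i. var (\<pi> i)) [1..<Suc d]) | \<pi>. \<pi> permutes {1..d}} = pm_unit ` perm_words d"
    unfolding prods perm_words_def by blast
  then show ?thesis by (simp only: multilinear_def pm_on_span[OF finite_perm_words])
qed

text \<open>\<open>identities\<close> quantifies over every \<open>m\<close> with \<open>f\<close>
  in \<open>F_sub m\<close>; here the single value \<open>m = d\<close> decides. Summation over all
  of \<open>perm_words d\<close> makes the condition visibly linear in \<open>f\<close>.\<close>

lemma identities_iff:
  assumes f: "f \<in> pm_on (perm_words d)"
  shows "f \<in> identities d \<rho> \<longleftrightarrow> (\<forall>A. (\<forall>i\<in>{1..d}. A i \<in> sl2) \<longrightarrow> (\<forall>i<d. \<forall>j<d.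
    (\<Sum>w\<in>perm_words d. lookup f w * foldr (*) (map (\<lambda>i. \<rho> (A i)) w) (1\<^sub>m d) $$ (i, j)) = 0))" (is "_ \<longleftrightarrow> ?R")
proof -
  have sub: "keys f \<subseteq> perm_words d" using f by (simp add: pm_on_def)
  have Fd: "f \<in> F_sub d" using sub perm_wordsD(3) by (fastforce simp: F_sub_def)
  have ev: "eval_mat d X f = 0\<^sub>m d d \<longleftrightarrow> (\<forall>i<d. \<forall>j<d.
      (\<Sum>w\<in>perm_words d. lookup f w * foldr (*) (map X w) (1\<^sub>m d) $$ (i, j)) = 0)" for X
  proof -
    have entry: "eval_mat d X f $$ (i, j)
        = (\<Sum>w\<in>perm_words d. lookup f w * foldr (*) (map X w) (1\<^sub>m d) $$ (i, j))" if "i < d" "j < d" for i j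
    proof -
      have "eval_mat d X f $$ (i, j) = (\<Sum>w\<in>keys f. lookup f w * foldr (*) (map X w) (1\<^sub>m d) $$ (i, j))"
        using that by (simp add: eval_mat_def)
      also have "\<dots> = (\<Sum>w\<in>perm_words d. lookup f w * foldr (*) (map X w) (1\<^sub>m d) $$ (i, j))"
        by (rule sum.mono_neutral_left[OF finite_perm_words sub]) (simp add: in_keys_iff)
      finally show ?thesis .
    qed
    show ?thesis
    proof (intro iffI allI impI)
      fix i j assume "eval_mat d X f = 0\<^sub>m d d" and ij: "i < d" "j < d"
      then have "eval_mat d X f $$ (i, j) = 0" by (simp only: index_zero_mat)
      with entry[OF ij] show "(\<Sum>w\<in>perm_words d. lookup f w * foldr (*) (map X w) (1\<^sub>m d) $$ (i, j)) = 0"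
        by (simp only:)
    next
      assume zero: "\<forall>i<d. \<forall>j<d.
        (\<Sum>w\<in>perm_words d. lookup f w * foldr (*) (map X w) (1\<^sub>m d) $$ (i, j)) = 0"
      show "eval_mat d X f = 0\<^sub>m d d"
      proof (rule eq_matI)
        fix i j assume "i < dim_row (0\<^sub>m d d :: complex mat)" "j < dim_col (0\<^sub>m d d :: complex mat)"
        then have "i < d" "j < d" by simp_all
        with entry zero show "eval_mat d X f $$ (i, j) = 0\<^sub>m d d $$ (i, j)" by (simp only: index_zero_mat)
      qed (simp_all add: eval_mat_def)
    qed
  qed
  show ?thesis
  proof
    assume "f \<in> identities d \<rho>"
    then have "eval_mat d (\<lambda>i. \<rho> (A i)) f = 0\<^sub>m d d" if "\<forall>i\<in>{1..d}. A i \<in> sl2" for A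
      using Fd that by (simp add: identities_def)
    then show ?R by (simp only: ev) simp
  next
    assume R: ?R
    \<comment> \<open>A nonzero \<open>f\<close> has a word containing all letters up to
      \<open>d\<close>, which forces \<open>d \<le> m\<close>. The zero element lies in
      \<open>F_sub m\<close> for smaller \<open>m\<close> too and is treated apart.\<close>
    have "eval_mat d (\<lambda>i. \<rho> (A i)) f = 0\<^sub>m d d" if m: "f \<in> F_sub m" "\<forall>i\<in>{1..m}. A i \<in> sl2" for m A
    proof (cases "f = 0")
      case True
      then show ?thesis by (intro eq_matI) (simp_all add: eval_mat_def)
    next
      case False
      then obtain w where w: "w \<in> keys f" by (metis all_not_in_conv keys_eq_empty)
      have "set w \<subseteq> {1..m}" using m(1) w unfolding F_sub_def by blast
      with m(2) perm_wordsD(3)[OF subsetD[OF sub w]] have "\<forall>i\<in>{1..d}. A i \<in> sl2" by blast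
      with R show ?thesis by (simp only: ev) simp
    qed
    then show "f \<in> identities d \<rho>" using Fd by (auto simp: identities_def F_alg_def)
  qed
qed

lemma lookup_pushforward_map:
  assumes "g permutes {1..d}" shows "lookup (pushforward (map g) f) (map g w) = lookup f w"
  by (intro lookup_pushforward_inj inj_mapI permutes_inj[OF assms])

interpretation word_rep: pm_rep "sym_group d" "\<lambda>\<pi>. pushforward (map \<pi>)" for d
  by (rule pm_rep_pushforward) (auto simp: fun_eq_iff)

lemma invariant_multilinear: "word_rep.invariant d (pm_on (perm_words d))"
  unfolding word_rep.invariant_def sym_group_carrier
  using subspace_pm_on pushforward_pm_on[OF map_perm_words] by (auto simp: sym_group_carrier)

text \<open>Renaming the variables of \<open>f\<close> amounts to substituting
  \<open>A \<circ> g\<close> for \<open>A\<close>, and the condition ranges over all such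
  substitutions.\<close>

lemma invariant_identities: "word_rep.invariant d (identities d \<rho> \<inter> pm_on (perm_words d))"
proof -
  let ?W = "identities d \<rho> \<inter> pm_on (perm_words d)"
  let ?m = "\<lambda>A w. foldr (*) (map (\<lambda>i. \<rho> (A i)) w) (1\<^sub>m d)"
  have W: "f \<in> ?W \<longleftrightarrow> f \<in> pm_on (perm_words d) \<and> (\<forall>A. (\<forall>i\<in>{1..d}. A i \<in> sl2) \<longrightarrow>
      (\<forall>i<d. \<forall>j<d. (\<Sum>w\<in>perm_words d. lookup f w * ?m A w $$ (i, j)) = 0))" for f
    using identities_iff by blast
  have "pm.subspace ?W"
  proof (rule pm.subspaceI)
    show "0 \<in> ?W" unfolding W by (simp add: pm.subspace_0[OF subspace_pm_on])
  next
    fix f g assume "f \<in> ?W" "g \<in> ?W"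
    then show "f + g \<in> ?W" unfolding W
      by (simp add: pm.subspace_add[OF subspace_pm_on] lookup_add distrib_right sum.distrib)
  next
    fix c f assume "f \<in> ?W"
    then show "pm_scale c f \<in> ?W" unfolding W
      by (simp add: pm.subspace_scale[OF subspace_pm_on] lookup_pm_scale mult.assoc flip: sum_distrib_left)
  qed
  moreover have "pushforward (map g) f \<in> ?W" if g: "g permutes {1..d}" and f: "f \<in> ?W" for g f
    unfolding W
  proof (intro conjI allI impI)
    show "pushforward (map g) f \<in> pm_on (perm_words d)"
      using f pushforward_pm_on[OF map_perm_words[OF g]] by blast
    fix A i j assume A: "\<forall>i\<in>{1..d}. A i \<in> sl2" and ij: "i < d" "j < d"
    have inj: "inj_on (map g) (perm_words d)"
      by (rule inj_on_subset[OF inj_mapI[OF permutes_inj[OF g]]]) simp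
    have img: "map g ` perm_words d = perm_words d"
      using endo_inj_surj[OF finite_perm_words map_perm_words[OF g] inj] .
    have "(\<Sum>w\<in>perm_words d. lookup (pushforward (map g) f) w * ?m A w $$ (i, j))
        = (\<Sum>w\<in>map g ` perm_words d. lookup (pushforward (map g) f) w * ?m A w $$ (i, j))"
      unfolding img ..
    also have "\<dots> = (\<Sum>w\<in>perm_words d. lookup f w * ?m (A \<circ> g) w $$ (i, j))"
      unfolding sum.reindex[OF inj] by (simp add: lookup_pushforward_map[OF g] comp_def)
    also have "\<dots> = 0"
    proof -
      have "\<forall>i\<in>{1..d}. (A \<circ> g) i \<in> sl2" using A permutes_in_image[OF g] by auto
      with f ij show ?thesis unfolding W by blast
    qed
    finally show "(\<Sum>w\<in>perm_words d. lookup (pushforward (map g) f) w * ?m A w $$ (i, j)) = 0" .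
  qed
  ultimately show ?thesis by (auto simp: word_rep.invariant_def sym_group_carrier)
qed

text \<open>A permutation and its inverse have the same fixed points. This removes the inverse from
  the inner product.\<close>

lemma specht_char_hook_inv:
  assumes d: "d \<ge> 2" and g: "g \<in> carrier (sym_group d)"
  shows "specht_char [d - 1, 1] (inv\<^bsub>sym_group d\<^esub> g) = specht_char [d - 1, 1] g"
proof -
  let ?h = "inv\<^bsub>sym_group d\<^esub> g"
  have h: "?h \<in> carrier (sym_group d)" using g by (rule word_rep.inv_closed)
  have "g (?h i) = i" "?h (g i) = i" for i
    using fun_cong[OF word_rep.r_inv[OF g, unfolded sym_group_mult sym_group_one], of i]
      fun_cong[OF word_rep.l_inv[OF g, unfolded sym_group_mult sym_group_one], of i] by simp_all
  then have "?h i = i \<longleftrightarrow> g i = i" for i by metis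
  then show ?thesis
    using specht_char_hook[OF d] g h by (simp add: sym_group_carrier)
qed

section \<open>Evaluation of the multiplicity\<close>

theorem proposition4p1:
  fixes d :: nat and \<rho> :: "complex mat \<Rightarrow> complex mat"
  assumes "d \<ge> 2" and "irreducible_sl2_rep d \<rho>"
  shows "mult_sl2 [d - 1, 1] d \<rho> = d - 1"
proof -
  note d = assms(1) and One_nat_def [simp del]
  let ?G = "sym_group d" and ?P = "perm_words d" and ?\<psi> = "specht_char [d - 1, 1]"
  define V where "V = pm_on ?P"
  define W where "W = identities d \<rho> \<inter> V"
  define T :: "(nat \<Rightarrow> nat) \<Rightarrow> free_algebra \<Rightarrow> free_algebra" where "T g = pushforward (map g)" for g
  have fin: "finite (carrier ?G)" by (simp add: sym_group_def finite_permutations)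
  have inv: "word_rep.invariant d V" "word_rep.invariant d W"
    using invariant_multilinear[of d] invariant_identities[of d \<rho>] by (simp_all add: V_def W_def)
  have TV: "T g ` V \<subseteq> V" and TW: "T g ` W \<subseteq> W" if "g \<in> carrier ?G" for g
    using word_rep.invariantD[OF inv(1) that] word_rep.invariantD[OF inv(2) that] by (simp_all add: T_def)
  have linT: "pm_linear (T g)" for g by (simp add: T_def linear_pushforward)
  have subV: "pm.subspace V" and subW: "pm.subspace W" using inv by (simp_all add: word_rep.invariant_def)
  interpret VW: quotient_space V W using subV subW by unfold_locales (auto simp: W_def)
  interpret W0: quotient_space W "{0}"
    using subW subspace_zero pm.subspace_0[OF subW] by unfold_locales auto
  have span: "V \<subseteq> pm.span (pm_unit ` ?P)" by (simp add: V_def pm_on_span[OF finite_perm_words])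
  have finP: "finite (pm_unit ` ?P)" by (simp add: finite_perm_words)
  obtain bs where bs: "based_quotient V W bs" using VW.obtain_basis[OF finP span] .
  have "W \<subseteq> pm.span (pm_unit ` ?P)" using span by (auto simp: W_def)
  from W0.obtain_basis[OF finP this] obtain cs where cs: "based_quotient W {0} cs" .
  interpret A: based_quotient V W bs by (rule bs)
  interpret B: based_quotient W "{0}" cs by (rule cs)
  interpret C: based_quotient V "{0}" "cs @ bs" by (rule quotient_basis_append[OF cs bs])
  obtain M where M: "set_mset M \<subseteq> irr_chars ?G" "\<forall>g\<in>carrier ?G. quotient_trace V W (T g) = (\<Sum>\<phi>\<in>#M. \<phi> g)"
    using word_rep.quotient_char_sum_irr_chars[OF finP span bs inv] unfolding T_def by blast
  have \<psi>: "?\<psi> g = (\<Sum>i\<in>{1..d}. if g i = i then 1 else 0) - 1" if "g \<in> carrier ?G" for g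
    using specht_char_hook[OF d] that by (simp add: sym_group_carrier sum.If_cases Int_def)
  \<comment> \<open>Up to the factor d! / (d - 1) this is the projection onto the isotypic component
    of the hook.\<close>
  define E where "E v = (\<Sum>g\<in>carrier ?G. pm_scale (?\<psi> g) (T g v))" for v
  have E_lookup: "lookup (E v) w = (\<Sum>g\<in>carrier ?G. ?\<psi> g * lookup (T g v) w)" for v w
    by (simp add: E_def lookup_sum lookup_pm_scale)
  have trE: "quotient_trace V W E = (\<Sum>g\<in>carrier ?G. ?\<psi> g * quotient_trace V W (T g))"
    unfolding E_def by (rule A.quotient_trace_sum(1)[OF linT TV TW])
  have linE: "pm_linear E" and EV: "E ` V \<subseteq> V" and EW: "E ` W \<subseteq> W"
    unfolding E_def[abs_def] by (rule A.quotient_trace_sum(2-4)[OF linT TV TW]; assumption)+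
  have trans: "T (inv\<^bsub>?G\<^esub> g) v = w \<longleftrightarrow> v = T g w" if "g \<in> carrier ?G" for g v w
    using that word_rep.T_mult word_rep.T_one unfolding T_def by (metis word_rep.inv_closed word_rep.l_inv word_rep.r_inv)
  have E_zero: "E f = 0" if f: "f \<in> W" for f
  proof (rule poly_mapping_eqI)
    fix w
    have fV: "f \<in> V" and id: "f \<in> identities d \<rho>" using f by (auto simp: W_def)
    then have keys: "keys f \<subseteq> ?P" by (simp add: V_def pm_on_def)
    have zero: "(\<Sum>u\<in>?P. if u ! k = x then lookup f u else 0) = 0" if "x \<in> {1..d}" "k < d" for x k
    proof -
      have "(\<Sum>u\<in>?P. if u ! k = x then lookup f u else 0) = (\<Sum>u\<in>keys f. if u ! k = x then lookup f u else 0)"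
        using keys finite_perm_words by (intro sum.mono_neutral_right) (auto simp: in_keys_iff)
      also have "\<dots> = 0"
        by (rule identity_position_sums_zero[OF assms(2,1) id _ that]) (use keys perm_wordsD in blast)
      finally show ?thesis .
    qed
    show "lookup (E f) w = lookup 0 w"
    proof (cases "w \<in> ?P")
      case False
      have "E f \<in> V" using EV fV by blast
      with False show ?thesis by (simp add: V_def lookup_outside)
    next
      case w: True
      note bij = bij_betw_map_perm_words[OF w] and len = perm_wordsD(1)[OF w]
      \<comment> \<open>Passing to inverses lets the coefficient of \<open>f\<close> be read off at
        \<open>map g w\<close>, which runs once through all words.\<close>
      have "lookup (E f) w = (\<Sum>g\<in>carrier ?G. ?\<psi> (inv\<^bsub>?G\<^esub> g) * lookup (T (inv\<^bsub>?G\<^esub> g) f) w)"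
        unfolding E_lookup
        by (rule sum.reindex_bij_witness[of _ "\<lambda>g. inv\<^bsub>?G\<^esub> g" "\<lambda>g. inv\<^bsub>?G\<^esub> g"]) auto
      also have "\<dots> = (\<Sum>g\<in>carrier ?G. ?\<psi> g * lookup f (map g w))"
      proof (intro sum.cong refl arg_cong2[of _ _ _ _ "(*)"] specht_char_hook_inv[OF d])
        fix g assume g: "g \<in> carrier ?G"
        have "T g (T (inv\<^bsub>?G\<^esub> g) f) = f"
          using trans[OF g, of f "T (inv\<^bsub>?G\<^esub> g) f"] by metis
        then have "lookup f (map g w) = lookup (T g (T (inv\<^bsub>?G\<^esub> g) f)) (map g w)" by simp
        also have "\<dots> = lookup (T (inv\<^bsub>?G\<^esub> g) f) w"
          using g unfolding T_def by (intro lookup_pushforward_map) (simp add: sym_group_carrier)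
        finally show "lookup (T (inv\<^bsub>?G\<^esub> g) f) w = lookup f (map g w)" by simp
      qed
      also have "\<dots> = (\<Sum>g\<in>carrier ?G. (\<Sum>i\<in>{1..d}. if g i = i then lookup f (map g w) else 0) - lookup f (map g w))"
        by (intro sum.cong refl) (simp add: \<psi> left_diff_distrib sum_distrib_right if_distrib[of "\<lambda>x. x * _"] cong: if_cong)
      also have "\<dots> = (\<Sum>i\<in>{1..d}. \<Sum>g\<in>carrier ?G. if g i = i then lookup f (map g w) else 0)
          - (\<Sum>g\<in>carrier ?G. lookup f (map g w))"
        unfolding sum_subtractf by (subst sum.swap) simp
      also have "(\<Sum>g\<in>carrier ?G. lookup f (map g w)) = (\<Sum>u\<in>?P. lookup f u)"
        by (rule sum.reindex_bij_betw[OF bij])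
      \<comment> \<open>Every word has exactly one first letter, so the total sum of coefficients
        splits into sums for place 0.\<close>
      also have "\<dots> = (\<Sum>u\<in>?P. \<Sum>x\<in>{1..d}. if u ! 0 = x then lookup f u else 0)"
      proof (intro sum.cong refl)
        fix u assume "u \<in> ?P"
        then have "u ! 0 \<in> {1..d}" using perm_wordsD[of u d] d nth_mem[of 0 u] by auto
        then show "lookup f u = (\<Sum>x\<in>{1..d}. if u ! 0 = x then lookup f u else 0)" by simp
      qed
      also have "\<dots> = (\<Sum>x\<in>{1..d}. \<Sum>u\<in>?P. if u ! 0 = x then lookup f u else 0)" by (rule sum.swap)
      also have "\<dots> = 0" by (rule sum.neutral) (use zero d in auto)
      also have "(\<Sum>i\<in>{1..d}. \<Sum>g\<in>carrier ?G. if g i = i then lookup f (map g w) else 0) = 0"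
      proof (rule sum.neutral, rule ballI)
        fix i assume i: "i \<in> {1..d}"
        \<comment> \<open>If \<open>i\<close> stands in place \<open>k\<close> of \<open>w\<close>,
          then \<open>g\<close> fixes \<open>i\<close> exactly when \<open>map g w\<close> has
          \<open>i\<close> in that place too.\<close>
        then obtain k where k: "k < d" "w ! k = i" using perm_wordsD[OF w] by (metis in_set_conv_nth)
        have "(\<Sum>g\<in>carrier ?G. if g i = i then lookup f (map g w) else 0)
            = (\<Sum>g\<in>carrier ?G. if map g w ! k = i then lookup f (map g w) else 0)"
          using k len by (intro sum.cong refl) simp
        also have "\<dots> = (\<Sum>u\<in>?P. if u ! k = i then lookup f u else 0)"
          by (rule sum.reindex_bij_betw[OF bij])
        also have "\<dots> = 0" by (rule zero[OF i k(1)])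
        finally show "(\<Sum>g\<in>carrier ?G. if g i = i then lookup f (map g w) else 0) = 0" .
      qed
      finally show ?thesis by simp
    qed
  qed
  have "quotient_trace W {0} E = B.trace E"
    by (rule B.quotient_trace_eq[OF linE EW]) (simp add: E_zero W0.W_le_V[THEN subsetD])
  also have "\<dots> = 0"
    unfolding B.trace_def by (intro sum.neutral ballI) (simp add: E_zero B.bs_in_V B.coord_in_W)
  finally have trW: "quotient_trace W {0} E = 0" .
  have "quotient_trace V {0} E = (\<Sum>w\<in>?P. lookup (E (pm_unit w)) w)"
    using EV unfolding V_def by (intro quotient_trace_pm_on finite_perm_words linE)
  also have "\<dots> = (\<Sum>w\<in>?P. of_nat (d - 1))"
  proof (intro sum.cong refl)
    fix w assume w: "w \<in> ?P"
    \<comment> \<open>The action on words is free, so only the identity contributes to the diagonal,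
      with value \<open>d - 1\<close>.\<close>
    have fix_iff: "map g w = w \<longleftrightarrow> g = id" if g: "g \<in> carrier ?G" for g
    proof
      assume "map g w = w"
      with bij_betw_imp_inj_on[OF bij_betw_map_perm_words[OF w]] g word_rep.one_closed
      show "g = id" unfolding sym_group_one inj_on_def by (metis list.map_id)
    qed simp
    have "lookup (E (pm_unit w)) w = (\<Sum>g\<in>carrier ?G. if g = id then ?\<psi> g else 0)"
      unfolding E_lookup by (intro sum.cong refl) (simp add: T_def pushforward_single lookup_single when_def fix_iff)
    also have "\<dots> = ?\<psi> id" using fin word_rep.one_closed by (simp add: sym_group_one)
    also have "\<dots> = of_nat (d - 1)"
      using \<psi>[of id] word_rep.one_closed d by (simp add: sym_group_one of_nat_diff)
    finally show "lookup (E (pm_unit w)) w = of_nat (d - 1)" .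
  qed
  also have "\<dots> = of_nat ((d - 1) * card (carrier ?G))"
  proof -
    have "[1..<Suc d] \<in> ?P" unfolding perm_words_def by (rule image_eqI[of _ _ id]) (simp_all add: permutes_id)
    from bij_betw_same_card[OF bij_betw_map_perm_words[OF this]] show ?thesis by simp
  qed
  \<comment> \<open>As the trace on \<open>W\<close> is zero, the whole trace on \<open>V\<close>
    belongs to the quotient.\<close>
  also have "quotient_trace V {0} E = quotient_trace W {0} E + quotient_trace V W E"
    using EV EW E_zero[OF pm.subspace_0[OF subW]] by (intro quotient_trace_additive[OF cs bs linE]) auto
  finally have "(\<Sum>g\<in>carrier ?G. quotient_trace V W (T g) * ?\<psi> (inv\<^bsub>?G\<^esub> g)) = of_nat ((d - 1) * card (carrier ?G))"
    using trW trE by (simp add: specht_char_hook_inv[OF d] mult.commute cong: sum.cong)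
  then have "char_mult ?G ?\<psi> (\<lambda>g. quotient_trace V W (T g)) = d - 1"
    using M by (intro word_rep.char_mult_eq[OF M(1) specht_char_hook_irr[OF d] fin]) auto
  \<comment> \<open>\<open>multilinear_char\<close> is \<open>undefined\<close> off the group, but
    \<open>char_mult\<close> inspects values on the carrier alone.\<close>
  moreover have "char_mult ?G ?\<psi> (\<lambda>g. quotient_trace V W (T g)) = char_mult ?G ?\<psi> (multilinear_char d \<rho> d)"
    unfolding char_mult_def multilinear_char_def
    by (simp add: multilinear_eq V_def W_def T_def cong: ball_cong)
  ultimately show ?thesis using d by (simp add: mult_sl2_def)
qed

end
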